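(* Assume (H1), (H2), that $P\in\Upsilon([0,T];\mathbb S^n)$ is a relaxed compensator, and that the Riccati equation for $\Sigma$ (given in the context) admits a unique solution $\Sigma\in C([0,T];\mathbb R^{n\times n})$. For any initial value $x\in\mathbb R^n$, any $1\le i\le N$ and any $u^i\in\mathscr U^i_c$ (agents $j\ne i$ using the decentralized strategies $\bar u^j$ described in the context), $$\mathcal J_i(u^i,\bar u^{-i})=\mathcal J^P_i(u^i,\bar u^{-i})+\tfrac12\langle P_0x,x\rangle .$$ Here $$\begin{aligned}\mathcal J^P_i(u^i,\bar u^{-i})=\tfrac12\mathbb E\Big[\int_0^T\big\{&\langle Q^P_tx^i_t+2\tilde q^P_t+2S^P_tu^i_t,x^i_t\rangle+\langle R^P_tu^i_t+2\tilde r^P_t,u^i_t\rangle+\langle\tilde Q^P_tx^{(N)}_t,x^{(N)}_t\rangle\\&+2\langle\bar Q^P_tx^i_t+\bar r^P_tu^i_t+\bar q^P_t,x^{(N)}_t\rangle+\langle\tilde R^P_tu^{(N)}_t,u^{(N)}_t\rangle+2\langle\hat Q^P_tx^i_t+\hat r^P_tu^i_t+\hat q^P_t,u^{(N)}_t\rangle\\&+\tilde M^P_t+2\langle\tilde S^P_tu^{(N)}_t,x^{(N)}_t\rangle\big\}\mathrm dt+\langle L^P_Tx^i_T+2l_T,x^i_T\rangle-2\alpha_3\langle L_Tx^i_T+l_T,x^{(N)}_T\rangle+\alpha_3^2\langle L_Tx^{(N)}_T,x^{(N)}_T\rangle\Big],\end{aligned}$$ with $Q^P=Q+\dot P+PA+A^\top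 P+D^\top PD$, $S^P=S+PB+D^\top PF$, $R^P=R+F^\top PF$, $L^P_T=L_T-P_T$, $\tilde Q^P=\alpha_1^2Q+\bar D^\top P\bar D$, $\bar Q^P=-\alpha_1Q+\bar A^\top P+\bar D^\top PD$, $\tilde q^P=q+Pb+D^\top P\bar b$, $\bar q^P=-\alpha_1q+\bar D^\top P\bar b$, $\hat Q^P=-\beta_2S^\top+\bar B^\top P+\bar F^\top PD$, $\tilde S^P=\bar D^\top P\bar F+\alpha_2\beta_2S$, $\tilde R^P=\beta_1^2R+\bar F^\top P\bar F$, $\tilde r^P=r+F^\top P\bar b$, $\bar r^P=-\alpha_2S+\bar D^\top PF$, $\hat q^P=\bar F^\top P\bar b-\beta_1r$, $\hat r^P=\bar F^\top PF-\beta_1R$, $\tilde M^P=\bar b^\top P\bar b+\mathrm{tr}(\sigma^\top P\sigma)+\mathrm{tr}(\bar\sigma^\top P\bar\sigma)$.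
   Context: Probability setting. $T\ge0$; $(\Omega,\mathscr F,\{\mathscr F_t\}_{0\le t\le T},\mathbb P)$ is a complete filtered probability space carrying independent standard Brownian motions $W^i,\overline W^i$ ($d$-dimensional, $1\le i\le N$) and $W^0$ (one-dimensional). All generated filtrations are augmented by the $\mathbb P$-null sets. (H1): $A,\bar A,D,\bar D,G,\bar G\in L^\infty([0,T];\mathbb R^{n\times n})$; $b,\bar b,\tilde b\in L^\infty([0,T];\mathbb R^n)$; $\sigma,\bar\sigma,\tilde\sigma\in L^2([0,T];\mathbb R^{n\times d})$; $B,\bar B,F,\bar F,H,\bar H\in L^\infty([0,T];\mathbb R^{n\times m})$; $I,\check b,\check\sigma\in L^\infty([0,T];\mathbb R)$ with $\check\sigma$ non-degenerate (nonzero for a.e. $t$); $x\in\mathbb R^n$ constant (all deterministic). (H2): $Q\in L^\infty([0,T];\mathbb S^n)$, $R\in L^\infty([0,T];\mathbb S^m)$, $S\in L^\infty([0,T];\mathbb R^{n\times m})$, $q\in L^\infty([0,T];\mathbb R^n)$, $r\in L^\infty([0,T];\mathbb R^m)$, $L_T\in\mathbb S^n$, $l_T\in\mathbb R^n$, $\alpha_1,\alpha_2,\alpha_3,\beta_1,\beta_2\in\mathbb R$. No definiteness is assumed. $N$-agent game. With $x^{(N)}=\frac1N\sum_kx^k$, $u^{(N)}=\frac1N\sum_ku^k$, for every agent $k$: $\mathrm dx^k_t=(A_tx^k_t+B_tu^k_t+\bar A_tx^{(N)}_t+\bar B_tu^{(N)}_t+b_t)\mathrm dt+\sigma_t\mathrm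 dW^k_t+(D_tx^k_t+F_tu^k_t+\bar D_tx^{(N)}_t+\bar F_tu^{(N)}_t+\bar b_t)\mathrm dW^0_t+\bar\sigma_t\mathrm d\overline W^k_t$, $x^k_0=x$; $\mathrm dy^k_t=(G_tx^k_t+H_tu^k_t+\bar G_tx^{(N)}_t+\bar H_tu^{(N)}_t+\tilde b_t)\mathrm dt+\tilde\sigma_t\mathrm d\overline W^k_t$, $y^k_0=0$; $\mathrm d\theta_t=(I_t\theta_t+\check b_t)\mathrm dt+\check\sigma_t\mathrm dW^0_t$, $\theta_0=0$. In the claim $u^j=\bar u^j$ for $j\ne i$. Cost: $\mathcal J_i(u^i,u^{-i})=\frac12\mathbb E[\int_0^T\{\langle Q_t(x^i_t-\alpha_1x^{(N)}_t)+2q_t,x^i_t-\alpha_1x^{(N)}_t\rangle+\langle R_t(u^i_t-\beta_1u^{(N)}_t)+2r_t,u^i_t-\beta_1u^{(N)}_t\rangle+2\langle S_t(u^i_t-\beta_2u^{(N)}_t),x^i_t-\alpha_2x^{(N)}_t\rangle\}\mathrm dt+\langle L_T(x^i_T-\alpha_3x^{(N)}_T)+2l_T,x^i_T-\alpha_3x^{(N)}_T\rangle]$. Centralized admissible set: let $\mathrm dx^{k,0}_t=(A_tx^{k,0}_t+\bar A_tx^{(N)}_{0,t})\mathrm dt+(D_tx^{k,0}_t+\bar D_tx^{(N)}_{0,t})\mathrm dW^0_t+\sigma_t\mathrm dW^k_t+\bar\sigma_t\mathrm d\overline W^k_t$, $x^{k,0}_0=x$, $\mathrm dy^{k,0}_t=(G_tx^{k,0}_t+\bar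 G_tx^{(N)}_{0,t})\mathrm dt+\tilde\sigma_t\mathrm d\overline W^k_t$, $y^{k,0}_0=0$, $x^{(N)}_0=\frac1N\sum_kx^{k,0}$; $\mathscr F^{y^0}_t=\sigma\{y^{k,0}_s,\theta_s:1\le k\le N,s\le t\}$, $\mathscr F^y_t=\sigma\{y^k_s,\theta_s:1\le k\le N,s\le t\}$. $\mathscr U^i_c$: $\mathbb R^m$-valued processes that are both $\mathscr F^{y^0}$- and $\mathscr F^y$-adapted with $\mathbb E\sup_t|u^i_t|^2<\infty$. Relaxed compensator. $\Upsilon([0,T];\mathbb S^n)$: absolutely continuous $P:[0,T]\to\mathbb S^n$ (symmetric matrices). $P$ is a relaxed compensator if $\begin{pmatrix}Q^P&S^P\\(S^P)^\top&R^P\end{pmatrix}\ge0$, $R^P\gg0$, $L^P_T\ge0$ ($M\gg0$: $M_t\ge\lambda_0\mathrm{Id}$ for some $\lambda_0>0$ and (almost) all $t$). Riccati equations. $\dot\Pi+\Pi A+A^\top\Pi+D^\top\Pi D+Q-\widetilde\Pi\mathcal R^{-1}\widetilde\Pi^\top=0$, $\Pi_T=L_T$, $\mathcal R=R+F^\top\Pi F\gg0$, $\widetilde\Pi=\Pi B+D^\top\Pi F+S$ (uniquely solvable when a relaxed compensator exists). $\dot\Sigma+\Sigma(A+\bar A)+A^\top\Sigma+D^\top\Sigma(D+\bar D)-\widetilde\Sigma\widetilde{\mathcal R}^{-1}\bar\Sigma^\top+(1-\alpha_1)Q=0$, $\Sigma_T=(1-\alpha_3)L_T$, $\widetilde{\mathcal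 R}+\widetilde{\mathcal R}^\top\gg0$, where $\widetilde{\mathcal R}=(1-\beta_1)R+F^\top\Sigma(F+\bar F)$, $\widetilde\Sigma=\Sigma(B+\bar B)+D^\top\Sigma(F+\bar F)+(1-\beta_2)S$, $\bar\Sigma^\top=B^\top\Sigma+F^\top\Sigma(D+\bar D)+(1-\alpha_2)S^\top$. $\dot\rho+A^\top\rho-\widetilde\Sigma\widetilde{\mathcal R}^{-1}\tilde\rho+\Sigma b+D^\top\Sigma\bar b+q=0$, $\rho_T=l_T$, $\tilde\rho=B^\top\rho+F^\top\Sigma\bar b+r$. Decentralized strategies. $\mathrm dx^0_t=[(A_t+\bar A_t)x^0_t+(B_t+\bar B_t)u^0_t+b_t]\mathrm dt+[(D_t+\bar D_t)x^0_t+(F_t+\bar F_t)u^0_t+\bar b_t]\mathrm dW^0_t$, $x^0_0=x$, $u^0_t=-\widetilde{\mathcal R}_t^{-1}(\bar\Sigma_t^\top x^0_t+\tilde\rho_t)$; $\bar u^j_t=-\mathcal R_t^{-1}\widetilde\Pi_t^\top(\hat{\bar X}^j_t-x^0_t)-\widetilde{\mathcal R}_t^{-1}(\bar\Sigma_t^\top x^0_t+\tilde\rho_t)$, where $\hat{\bar X}^j_t=\mathbb E[\bar X^j_t|\sigma\{\bar Y^j_s,\theta_s:s\le t\}]$, $\mathrm d\bar X^j_t=(A_t\bar X^j_t+B_t\bar u^j_t+\bar A_tx^0_t+\bar B_tu^0_t+b_t)\mathrm dt+\sigma_t\mathrm dW^j_t+(D_t\bar X^j_t+F_t\bar u^j_t+\bar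 D_tx^0_t+\bar F_tu^0_t+\bar b_t)\mathrm dW^0_t+\bar\sigma_t\mathrm d\overline W^j_t$, $\bar X^j_0=x$, $\mathrm d\bar Y^j_t=(G_t\bar X^j_t+H_t\bar u^j_t+\bar G_tx^0_t+\bar H_tu^0_t+\tilde b_t)\mathrm dt+\tilde\sigma_t\mathrm d\overline W^j_t$, $\bar Y^j_0=0$. *)

theory Defs
  imports "HOL-Probability.Probability"
begin

definition Linf :: "real \<Rightarrow> (real \<Rightarrow> 'a::euclidean_space) \<Rightarrow> bool" where
  "Linf T f \<longleftrightarrow> f \<in> borel_measurable (lebesgue_on {0..T}) \<and>
     (\<exists>C. AE t in lebesgue_on {0..T}. norm (f t) \<le> C)"

definition Ltwo :: "real \<Rightarrow> (real \<Rightarrow> 'a::euclidean_space) \<Rightarrow> bool" where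
  "Ltwo T f \<longleftrightarrow> f \<in> borel_measurable (lebesgue_on {0..T}) \<and>
     integrable (lebesgue_on {0..T}) (\<lambda>t. (norm (f t))\<^sup>2)"

definition psd :: "real^'n^'n \<Rightarrow> bool" where
  "psd M \<longleftrightarrow> transpose M = M \<and> (\<forall>v. 0 \<le> v \<bullet> (M *v v))"

definition unif_pd :: "real \<Rightarrow> (real \<Rightarrow> real^'n^'n) \<Rightarrow> bool" where
  "unif_pd T M \<longleftrightarrow> (\<exists>l>0. AE t in lebesgue_on {0..T}. psd (M t - l *\<^sub>R mat 1))"

definition block_mat ::
  "real^'n^'n \<Rightarrow> real^'m^'n \<Rightarrow> real^'n^'m \<Rightarrow> real^'m^'m \<Rightarrow> real^('n + 'm)^('n + 'm)" where
  "block_mat M11 M12 M21 M22 = (\<chi> a b. case a of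
       Inl i \<Rightarrow> (case b of Inl j \<Rightarrow> M11 $ i $ j | Inr j \<Rightarrow> M12 $ i $ j)
     | Inr i \<Rightarrow> (case b of Inl j \<Rightarrow> M21 $ i $ j | Inr j \<Rightarrow> M22 $ i $ j))"

definition abs_cont_on :: "real \<Rightarrow> real \<Rightarrow> (real \<Rightarrow> 'a::real_normed_vector) \<Rightarrow> bool" where
  "abs_cont_on a b f \<longleftrightarrow> (\<forall>e>0. \<exists>d>0. \<forall>(p::nat) l r.
     (\<forall>k<p. a \<le> l k \<and> l k \<le> r k \<and> r k \<le> b) \<and>
     (\<forall>j<p. \<forall>k<p. j \<noteq> k \<longrightarrow> {l j<..<r j} \<inter> {l k<..<r k} = {}) \<and>
     (\<Sum>k<p. r k - l k) < d
     \<longrightarrow> (\<Sum>k<p. norm (f (r k) - f (l k))) < e)"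

text \<open>The derivative of an absolutely continuous function exists only almost everywhere;
  \<open>f'\<close> is any function that agrees with it almost everywhere.\<close>

definition abs_cont_deriv ::
  "real \<Rightarrow> (real \<Rightarrow> 'a::real_normed_vector) \<Rightarrow> (real \<Rightarrow> 'a) \<Rightarrow> bool" where
  "abs_cont_deriv T f f' \<longleftrightarrow> abs_cont_on 0 T f \<and>
     (AE t in lebesgue_on {0..T}. (f has_vector_derivative f' t) (at t))"

definition avg :: "nat \<Rightarrow> (nat \<Rightarrow> 'a::real_vector) \<Rightarrow> 'a" where
  "avg N z = (1 / real N) *\<^sub>R (\<Sum>k=1..N. z k)"

definition filtered_space :: "'w measure \<Rightarrow> (real \<Rightarrow> 'w measure) \<Rightarrow> real \<Rightarrow> bool" where
  "filtered_space M F T \<longleftrightarrow> prob_space M \<and> complete_measure M \<and>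
     (\<forall>t\<in>{0..T}. subalgebra M (F t)) \<and>
     (\<forall>s t. 0 \<le> s \<and> s \<le> t \<and> t \<le> T \<longrightarrow> sets (F s) \<subseteq> sets (F t)) \<and>
     null_sets M \<subseteq> sets (F 0)"

definition meas_adapted ::
  "'w measure \<Rightarrow> (real \<Rightarrow> 'w measure) \<Rightarrow> real \<Rightarrow> (real \<Rightarrow> 'w \<Rightarrow> 'a::euclidean_space) \<Rightarrow> bool" where
  "meas_adapted M F T X \<longleftrightarrow>
     (\<lambda>(t, \<omega>). X t \<omega>) \<in> borel_measurable (lebesgue_on {0..T} \<Otimes>\<^sub>M M) \<and>
     (\<forall>t\<in>{0..T}. X t \<in> borel_measurable (F t))"

text \<open>For jointly measurable \<open>X\<close> the supremum is measurable because \<open>M\<close> is complete; no separability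
  of the paths has to be assumed.\<close>

definition sup_sq_finite ::
  "'w measure \<Rightarrow> real \<Rightarrow> (real \<Rightarrow> 'w \<Rightarrow> 'a::euclidean_space) \<Rightarrow> bool" where
  "sup_sq_finite M T X \<longleftrightarrow>
     (\<integral>\<^sup>+\<omega>. (SUP t\<in>{0..T}. ennreal ((norm (X t \<omega>))\<^sup>2)) \<partial>M) < \<infinity>"

text \<open>A finite family of real Brownian motions relative to \<open>F\<close> that together form one
  multidimensional standard \<open>F\<close>-Brownian motion: increments over \<open>(s, t]\<close> are centred normal
  with variance \<open>t - s\<close>, mutually independent, and jointly independent of \<open>F s\<close>
  (which carries the index \<open>None\<close>).\<close>

definition brownian_family ::
  "'w measure \<Rightarrow> (real \<Rightarrow> 'w measure) \<Rightarrow> real \<Rightarrow> 'j set \<Rightarrow> ('j \<Rightarrow> real \<Rightarrow> 'w \<Rightarrow> real) \<Rightarrow> bool" where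
  "brownian_family M F T J B \<longleftrightarrow>
     (\<forall>j\<in>J. (AE \<omega> in M. B j 0 \<omega> = 0) \<and>
            (AE \<omega> in M. continuous_on {0..T} (\<lambda>t. B j t \<omega>)) \<and>
            meas_adapted M F T (B j)) \<and>
     (\<forall>s t. 0 \<le> s \<and> s < t \<and> t \<le> T \<longrightarrow>
        (\<forall>j\<in>J. distributed M lborel (\<lambda>\<omega>. B j t \<omega> - B j s \<omega>)
                  (\<lambda>z. ennreal (normal_density 0 (sqrt (t - s)) z))) \<and>
        prob_space.indep_sets M
          (\<lambda>a. case a of
               None \<Rightarrow> sets (F s)
             | Some j \<Rightarrow> {(\<lambda>\<omega>. B j t \<omega> - B j s \<omega>) -` A \<inter> space M | A. A \<in> sets borel})
          (insert None (Some ` J)))"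

text \<open>A simple integrand is given by a partition \<open>\<tau> 0 \<le> \<dots> \<le> \<tau> p\<close> of a part of \<open>[0, T]\<close> and by
  the bounded \<open>F (\<tau> l)\<close>-measurable values \<open>\<xi> l\<close> taken on \<open>(\<tau> l, \<tau> (l + 1)]\<close>.\<close>

definition simple_integrand ::
  "'w measure \<Rightarrow> (real \<Rightarrow> 'w measure) \<Rightarrow> real \<Rightarrow> nat \<Rightarrow> (nat \<Rightarrow> real) \<Rightarrow>
   (nat \<Rightarrow> 'w \<Rightarrow> 'a::euclidean_space) \<Rightarrow> bool" where
  "simple_integrand M F T p \<tau> \<xi> \<longleftrightarrow> 0 \<le> \<tau> 0 \<and> \<tau> p \<le> T \<and> (\<forall>l<p. \<tau> l \<le> \<tau> (Suc l)) \<and>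
     (\<forall>l<p. \<xi> l \<in> borel_measurable (F (\<tau> l)) \<and> (\<exists>C. \<forall>\<omega>\<in>space M. norm (\<xi> l \<omega>) \<le> C))"

definition simple_process ::
  "nat \<Rightarrow> (nat \<Rightarrow> real) \<Rightarrow> (nat \<Rightarrow> 'w \<Rightarrow> 'a::euclidean_space) \<Rightarrow> real \<Rightarrow> 'w \<Rightarrow> 'a" where
  "simple_process p \<tau> \<xi> t \<omega> = (\<Sum>l<p. indicator {\<tau> l<..\<tau> (Suc l)} t *\<^sub>R \<xi> l \<omega>)"

definition simple_integral ::
  "(real \<Rightarrow> 'w \<Rightarrow> real) \<Rightarrow> nat \<Rightarrow> (nat \<Rightarrow> real) \<Rightarrow> (nat \<Rightarrow> 'w \<Rightarrow> 'a::euclidean_space) \<Rightarrow>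
   real \<Rightarrow> 'w \<Rightarrow> 'a" where
  "simple_integral W p \<tau> \<xi> t \<omega> =
     (\<Sum>l<p. (W (min (\<tau> (Suc l)) t) \<omega> - W (min (\<tau> l) t) \<omega>) *\<^sub>R \<xi> l \<omega>)"

text \<open>\<open>I\<close> is a continuous version of \<open>\<integral>\<^sub>0\<^sup>t \<phi> dW\<close> for a square-integrable measurable adapted \<open>\<phi>\<close>:
  the \<open>L\<^sup>2\<close>-limit of the elementary integrals of simple integrands that approximate \<open>\<phi>\<close> in
  \<open>L\<^sup>2(dt \<otimes> dP)\<close>. These conditions determine \<open>I\<close> up to indistinguishability.\<close>

definition ito_integral ::
  "'w measure \<Rightarrow> (real \<Rightarrow> 'w measure) \<Rightarrow> real \<Rightarrow> (real \<Rightarrow> 'w \<Rightarrow> real) \<Rightarrow>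
   (real \<Rightarrow> 'w \<Rightarrow> 'a::euclidean_space) \<Rightarrow> (real \<Rightarrow> 'w \<Rightarrow> 'a) \<Rightarrow> bool" where
  "ito_integral M F T W \<phi> I \<longleftrightarrow>
     meas_adapted M F T \<phi> \<and>
     (\<integral>\<^sup>+\<omega>. (\<integral>\<^sup>+t. ennreal ((norm (\<phi> t \<omega>))\<^sup>2) \<partial>lebesgue_on {0..T}) \<partial>M) < \<infinity> \<and>
     meas_adapted M F T I \<and> (AE \<omega> in M. continuous_on {0..T} (\<lambda>t. I t \<omega>)) \<and>
     (\<exists>p \<tau> \<xi>. (\<forall>n. simple_integrand M F T (p n) (\<tau> n) (\<xi> n)) \<and>
        (\<lambda>n. \<integral>\<^sup>+\<omega>. (\<integral>\<^sup>+t. ennreal ((norm (\<phi> t \<omega> - simple_process (p n) (\<tau> n) (\<xi> n) t \<omega>))\<^sup>2)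
                \<partial>lebesgue_on {0..T}) \<partial>M) \<longlonglongrightarrow> 0 \<and>
        (\<forall>t\<in>{0..T}. (\<lambda>n. \<integral>\<^sup>+\<omega>. ennreal ((norm (I t \<omega> -
            simple_integral W (p n) (\<tau> n) (\<xi> n) t \<omega>))\<^sup>2) \<partial>M) \<longlonglongrightarrow> 0))"

text \<open>\<open>dX = a dt + \<Sum>j\<in>J. c j dB j\<close> with \<open>X 0 = x0\<close>, where \<open>X\<close> lies in the usual solution space
  of continuous adapted processes with \<open>E sup |X|\<^sup>2 < \<infinity>\<close>. Equations whose coefficients depend on
  \<open>X\<close> are stated by letting \<open>a\<close> and \<open>c\<close> mention \<open>X\<close>.\<close>

definition ito_process ::
  "'w measure \<Rightarrow> (real \<Rightarrow> 'w measure) \<Rightarrow> real \<Rightarrow> ('j \<Rightarrow> real \<Rightarrow> 'w \<Rightarrow> real) \<Rightarrow> 'j set \<Rightarrow>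
   'a::euclidean_space \<Rightarrow> (real \<Rightarrow> 'w \<Rightarrow> 'a) \<Rightarrow> ('j \<Rightarrow> real \<Rightarrow> 'w \<Rightarrow> 'a) \<Rightarrow>
   (real \<Rightarrow> 'w \<Rightarrow> 'a) \<Rightarrow> bool" where
  "ito_process M F T B J x0 a c X \<longleftrightarrow>
     meas_adapted M F T X \<and> (AE \<omega> in M. continuous_on {0..T} (\<lambda>t. X t \<omega>)) \<and>
     sup_sq_finite M T X \<and>
     meas_adapted M F T a \<and> (AE \<omega> in M. integrable (lebesgue_on {0..T}) (\<lambda>t. a t \<omega>)) \<and>
     (\<exists>I. (\<forall>j\<in>J. ito_integral M F T (B j) (c j) (I j)) \<and>
        (AE \<omega> in M. \<forall>t\<in>{0..T}.
           X t \<omega> = x0 + (LINT s|lebesgue_on {0..t}. a s \<omega>) + (\<Sum>j\<in>J. I j t \<omega>)))"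

text \<open>The filtration generated by \<open>Y k\<close> (\<open>k \<in> K\<close>) and \<open>\<theta>\<close>, augmented by the null sets.\<close>

definition obs_filt ::
  "'w measure \<Rightarrow> nat set \<Rightarrow> (nat \<Rightarrow> real \<Rightarrow> 'w \<Rightarrow> 'a::euclidean_space) \<Rightarrow>
   (real \<Rightarrow> 'w \<Rightarrow> real) \<Rightarrow> real \<Rightarrow> 'w measure" where
  "obs_filt M K Y \<theta> t = sigma (space M)
     ({Y k s -` A \<inter> space M | k s A. k \<in> K \<and> s \<in> {0..t} \<and> A \<in> sets borel} \<union>
      {\<theta> s -` A \<inter> space M | s A. s \<in> {0..t} \<and> A \<in> sets borel} \<union> null_sets M)"

definition cond_exp_vec ::
  "'w measure \<Rightarrow> 'w measure \<Rightarrow> ('w \<Rightarrow> real^'n) \<Rightarrow> 'w \<Rightarrow> real^'n" where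
  "cond_exp_vec M G X \<omega> = (\<chi> r. real_cond_exp M G (\<lambda>\<omega>'. X \<omega>' $ r) \<omega>)"

record ('n, 'm, 'd) lq_data =
  Ac :: "real \<Rightarrow> real^'n^'n"
  Abar :: "real \<Rightarrow> real^'n^'n"
  Bc :: "real \<Rightarrow> real^'m^'n"
  Bbar :: "real \<Rightarrow> real^'m^'n"
  Dc :: "real \<Rightarrow> real^'n^'n"
  Dbar :: "real \<Rightarrow> real^'n^'n"
  Fc :: "real \<Rightarrow> real^'m^'n"
  Fbar :: "real \<Rightarrow> real^'m^'n"
  Gc :: "real \<Rightarrow> real^'n^'n"
  Gbar :: "real \<Rightarrow> real^'n^'n"
  Hc :: "real \<Rightarrow> real^'m^'n"
  Hbar :: "real \<Rightarrow> real^'m^'n"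
  bc :: "real \<Rightarrow> real^'n"
  bbar :: "real \<Rightarrow> real^'n"
  btilde :: "real \<Rightarrow> real^'n"
  sig :: "real \<Rightarrow> real^'d^'n"
  sigbar :: "real \<Rightarrow> real^'d^'n"
  sigtilde :: "real \<Rightarrow> real^'d^'n"
  Ic :: "real \<Rightarrow> real"
  bcheck :: "real \<Rightarrow> real"
  sigcheck :: "real \<Rightarrow> real"
  Qc :: "real \<Rightarrow> real^'n^'n"
  Rc :: "real \<Rightarrow> real^'m^'m"
  Sc :: "real \<Rightarrow> real^'m^'n"
  qc :: "real \<Rightarrow> real^'n"
  rc :: "real \<Rightarrow> real^'m"
  LT :: "real^'n^'n"
  lT :: "real^'n"
  alpha1 :: real
  alpha2 :: real
  alpha3 :: real
  beta1 :: real
  beta2 :: real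

definition H1 :: "real \<Rightarrow> ('n::finite, 'm::finite, 'd::finite) lq_data \<Rightarrow> bool" where
  "H1 T c \<longleftrightarrow>
     Linf T (Ac c) \<and> Linf T (Abar c) \<and> Linf T (Dc c) \<and> Linf T (Dbar c) \<and>
     Linf T (Gc c) \<and> Linf T (Gbar c) \<and>
     Linf T (bc c) \<and> Linf T (bbar c) \<and> Linf T (btilde c) \<and>
     Ltwo T (sig c) \<and> Ltwo T (sigbar c) \<and> Ltwo T (sigtilde c) \<and>
     Linf T (Bc c) \<and> Linf T (Bbar c) \<and> Linf T (Fc c) \<and> Linf T (Fbar c) \<and>
     Linf T (Hc c) \<and> Linf T (Hbar c) \<and>
     Linf T (Ic c) \<and> Linf T (bcheck c) \<and> Linf T (sigcheck c) \<and>
     (AE t in lebesgue_on {0..T}. sigcheck c t \<noteq> 0)"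

definition H2 :: "real \<Rightarrow> ('n::finite, 'm::finite, 'd::finite) lq_data \<Rightarrow> bool" where
  "H2 T c \<longleftrightarrow>
     Linf T (Qc c) \<and> (AE t in lebesgue_on {0..T}. transpose (Qc c t) = Qc c t) \<and>
     Linf T (Rc c) \<and> (AE t in lebesgue_on {0..T}. transpose (Rc c t) = Rc c t) \<and>
     Linf T (Sc c) \<and> Linf T (qc c) \<and> Linf T (rc c) \<and>
     transpose (LT c) = LT c"

datatype 'd noise = Common | Idio nat 'd | Obs nat 'd

text \<open>\<open>B Common\<close> is \<open>W\<^sup>0\<close>; \<open>B (Idio k e)\<close> and \<open>B (Obs k e)\<close> are the \<open>e\<close>-th components of \<open>W\<^sup>k\<close>
  and of the second Brownian motion of agent \<open>k\<close>, which also drives the observation.\<close>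

definition agent_noise :: "nat \<Rightarrow> 'd noise set" where
  "agent_noise k = insert Common (range (Idio k) \<union> range (Obs k))"

definition all_noise :: "nat \<Rightarrow> 'd noise set" where
  "all_noise N = insert Common (\<Union>k\<in>{1..N}. range (Idio k) \<union> range (Obs k))"

fun state_coef ::
  "('n::finite, 'm::finite, 'd::finite) lq_data \<Rightarrow> (real \<Rightarrow> 'w \<Rightarrow> real^'n) \<Rightarrow> 'd noise \<Rightarrow>
   real \<Rightarrow> 'w \<Rightarrow> real^'n" where
  "state_coef c z Common t \<omega> = z t \<omega>"
| "state_coef c z (Idio k e) t \<omega> = column e (sig c t)"
| "state_coef c z (Obs k e) t \<omega> = column e (sigbar c t)"

fun obs_coef ::
  "('n::finite, 'm::finite, 'd::finite) lq_data \<Rightarrow> 'd noise \<Rightarrow> real \<Rightarrow> 'w \<Rightarrow> real^'n" where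
  "obs_coef c (Obs k e) t \<omega> = column e (sigtilde c t)"
| "obs_coef c _ t \<omega> = 0"

text \<open>The drift of the state, its coefficient of \<open>dW\<^sup>0\<close>, and the drift of the observation, at
  state \<open>x\<close>, control \<open>u\<close> and mean-field terms \<open>xm\<close>, \<open>um\<close>.\<close>

definition x_drift :: "('n::finite, 'm::finite, 'd::finite) lq_data \<Rightarrow> real \<Rightarrow>
    real^'n \<Rightarrow> real^'m \<Rightarrow> real^'n \<Rightarrow> real^'m \<Rightarrow> real^'n" where
  "x_drift c t x u xm um =
     Ac c t *v x + Bc c t *v u + Abar c t *v xm + Bbar c t *v um + bc c t"

definition x_diff0 :: "('n::finite, 'm::finite, 'd::finite) lq_data \<Rightarrow> real \<Rightarrow>
    real^'n \<Rightarrow> real^'m \<Rightarrow> real^'n \<Rightarrow> real^'m \<Rightarrow> real^'n" where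
  "x_diff0 c t x u xm um =
     Dc c t *v x + Fc c t *v u + Dbar c t *v xm + Fbar c t *v um + bbar c t"

definition y_drift :: "('n::finite, 'm::finite, 'd::finite) lq_data \<Rightarrow> real \<Rightarrow>
    real^'n \<Rightarrow> real^'m \<Rightarrow> real^'n \<Rightarrow> real^'m \<Rightarrow> real^'n" where
  "y_drift c t x u xm um =
     Gc c t *v x + Hc c t *v u + Gbar c t *v xm + Hbar c t *v um + btilde c t"

definition theta_eq where
  "theta_eq M F T B c \<theta> \<longleftrightarrow>
     ito_process M F T B {Common} 0
       (\<lambda>t \<omega>. Ic c t * \<theta> t \<omega> + bcheck c t) (\<lambda>_ t \<omega>. sigcheck c t) \<theta>"

definition state_eqs ::
  "'w measure \<Rightarrow> (real \<Rightarrow> 'w measure) \<Rightarrow> real \<Rightarrow> ('d noise \<Rightarrow> real \<Rightarrow> 'w \<Rightarrow> real) \<Rightarrow>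
   ('n::finite, 'm::finite, 'd::finite) lq_data \<Rightarrow> nat \<Rightarrow> real^'n \<Rightarrow>
   (nat \<Rightarrow> real \<Rightarrow> 'w \<Rightarrow> real^'m) \<Rightarrow> (nat \<Rightarrow> real \<Rightarrow> 'w \<Rightarrow> real^'n) \<Rightarrow>
   (nat \<Rightarrow> real \<Rightarrow> 'w \<Rightarrow> real^'n) \<Rightarrow> bool" where
  "state_eqs M F T B c N x u X Y \<longleftrightarrow> (\<forall>k\<in>{1..N}.
     ito_process M F T B (agent_noise k) x
       (\<lambda>t \<omega>. x_drift c t (X k t \<omega>) (u k t \<omega>) (avg N (\<lambda>j. X j t \<omega>)) (avg N (\<lambda>j. u j t \<omega>)))
       (state_coef c
         (\<lambda>t \<omega>. x_diff0 c t (X k t \<omega>) (u k t \<omega>) (avg N (\<lambda>j. X j t \<omega>)) (avg N (\<lambda>j. u j t \<omega>))))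
       (X k) \<and>
     ito_process M F T B (range (Obs k)) 0
       (\<lambda>t \<omega>. y_drift c t (X k t \<omega>) (u k t \<omega>) (avg N (\<lambda>j. X j t \<omega>)) (avg N (\<lambda>j. u j t \<omega>)))
       (obs_coef c)
       (Y k))"

definition uncontrolled_eqs ::
  "'w measure \<Rightarrow> (real \<Rightarrow> 'w measure) \<Rightarrow> real \<Rightarrow> ('d noise \<Rightarrow> real \<Rightarrow> 'w \<Rightarrow> real) \<Rightarrow>
   ('n::finite, 'm::finite, 'd::finite) lq_data \<Rightarrow> nat \<Rightarrow> real^'n \<Rightarrow>
   (nat \<Rightarrow> real \<Rightarrow> 'w \<Rightarrow> real^'n) \<Rightarrow> (nat \<Rightarrow> real \<Rightarrow> 'w \<Rightarrow> real^'n) \<Rightarrow> bool" where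
  "uncontrolled_eqs M F T B c N x X0 Y0 \<longleftrightarrow> (\<forall>k\<in>{1..N}.
     ito_process M F T B (agent_noise k) x
       (\<lambda>t \<omega>. Ac c t *v X0 k t \<omega> + Abar c t *v avg N (\<lambda>j. X0 j t \<omega>))
       (state_coef c (\<lambda>t \<omega>. Dc c t *v X0 k t \<omega> + Dbar c t *v avg N (\<lambda>j. X0 j t \<omega>)))
       (X0 k) \<and>
     ito_process M F T B (range (Obs k)) 0
       (\<lambda>t \<omega>. Gc c t *v X0 k t \<omega> + Gbar c t *v avg N (\<lambda>j. X0 j t \<omega>))
       (obs_coef c)
       (Y0 k))"

text \<open>Centralized admissibility of \<open>u\<close>, where \<open>Y0\<close> are the uncontrolled observations and \<open>Y\<close>
  the observations produced by the whole control profile, \<open>u\<close> included.\<close>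

definition admissible_c ::
  "'w measure \<Rightarrow> real \<Rightarrow> nat \<Rightarrow> (real \<Rightarrow> 'w \<Rightarrow> real) \<Rightarrow>
   (nat \<Rightarrow> real \<Rightarrow> 'w \<Rightarrow> real^'n) \<Rightarrow> (nat \<Rightarrow> real \<Rightarrow> 'w \<Rightarrow> real^'n) \<Rightarrow>
   (real \<Rightarrow> 'w \<Rightarrow> real^'m) \<Rightarrow> bool" where
  "admissible_c M T N \<theta> Y0 Y u \<longleftrightarrow>
     meas_adapted M (obs_filt M {1..N} Y0 \<theta>) T u \<and>
     meas_adapted M (obs_filt M {1..N} Y \<theta>) T u \<and>
     sup_sq_finite M T u"

definition R_Pi where
  "R_Pi c \<pi> t = Rc c t + transpose (Fc c t) ** \<pi> t ** Fc c t"

definition Pi_tilde where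
  "Pi_tilde c \<pi> t = \<pi> t ** Bc c t + transpose (Dc c t) ** \<pi> t ** Fc c t + Sc c t"

definition Pi_solution ::
  "real \<Rightarrow> ('n::finite, 'm::finite, 'd::finite) lq_data \<Rightarrow> (real \<Rightarrow> real^'n^'n) \<Rightarrow> bool" where
  "Pi_solution T c \<pi> \<longleftrightarrow>
     (\<forall>t\<in>{0..T}. transpose (\<pi> t) = \<pi> t) \<and>
     (\<exists>\<pi>'. abs_cont_deriv T \<pi> \<pi>' \<and>
        (AE t in lebesgue_on {0..T}.
           \<pi>' t + \<pi> t ** Ac c t + transpose (Ac c t) ** \<pi> t
           + transpose (Dc c t) ** \<pi> t ** Dc c t + Qc c t
           - Pi_tilde c \<pi> t ** matrix_inv (R_Pi c \<pi> t) ** transpose (Pi_tilde c \<pi> t) = 0)) \<and>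
     \<pi> T = LT c \<and>
     unif_pd T (R_Pi c \<pi>)"

definition R_Sigma where
  "R_Sigma c \<Sigma> t = (1 - beta1 c) *\<^sub>R Rc c t + transpose (Fc c t) ** \<Sigma> t ** (Fc c t + Fbar c t)"

definition Sigma_tilde where
  "Sigma_tilde c \<Sigma> t = \<Sigma> t ** (Bc c t + Bbar c t)
     + transpose (Dc c t) ** \<Sigma> t ** (Fc c t + Fbar c t) + (1 - beta2 c) *\<^sub>R Sc c t"

text \<open>\<open>Sigma_barT\<close> is the transpose of \<open>\<Sigma>\<close>-bar; only the transpose ever occurs.\<close>

definition Sigma_barT where
  "Sigma_barT c \<Sigma> t = transpose (Bc c t) ** \<Sigma> t
     + transpose (Fc c t) ** \<Sigma> t ** (Dc c t + Dbar c t) + (1 - alpha2 c) *\<^sub>R transpose (Sc c t)"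

definition Sigma_solution ::
  "real \<Rightarrow> ('n::finite, 'm::finite, 'd::finite) lq_data \<Rightarrow> (real \<Rightarrow> real^'n^'n) \<Rightarrow> bool" where
  "Sigma_solution T c \<Sigma> \<longleftrightarrow>
     (\<exists>\<Sigma>'. abs_cont_deriv T \<Sigma> \<Sigma>' \<and>
        (AE t in lebesgue_on {0..T}.
           \<Sigma>' t + \<Sigma> t ** (Ac c t + Abar c t) + transpose (Ac c t) ** \<Sigma> t
           + transpose (Dc c t) ** \<Sigma> t ** (Dc c t + Dbar c t)
           - Sigma_tilde c \<Sigma> t ** matrix_inv (R_Sigma c \<Sigma> t) ** Sigma_barT c \<Sigma> t
           + (1 - alpha1 c) *\<^sub>R Qc c t = 0)) \<and>
     \<Sigma> T = (1 - alpha3 c) *\<^sub>R LT c \<and>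
     unif_pd T (\<lambda>t. R_Sigma c \<Sigma> t + transpose (R_Sigma c \<Sigma> t))"

definition rho_tilde where
  "rho_tilde c \<Sigma> \<rho> t =
     transpose (Bc c t) *v \<rho> t + transpose (Fc c t) *v (\<Sigma> t *v bbar c t) + rc c t"

definition rho_solution ::
  "real \<Rightarrow> ('n::finite, 'm::finite, 'd::finite) lq_data \<Rightarrow> (real \<Rightarrow> real^'n^'n) \<Rightarrow>
   (real \<Rightarrow> real^'n) \<Rightarrow> bool" where
  "rho_solution T c \<Sigma> \<rho> \<longleftrightarrow>
     (\<exists>\<rho>'. abs_cont_deriv T \<rho> \<rho>' \<and>
        (AE t in lebesgue_on {0..T}.
           \<rho>' t + transpose (Ac c t) *v \<rho> t
           - (Sigma_tilde c \<Sigma> t ** matrix_inv (R_Sigma c \<Sigma> t)) *v rho_tilde c \<Sigma> \<rho> t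
           + \<Sigma> t *v bc c t + transpose (Dc c t) *v (\<Sigma> t *v bbar c t) + qc c t = 0)) \<and>
     \<rho> T = lT c"

definition u_zero where
  "u_zero c \<Sigma> \<rho> x0 t \<omega> =
     - (matrix_inv (R_Sigma c \<Sigma> t) *v (Sigma_barT c \<Sigma> t *v x0 t \<omega> + rho_tilde c \<Sigma> \<rho> t))"

definition x_zero_eq where
  "x_zero_eq M F T B c \<Sigma> \<rho> x x0 \<longleftrightarrow>
     ito_process M F T B {Common} x
       (\<lambda>t \<omega>. (Ac c t + Abar c t) *v x0 t \<omega> + (Bc c t + Bbar c t) *v u_zero c \<Sigma> \<rho> x0 t \<omega> + bc c t)
       (\<lambda>_ t \<omega>. (Dc c t + Dbar c t) *v x0 t \<omega> + (Fc c t + Fbar c t) *v u_zero c \<Sigma> \<rho> x0 t \<omega>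
                  + bbar c t)
       x0"

text \<open>The strategy \<open>ub\<close> is not given by an explicit formula, since a conditional expectation at
  each single \<open>t\<close> is only determined almost surely; \<open>ub\<close> is any measurable adapted process that
  satisfies the feedback relation for almost every \<open>t\<close>, almost surely. The relation is
  self-referential, because \<open>Xb\<close> and \<open>Yb\<close> are themselves driven by \<open>ub\<close>.\<close>

definition decentralized_strategy ::
  "'w measure \<Rightarrow> (real \<Rightarrow> 'w measure) \<Rightarrow> real \<Rightarrow> ('d noise \<Rightarrow> real \<Rightarrow> 'w \<Rightarrow> real) \<Rightarrow>
   ('n::finite, 'm::finite, 'd::finite) lq_data \<Rightarrow> real^'n \<Rightarrow> (real \<Rightarrow> 'w \<Rightarrow> real) \<Rightarrow>
   (real \<Rightarrow> real^'n^'n) \<Rightarrow> (real \<Rightarrow> real^'n^'n) \<Rightarrow> (real \<Rightarrow> real^'n) \<Rightarrow>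
   (real \<Rightarrow> 'w \<Rightarrow> real^'n) \<Rightarrow> nat \<Rightarrow> (nat \<Rightarrow> real \<Rightarrow> 'w \<Rightarrow> real^'n) \<Rightarrow>
   (nat \<Rightarrow> real \<Rightarrow> 'w \<Rightarrow> real^'n) \<Rightarrow> (nat \<Rightarrow> real \<Rightarrow> 'w \<Rightarrow> real^'m) \<Rightarrow> bool" where
  "decentralized_strategy M F T B c x \<theta> \<pi> \<Sigma> \<rho> x0 j Xb Yb ub \<longleftrightarrow>
     (let u0 = u_zero c \<Sigma> \<rho> x0 in
     ito_process M F T B (agent_noise j) x
       (\<lambda>t \<omega>. x_drift c t (Xb j t \<omega>) (ub j t \<omega>) (x0 t \<omega>) (u0 t \<omega>))
       (state_coef c (\<lambda>t \<omega>. x_diff0 c t (Xb j t \<omega>) (ub j t \<omega>) (x0 t \<omega>) (u0 t \<omega>)))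
       (Xb j) \<and>
     ito_process M F T B (range (Obs j)) 0
       (\<lambda>t \<omega>. y_drift c t (Xb j t \<omega>) (ub j t \<omega>) (x0 t \<omega>) (u0 t \<omega>))
       (obs_coef c)
       (Yb j) \<and>
     meas_adapted M F T (ub j) \<and>
     (AE t in lebesgue_on {0..T}. AE \<omega> in M.
        ub j t \<omega> =
          - (matrix_inv (R_Pi c \<pi> t) *v (transpose (Pi_tilde c \<pi> t) *v
               (cond_exp_vec M (obs_filt M {j} Yb \<theta> t) (Xb j t) \<omega> - x0 t \<omega>)))
          - matrix_inv (R_Sigma c \<Sigma> t) *v (Sigma_barT c \<Sigma> t *v x0 t \<omega> + rho_tilde c \<Sigma> \<rho> t)))"

definition cost ::
  "'w measure \<Rightarrow> real \<Rightarrow> ('n::finite, 'm::finite, 'd::finite) lq_data \<Rightarrow> nat \<Rightarrow> nat \<Rightarrow>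
   (nat \<Rightarrow> real \<Rightarrow> 'w \<Rightarrow> real^'n) \<Rightarrow> (nat \<Rightarrow> real \<Rightarrow> 'w \<Rightarrow> real^'m) \<Rightarrow> real" where
  "cost M T c N i X u = 1/2 * (LINT \<omega>|M.
     (LINT t|lebesgue_on {0..T}.
       (let x = X i t \<omega>; v = u i t \<omega>; xN = avg N (\<lambda>k. X k t \<omega>); uN = avg N (\<lambda>k. u k t \<omega>) in
          (Qc c t *v (x - alpha1 c *\<^sub>R xN) + 2 *\<^sub>R qc c t) \<bullet> (x - alpha1 c *\<^sub>R xN)
        + (Rc c t *v (v - beta1 c *\<^sub>R uN) + 2 *\<^sub>R rc c t) \<bullet> (v - beta1 c *\<^sub>R uN)
        + 2 * ((Sc c t *v (v - beta2 c *\<^sub>R uN)) \<bullet> (x - alpha2 c *\<^sub>R xN))))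
     + (let x = X i T \<omega>; xN = avg N (\<lambda>k. X k T \<omega>) in
          (LT c *v (x - alpha3 c *\<^sub>R xN) + 2 *\<^sub>R lT c) \<bullet> (x - alpha3 c *\<^sub>R xN)))"

text \<open>In the following, \<open>P'\<close> is the derivative of \<open>P\<close>.\<close>

definition QP where
  "QP c P P' t = Qc c t + P' t + P t ** Ac c t + transpose (Ac c t) ** P t
     + transpose (Dc c t) ** P t ** Dc c t"

definition SP where
  "SP c P t = Sc c t + P t ** Bc c t + transpose (Dc c t) ** P t ** Fc c t"

definition RP where
  "RP c P t = Rc c t + transpose (Fc c t) ** P t ** Fc c t"

definition LP where
  "LP c P T = LT c - P T"

definition QP_tilde where
  "QP_tilde c P t = (alpha1 c)\<^sup>2 *\<^sub>R Qc c t + transpose (Dbar c t) ** P t ** Dbar c t"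

definition QP_bar where
  "QP_bar c P t = - (alpha1 c *\<^sub>R Qc c t) + transpose (Abar c t) ** P t
     + transpose (Dbar c t) ** P t ** Dc c t"

definition qP_tilde where
  "qP_tilde c P t = qc c t + P t *v bc c t + transpose (Dc c t) *v (P t *v bbar c t)"

definition qP_bar where
  "qP_bar c P t = - (alpha1 c *\<^sub>R qc c t) + transpose (Dbar c t) *v (P t *v bbar c t)"

definition QP_hat where
  "QP_hat c P t = - (beta2 c *\<^sub>R transpose (Sc c t)) + transpose (Bbar c t) ** P t
     + transpose (Fbar c t) ** P t ** Dc c t"

definition SP_tilde where
  "SP_tilde c P t = transpose (Dbar c t) ** P t ** Fbar c t + (alpha2 c * beta2 c) *\<^sub>R Sc c t"

definition RP_tilde where
  "RP_tilde c P t = (beta1 c)\<^sup>2 *\<^sub>R Rc c t + transpose (Fbar c t) ** P t ** Fbar c t"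

definition rP_tilde where
  "rP_tilde c P t = rc c t + transpose (Fc c t) *v (P t *v bbar c t)"

definition rP_bar where
  "rP_bar c P t = - (alpha2 c *\<^sub>R Sc c t) + transpose (Dbar c t) ** P t ** Fc c t"

definition qP_hat where
  "qP_hat c P t = transpose (Fbar c t) *v (P t *v bbar c t) - beta1 c *\<^sub>R rc c t"

definition rP_hat where
  "rP_hat c P t = transpose (Fbar c t) ** P t ** Fc c t - beta1 c *\<^sub>R Rc c t"

definition MP_tilde where
  "MP_tilde c P t = bbar c t \<bullet> (P t *v bbar c t)
     + trace (transpose (sig c t) ** P t ** sig c t)
     + trace (transpose (sigbar c t) ** P t ** sigbar c t)"

definition relaxed_compensator ::
  "real \<Rightarrow> ('n::finite, 'm::finite, 'd::finite) lq_data \<Rightarrow> (real \<Rightarrow> real^'n^'n) \<Rightarrow>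
   (real \<Rightarrow> real^'n^'n) \<Rightarrow> bool" where
  "relaxed_compensator T c P P' \<longleftrightarrow>
     abs_cont_deriv T P P' \<and> (\<forall>t\<in>{0..T}. transpose (P t) = P t) \<and>
     (AE t in lebesgue_on {0..T}.
        psd (block_mat (QP c P P' t) (SP c P t) (transpose (SP c P t)) (RP c P t))) \<and>
     unif_pd T (RP c P) \<and>
     psd (LP c P T)"

definition cost_P ::
  "'w measure \<Rightarrow> real \<Rightarrow> ('n::finite, 'm::finite, 'd::finite) lq_data \<Rightarrow>
   (real \<Rightarrow> real^'n^'n) \<Rightarrow> (real \<Rightarrow> real^'n^'n) \<Rightarrow> nat \<Rightarrow> nat \<Rightarrow>
   (nat \<Rightarrow> real \<Rightarrow> 'w \<Rightarrow> real^'n) \<Rightarrow> (nat \<Rightarrow> real \<Rightarrow> 'w \<Rightarrow> real^'m) \<Rightarrow> real" where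
  "cost_P M T c P P' N i X u = 1/2 * (LINT \<omega>|M.
     (LINT t|lebesgue_on {0..T}.
       (let x = X i t \<omega>; v = u i t \<omega>; xN = avg N (\<lambda>k. X k t \<omega>); uN = avg N (\<lambda>k. u k t \<omega>) in
          (QP c P P' t *v x + 2 *\<^sub>R qP_tilde c P t + 2 *\<^sub>R (SP c P t *v v)) \<bullet> x
        + (RP c P t *v v + 2 *\<^sub>R rP_tilde c P t) \<bullet> v
        + (QP_tilde c P t *v xN) \<bullet> xN
        + 2 * ((QP_bar c P t *v x + rP_bar c P t *v v + qP_bar c P t) \<bullet> xN)
        + (RP_tilde c P t *v uN) \<bullet> uN
        + 2 * ((QP_hat c P t *v x + rP_hat c P t *v v + qP_hat c P t) \<bullet> uN)
        + MP_tilde c P t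
        + 2 * ((SP_tilde c P t *v uN) \<bullet> xN)))
     + (let x = X i T \<omega>; xN = avg N (\<lambda>k. X k T \<omega>) in
          (LP c P T *v x + 2 *\<^sub>R lT c) \<bullet> x
        - 2 * alpha3 c * ((LT c *v x + lT c) \<bullet> xN)
        + (alpha3 c)\<^sup>2 * ((LT c *v xN) \<bullet> xN)))"

end

theory Submission
  imports Defs
begin

text \<open>The function \<open>t \<mapsto> \<langle>P t X t, X t\<rangle>\<close> is differentiated in expectation, where \<open>X\<close> is the state of
  agent \<open>i\<close>, and the result is added to the cost: this completes the coefficients of \<open>cost\<close> to those
  of \<open>cost_P\<close>, and only the value at time 0 is left over. Only the expectation of the product rule
  is needed, never the pathwise one. For \<open>X = x + A + N\<close> with an absolutely continuous part \<open>A\<close>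
  with density \<open>a\<close> and a martingale part \<open>N\<close>, it follows from integration by parts for \<open>A\<close>, from the
  isometry for \<open>N\<close>, and from \<open>E (A t N t) = \<integral> E (a s N s) ds\<close>, since increments of \<open>N\<close> after time \<open>s\<close>
  are orthogonal to \<open>a s\<close>. The function \<open>P\<close> enters afterwards, through deterministic integration by
  parts, which requires that \<open>P\<close> is the integral of \<open>P'\<close>. The cost integrands are integrable because
  conditional expectation contracts \<open>L\<^sup>2\<close> and the feedback gains of the other agents are bounded.\<close>

section \<open>Square-integrable functions\<close>

text \<open>What \<open>ito_integral\<close> provides is, at each single time, a limit in L2 of
  elementary integrals. Such a limit carries second moments, which are bilinear in functions
  converging in L2, but no quadratic variation along paths. Two kinds of integrability have to be
  told apart. The drift is paired with the state and must be square integrable over time and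
  outcome, whereas \<open>ito_process\<close> only makes it integrable along almost every path. As
  it contains the average control, second moments of the controls of all agents are required;
  admissibility supplies them for agent \<open>i\<close> alone, and for the others they are
  extracted from a feedback relation that holds almost everywhere and involves a conditional
  expectation chosen separately at each time. The derivative \<open>P'\<close>, in contrast, is
  merely integrable in time; its product with a quadratic expression of the state is integrable
  because the second moments of the state are bounded uniformly in time. Vectors and matrices are
  treated entry by entry, so that the stochastic part concerns pairs of real processes.\<close>

definition in_L2 :: "'a measure \<Rightarrow> ('a \<Rightarrow> real) \<Rightarrow> bool" where
  "in_L2 N f \<longleftrightarrow> f \<in> borel_measurable N \<and> integrable N (\<lambda>x. (f x)\<^sup>2)"

lemma in_L2_measurable: "in_L2 N f \<Longrightarrow> f \<in> borel_measurable N"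
  by (simp add: in_L2_def)

lemma in_L2_iff_nn:
  "in_L2 N f \<longleftrightarrow> f \<in> borel_measurable N \<and> (\<integral>\<^sup>+x. ennreal ((f x)\<^sup>2) \<partial>N) < \<infinity>"
  by (auto simp: in_L2_def integrable_iff_bounded)

lemma in_L2_mult:
  assumes "in_L2 N f" "in_L2 N g"
  shows "integrable N (\<lambda>x. f x * g x)"
proof (rule Bochner_Integration.integrable_bound)
  show "integrable N (\<lambda>x. (f x)\<^sup>2 + (g x)\<^sup>2)"
    using assms by (auto simp: in_L2_def)
  show "(\<lambda>x. f x * g x) \<in> borel_measurable N"
    using assms by (auto simp: in_L2_def)
  have "\<bar>f x * g x\<bar> \<le> (f x)\<^sup>2 + (g x)\<^sup>2" for x
    using sum_squares_bound[of "\<bar>f x\<bar>" "\<bar>g x\<bar>"] abs_ge_zero[of "f x * g x"]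
    unfolding abs_mult power2_abs by linarith
  then show "AE x in N. norm (f x * g x) \<le> norm ((f x)\<^sup>2 + (g x)\<^sup>2)" by auto
qed

lemma in_L2_bound:
  assumes "in_L2 N g" "f \<in> borel_measurable N" "AE x in N. \<bar>f x\<bar> \<le> C * \<bar>g x\<bar>"
  shows "in_L2 N f"
  unfolding in_L2_def
proof
  show "integrable N (\<lambda>x. (f x)\<^sup>2)"
  proof (rule Bochner_Integration.integrable_bound)
    show "integrable N (\<lambda>x. C\<^sup>2 * (g x)\<^sup>2)"
      using assms(1) by (auto simp: in_L2_def)
    show "(\<lambda>x. (f x)\<^sup>2) \<in> borel_measurable N" using assms(2) by simp
    show "AE x in N. norm ((f x)\<^sup>2) \<le> norm (C\<^sup>2 * (g x)\<^sup>2)"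
      using assms(3)
    proof eventually_elim
      case (elim x)
      have "(\<bar>f x\<bar>)\<^sup>2 \<le> (C * \<bar>g x\<bar>)\<^sup>2" by (rule power_mono[OF elim]) simp
      then show ?case by (simp add: power_mult_distrib)
    qed
  qed
qed fact

lemma in_L2_add:
  assumes "in_L2 N f" "in_L2 N g"
  shows "in_L2 N (\<lambda>x. f x + g x)"
proof -
  have "integrable N (\<lambda>x. (f x)\<^sup>2 + (g x)\<^sup>2 + 2 * (f x * g x))"
    using assms in_L2_mult[OF assms] by (auto simp: in_L2_def)
  then show ?thesis using assms by (auto simp: in_L2_def power2_sum mult.assoc)
qed

lemma in_L2_cmult:
  assumes "in_L2 N f" shows "in_L2 N (\<lambda>x. c * f x)"
  using assms by (auto simp: in_L2_def power_mult_distrib)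

lemma in_L2_diff:
  assumes "in_L2 N f" "in_L2 N g"
  shows "in_L2 N (\<lambda>x. f x - g x)"
  using in_L2_add[OF assms(1) in_L2_cmult[OF assms(2), of "-1"]] by simp

lemma in_L2_sum:
  assumes "\<And>i. i \<in> A \<Longrightarrow> in_L2 N (f i)"
  shows "in_L2 N (\<lambda>x. \<Sum>i\<in>A. f i x)"
  using assms
proof (induction A rule: infinite_finite_induct)
  case (insert i A)
  then show ?case using in_L2_add[of N "f i" "\<lambda>x. \<Sum>i\<in>A. f i x"] by simp
qed (auto simp: in_L2_def)

lemma in_L2_cong_AE:
  assumes "in_L2 N g" "f \<in> borel_measurable N" "AE x in N. f x = g x"
  shows "in_L2 N f"
  by (rule in_L2_bound[OF assms(1,2), of 1]) (use assms(3) in auto)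

lemma (in finite_measure) in_L2_bounded:
  assumes "f \<in> borel_measurable M" "\<And>x. x \<in> space M \<Longrightarrow> \<bar>f x\<bar> \<le> C"
  shows "in_L2 M f"
proof -
  have "in_L2 M (\<lambda>_. 1)" by (simp add: in_L2_def)
  then show ?thesis
    by (rule in_L2_bound[OF _ assms(1), of _ C]) (use assms(2) in auto)
qed

lemma (in finite_measure) in_L2_integrable:
  assumes "in_L2 M f" shows "integrable M f"
proof -
  have "in_L2 M (\<lambda>_. 1)" by (simp add: in_L2_def)
  from in_L2_mult[OF assms this] show ?thesis by simp
qed

lemma integral_Cauchy_Schwarz:
  assumes "in_L2 N f" "in_L2 N g"
  shows "\<bar>\<integral>x. f x * g x \<partial>N\<bar> \<le> sqrt (\<integral>x. (f x)\<^sup>2 \<partial>N) * sqrt (\<integral>x. (g x)\<^sup>2 \<partial>N)"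
proof -
  define A B where "A = (\<integral>x. (f x)\<^sup>2 \<partial>N)" and "B = (\<integral>x. (g x)\<^sup>2 \<partial>N)"
  have [measurable]: "f \<in> borel_measurable N" "g \<in> borel_measurable N"
    and f2: "integrable N (\<lambda>x. (f x)\<^sup>2)" and g2: "integrable N (\<lambda>x. (g x)\<^sup>2)"
    using assms by (auto simp: in_L2_def)
  have fg: "integrable N (\<lambda>x. \<bar>f x * g x\<bar>)"
    using in_L2_mult[OF assms] by (rule integrable_abs)
  define C where "C = (\<integral>x. \<bar>f x * g x\<bar> \<partial>N)"
  have A0: "0 \<le> A" and B0: "0 \<le> B" and C0: "0 \<le> C" by (auto simp: A_def B_def C_def)
  have le: "\<bar>\<integral>x. f x * g x \<partial>N\<bar> \<le> C"
    unfolding C_def by (rule integral_abs_bound)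
  have "C \<le> sqrt A * sqrt B"
  proof (cases "A = 0 \<or> B = 0")
    case True
    \<comment> \<open>The scaling used in the other case degenerates if one norm vanishes, but then
      that factor is zero almost everywhere and so is the product.\<close>
    have "AE x in N. f x * g x = 0"
    proof (cases "A = 0")
      case True
      then have "AE x in N. (f x)\<^sup>2 = 0"
        using integral_nonneg_eq_0_iff_AE[OF f2] by (simp add: A_def)
      then show ?thesis by auto
    next
      case False
      then have "AE x in N. (g x)\<^sup>2 = 0"
        using True integral_nonneg_eq_0_iff_AE[OF g2] by (simp add: B_def)
      then show ?thesis by auto
    qed
    then have "C = (\<integral>x. 0 \<partial>N)"
      unfolding C_def by (intro integral_cong_AE) auto
    then show ?thesis using A0 B0 by simp
  next
    case False
    then have pos: "0 < sqrt A" "0 < sqrt B" using A0 B0 by auto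
    \<comment> \<open>Each factor is weighted by the norm of the other, so that both squares
      integrate to \<open>A * B\<close> and the positive number \<open>sqrt A * sqrt B\<close> can
      be cancelled.\<close>
    have "0 \<le> (\<integral>x. (sqrt B * \<bar>f x\<bar> - sqrt A * \<bar>g x\<bar>)\<^sup>2 \<partial>N)" by simp
    also have "\<dots> = (\<integral>x. B * (f x)\<^sup>2 + A * (g x)\<^sup>2 - 2 * sqrt A * sqrt B * \<bar>f x * g x\<bar> \<partial>N)"
      using A0 B0 by (intro Bochner_Integration.integral_cong refl)
        (simp add: power2_diff power_mult_distrib abs_mult algebra_simps)
    also have "\<dots> = B * A + A * B - 2 * sqrt A * sqrt B * C"
      using f2 g2 fg by (simp add: A_def B_def C_def)
    also have "\<dots> = 2 * (sqrt A * sqrt B) * (sqrt A * sqrt B - C)"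
      using A0 B0 by (simp add: algebra_simps)
    finally have "0 \<le> sqrt A * sqrt B - C"
      using mult_pos_pos[OF pos] by (simp add: zero_le_mult_iff del: real_sqrt_gt_0_iff)
    then show ?thesis by simp
  qed
  with le show ?thesis unfolding A_def B_def by simp
qed

text \<open>The error splits as (F - f)(G - g) + (F - f) g + f (G - g), and Cauchy-Schwarz bounds
  each part. Every identity between second moments of elementary integrals reaches the stochastic
  integral through this continuity.\<close>

lemma tendsto_integral_mult:
  assumes F: "\<And>n. in_L2 N (F n)" "in_L2 N f"
    and G: "\<And>n. in_L2 N (G n)" "in_L2 N g"
    and lF: "(\<lambda>n. \<integral>x. (F n x - f x)\<^sup>2 \<partial>N) \<longlonglongrightarrow> 0"
    and lG: "(\<lambda>n. \<integral>x. (G n x - g x)\<^sup>2 \<partial>N) \<longlonglongrightarrow> 0"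
  shows "(\<lambda>n. \<integral>x. F n x * G n x \<partial>N) \<longlonglongrightarrow> (\<integral>x. f x * g x \<partial>N)"
proof (rule Lim_null[THEN iffD2])
  define a b where "a n = sqrt (\<integral>x. (F n x - f x)\<^sup>2 \<partial>N)" and "b n = sqrt (\<integral>x. (G n x - g x)\<^sup>2 \<partial>N)" for n
  define p q where "p = sqrt (\<integral>x. (f x)\<^sup>2 \<partial>N)" and "q = sqrt (\<integral>x. (g x)\<^sup>2 \<partial>N)"
  have a: "a \<longlonglongrightarrow> 0" unfolding a_def using tendsto_real_sqrt[OF lF] by simp
  have b: "b \<longlonglongrightarrow> 0" unfolding b_def using tendsto_real_sqrt[OF lG] by simp
  have lim: "(\<lambda>n. a n * b n + a n * q + p * b n) \<longlonglongrightarrow> 0 * 0 + 0 * q + p * 0"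
    by (intro tendsto_intros a b)
  show "(\<lambda>n. (\<integral>x. F n x * G n x \<partial>N) - (\<integral>x. f x * g x \<partial>N)) \<longlonglongrightarrow> 0"
  proof (rule Lim_null_comparison)
    show "(\<lambda>n. a n * b n + a n * q + p * b n) \<longlonglongrightarrow> 0" using lim by simp
    have "norm ((\<integral>x. F n x * G n x \<partial>N) - (\<integral>x. f x * g x \<partial>N)) \<le> a n * b n + a n * q + p * b n" for n
    proof -
      note dF = in_L2_diff[OF F(1)[of n] F(2)] and dG = in_L2_diff[OF G(1)[of n] G(2)]
      have "(\<integral>x. F n x * G n x \<partial>N) - (\<integral>x. f x * g x \<partial>N)
          = (\<integral>x. (F n x * G n x) - f x * g x \<partial>N)"
        using F G by (intro Bochner_Integration.integral_diff[symmetric] in_L2_mult)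
      also have "\<dots> = (\<integral>x. ((F n x - f x) * (G n x - g x) + (F n x - f x) * g x) + f x * (G n x - g x) \<partial>N)"
        by (intro Bochner_Integration.integral_cong refl) (simp add: algebra_simps)
      also have "\<dots> = (\<integral>x. (F n x - f x) * (G n x - g x) \<partial>N) + (\<integral>x. (F n x - f x) * g x \<partial>N)
          + (\<integral>x. f x * (G n x - g x) \<partial>N)"
        using in_L2_mult[OF dF dG] in_L2_mult[OF dF G(2)]
          in_L2_mult[OF F(2) dG] by simp
      finally show ?thesis
        using integral_Cauchy_Schwarz[OF dF dG] integral_Cauchy_Schwarz[OF dF G(2)]
          integral_Cauchy_Schwarz[OF F(2) dG]
        unfolding a_def b_def p_def q_def by (simp only: real_norm_def)
    qed
    then show "\<forall>\<^sub>F n in sequentially. norm ((\<integral>x. F n x * G n x \<partial>N) - (\<integral>x. f x * g x \<partial>N))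
        \<le> a n * b n + a n * q + p * b n" by simp
  qed
qed

text \<open>\<open>ito_integral\<close> states its limits with nonnegative integrals, while
  Cauchy-Schwarz and linearity are applied to Bochner integrals.\<close>

lemma tendsto_integral_square_of_nn:
  assumes F: "\<And>n. in_L2 N (F n)" "in_L2 N f"
    and l: "(\<lambda>n. \<integral>\<^sup>+x. ennreal ((f x - F n x)\<^sup>2) \<partial>N) \<longlonglongrightarrow> 0"
  shows "(\<lambda>n. \<integral>x. (F n x - f x)\<^sup>2 \<partial>N) \<longlonglongrightarrow> 0"
proof -
  have "(\<integral>\<^sup>+x. ennreal ((f x - F n x)\<^sup>2) \<partial>N) = ennreal (\<integral>x. (F n x - f x)\<^sup>2 \<partial>N)" for n
    using in_L2_diff[OF F(1)[of n] F(2)]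
    by (subst nn_integral_eq_integral[symmetric]) (auto simp: in_L2_def power2_commute)
  with l have "(\<lambda>n. ennreal (\<integral>x. (F n x - f x)\<^sup>2 \<partial>N)) \<longlonglongrightarrow> ennreal 0" by simp
  then show ?thesis by (subst (asm) tendsto_ennreal_iff) auto
qed

text \<open>A single approximant is enough: \<open>f\<close> is the sum of it and of a difference
  whose squared norm is below 1. This yields the square integrability of the stochastic integral,
  which its definition does not assert.\<close>

lemma in_L2_limit:
  assumes F: "\<And>n::nat. in_L2 N (F n)" and f: "f \<in> borel_measurable N"
    and l: "(\<lambda>n. \<integral>\<^sup>+x. ennreal ((f x - F n x)\<^sup>2) \<partial>N) \<longlonglongrightarrow> 0"
  shows "in_L2 N f"
proof -
  have "\<forall>\<^sub>F n in sequentially. (\<integral>\<^sup>+x. ennreal ((f x - F n x)\<^sup>2) \<partial>N) < 1"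
    using order_tendstoD(2)[OF l, of 1] by simp
  then obtain n where n: "(\<integral>\<^sup>+x. ennreal ((f x - F n x)\<^sup>2) \<partial>N) < 1"
    by (auto simp: eventually_sequentially)
  have "in_L2 N (\<lambda>x. f x - F n x)"
    using n f in_L2_measurable[OF F[of n]]
    by (auto simp: in_L2_iff_nn intro: less_trans)
  from in_L2_add[OF this F[of n]] show ?thesis by simp
qed

section \<open>Increments of Brownian motion\<close>

text \<open>\<open>J\<close> stays abstract and may be infinite. The theorem instantiates it by all
  noises of the game, whereas a single process is driven by a finite subset
  \<open>K\<close>.\<close>

locale brownian_setting = prob_space M
  for M :: "'w measure" +
  fixes F :: "real \<Rightarrow> 'w measure" and T :: real and J :: "'j set" and B :: "'j \<Rightarrow> real \<Rightarrow> 'w \<Rightarrow> real"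
  assumes T_nonneg: "0 \<le> T"
    and filtered: "filtered_space M F T"
    and brownian: "brownian_family M F T J B"
begin

lemma subalgebra_F: "0 \<le> t \<Longrightarrow> t \<le> T \<Longrightarrow> subalgebra M (F t)"
  using filtered by (auto simp: filtered_space_def)

lemma space_F: "0 \<le> t \<Longrightarrow> t \<le> T \<Longrightarrow> space (F t) = space M"
  using subalgebra_F by (auto simp: subalgebra_def)

lemma F_measurable: "0 \<le> t \<Longrightarrow> t \<le> T \<Longrightarrow> f \<in> measurable (F t) N \<Longrightarrow> f \<in> measurable M N"
  using measurable_from_subalg[OF subalgebra_F] by blast

lemma F_mono:
  assumes "0 \<le> s" "s \<le> t" "t \<le> T" "f \<in> measurable (F s) N"
  shows "f \<in> measurable (F t) N"
proof -
  have "sets (F s) \<subseteq> sets (F t)" using filtered assms by (auto simp: filtered_space_def)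
  moreover have "space (F s) = space (F t)" using assms space_F[of s] space_F[of t] by simp
  ultimately show ?thesis using assms(4) unfolding measurable_def by auto
qed

lemma B_adapted: "j \<in> J \<Longrightarrow> 0 \<le> t \<Longrightarrow> t \<le> T \<Longrightarrow> B j t \<in> borel_measurable (F t)"
  using brownian unfolding brownian_family_def meas_adapted_def by (meson atLeastAtMost_iff)

lemma incr_measurable:
  assumes "j \<in> J" "0 \<le> s" "s \<le> t" "t \<le> T"
  shows "(\<lambda>w. B j t w - B j s w) \<in> borel_measurable (F t)"
  using B_adapted[OF assms(1), of t] F_mono[OF assms(2-4) B_adapted[OF assms(1), of s]] assms
  by (intro borel_measurable_diff) auto

lemma incr_measurable_M:
  assumes "j \<in> J" "0 \<le> s" "s \<le> t" "t \<le> T"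
  shows "(\<lambda>w. B j t w - B j s w) \<in> borel_measurable M"
  using F_measurable[OF _ _ incr_measurable[OF assms]] assms by auto

lemma brownian_incr:
  assumes "0 \<le> s" "s < t" "t \<le> T"
  shows "(\<forall>j\<in>J. distributed M lborel (\<lambda>w. B j t w - B j s w)
      (\<lambda>z. ennreal (normal_density 0 (sqrt (t - s)) z)))"
    and "indep_sets (\<lambda>a. case a of None \<Rightarrow> sets (F s)
       | Some j \<Rightarrow> {(\<lambda>w. B j t w - B j s w) -` A \<inter> space M | A. A \<in> sets borel}) (insert None (Some ` J))"
  using brownian[unfolded brownian_family_def, THEN conjunct2, rule_format, of s t] assms by simp_all

lemma incr_distributed:
  assumes "j \<in> J" "0 \<le> s" "s < t" "t \<le> T"
  shows "distributed M lborel (\<lambda>w. B j t w - B j s w) (normal_density 0 (sqrt (t - s)))"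
  using brownian_incr[OF assms(2-4)] assms(1) by blast

lemma incr_in_L2:
  assumes "j \<in> J" "0 \<le> s" "s \<le> t" "t \<le> T"
  shows "in_L2 M (\<lambda>w. B j t w - B j s w)"
\<comment> \<open>\<open>brownian_family\<close> describes increments for s < t only, as a normal
  law of variance 0 has no density; the empty increment is 0.\<close>
proof (cases "s = t")
  case True then show ?thesis by (simp add: in_L2_def)
next
  case False
  then have "s < t" using assms by simp
  have "integrable lborel (\<lambda>x. normal_density 0 (sqrt (t - s)) x * (x - 0)\<^sup>2)"
    using \<open>s < t\<close> by (intro integrable_normal_moment) simp
  then have "integrable M (\<lambda>w. (B j t w - B j s w)\<^sup>2)"
    using distributed_integrable[OF incr_distributed[OF assms(1,2) \<open>s < t\<close> assms(4)], of "\<lambda>x. x\<^sup>2"]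
    by simp
  then show ?thesis using incr_measurable_M[OF assms] by (simp add: in_L2_def)
qed

lemma incr_expectation:
  assumes "j \<in> J" "0 \<le> s" "s \<le> t" "t \<le> T"
  shows "expectation (\<lambda>w. B j t w - B j s w) = 0"
proof (cases "s = t")
  case False
  then have "s < t" using assms by simp
  then show ?thesis
    using normal_distributed_expectation[OF _ incr_distributed[OF assms(1,2) \<open>s < t\<close> assms(4)]] by simp
qed simp

lemma incr_variance:
  assumes "j \<in> J" "0 \<le> s" "s \<le> t" "t \<le> T"
  shows "expectation (\<lambda>w. (B j t w - B j s w)\<^sup>2) = t - s"
proof (cases "s = t")
  case False
  then have "s < t" using assms by simp
  then show ?thesis
    using normal_distributed_variance[OF _ incr_distributed[OF assms(1,2) \<open>s < t\<close> assms(4)]]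
    unfolding incr_expectation[OF assms] by simp
qed simp

text \<open>The definition attaches the whole \<sigma>-algebra \<open>F s\<close> to the index
  \<open>None\<close>; the events generated by \<eta> form a subfamily, and independence passes to
  subfamilies and to fewer indices. Restricting to \<open>K\<close> makes finite index sets
  possible, for which the expectation of a product factorizes.\<close>

lemma incr_indep:
  assumes K: "K \<subseteq> J" and st: "0 \<le> s" "s < t" "t \<le> T" and \<eta>: "\<eta> \<in> borel_measurable (F s)"
  shows "indep_vars (\<lambda>_. borel)
    (\<lambda>a. case a of None \<Rightarrow> \<eta> | Some j \<Rightarrow> (\<lambda>w. B j t w - B j s w)) (insert None (Some ` K))"
  unfolding indep_vars_def2
proof
  have \<eta>M: "\<eta> \<in> borel_measurable M" using F_measurable[OF _ _ \<eta>] st by simp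
  show "\<forall>i\<in>insert None (Some ` K). random_variable borel
      (case i of None \<Rightarrow> \<eta> | Some j \<Rightarrow> (\<lambda>w. B j t w - B j s w))"
    using \<eta>M incr_measurable_M[of _ s t] st K by auto
  have ind: "indep_sets (\<lambda>a. case a of None \<Rightarrow> sets (F s)
       | Some j \<Rightarrow> {(\<lambda>w. B j t w - B j s w) -` A \<inter> space M | A. A \<in> sets borel}) (insert None (Some ` J))"
    using brownian_incr[OF st] by blast
  show "indep_sets (\<lambda>i. {(case i of None \<Rightarrow> \<eta> | Some j \<Rightarrow> (\<lambda>w. B j t w - B j s w)) -` A \<inter> space M |A.
      A \<in> sets borel}) (insert None (Some ` K))"
  proof (rule indep_sets_mono[OF ind])
    show "insert None (Some ` K) \<subseteq> insert None (Some ` J)" using K by auto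
    fix a assume a: "a \<in> insert None (Some ` K)"
    show "{(case a of None \<Rightarrow> \<eta> | Some j \<Rightarrow> (\<lambda>w. B j t w - B j s w)) -` A \<inter> space M |A. A \<in> sets borel}
      \<subseteq> (case a of None \<Rightarrow> sets (F s)
         | Some j \<Rightarrow> {(\<lambda>w. B j t w - B j s w) -` A \<inter> space M | A. A \<in> sets borel})"
      using measurable_sets[OF \<eta>] space_F[of s] st by (cases a) auto
  qed
qed

text \<open>The increment is independent of the past, so the expectation factorizes, and it is
  centred.\<close>

lemma
  assumes j: "j \<in> J" and st: "0 \<le> s" "s \<le> t" "t \<le> T"
    and \<eta>: "\<eta> \<in> borel_measurable (F s)" "integrable M \<eta>"
  shows integrable_mult_incr: "integrable M (\<lambda>w. \<eta> w * (B j t w - B j s w))"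
    and expectation_mult_incr: "expectation (\<lambda>w. \<eta> w * (B j t w - B j s w)) = 0"
proof -
  define X where "X = (\<lambda>a. case a of None \<Rightarrow> \<eta> | Some j \<Rightarrow> (\<lambda>w. B j t w - B j s w))"
  let ?I = "insert None (Some ` {j})"
  have "integrable M (\<lambda>w. \<eta> w * (B j t w - B j s w)) \<and>
    expectation (\<lambda>w. \<eta> w * (B j t w - B j s w)) = 0"
  proof (cases "s = t")
    case False
    then have "s < t" using st by simp
    then have ind: "indep_vars (\<lambda>_. borel) X ?I"
      unfolding X_def using incr_indep[of "{j}" s t \<eta>] j st \<eta> by auto
    have "\<And>i. i \<in> ?I \<Longrightarrow> integrable M (X i)"
      using \<eta>(2) in_L2_integrable[OF incr_in_L2[OF j st]] by (auto simp: X_def)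
    note * = indep_vars_lebesgue_integral[OF _ ind this] indep_vars_integrable[OF _ ind this]
    have "(\<Prod>i\<in>?I. X i w) = \<eta> w * (B j t w - B j s w)" for w by (simp add: X_def)
    moreover have "(\<Prod>i\<in>?I. expectation (X i)) = 0"
      using incr_expectation[OF j st] by (simp add: X_def)
    ultimately show ?thesis using * by simp
  qed simp
  then show "integrable M (\<lambda>w. \<eta> w * (B j t w - B j s w))"
    and "expectation (\<lambda>w. \<eta> w * (B j t w - B j s w)) = 0" by auto
qed

text \<open>For \<open>j\<close> and \<open>k\<close> distinct there are three independent factors,
  two of them centred; for \<open>j = k\<close> there is a squared increment, independent of the
  past, with expectation t - s.\<close>

lemma
  assumes jk: "j \<in> J" "k \<in> J" and st: "0 \<le> s" "s \<le> t" "t \<le> T"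
    and \<eta>: "\<eta> \<in> borel_measurable (F s)" "integrable M \<eta>"
  shows integrable_mult_incr2:
      "integrable M (\<lambda>w. \<eta> w * ((B j t w - B j s w) * (B k t w - B k s w)))"
    and expectation_mult_incr2:
      "expectation (\<lambda>w. \<eta> w * ((B j t w - B j s w) * (B k t w - B k s w))) =
       (if j = k then (t - s) * expectation \<eta> else 0)"
proof -
  define D where "D = (\<lambda>j w. B j t w - B j s w)"
  define X where "X = (\<lambda>a. case a of None \<Rightarrow> \<eta> | Some j \<Rightarrow> D j)"
  have "integrable M (\<lambda>w. \<eta> w * (D j w * D k w)) \<and>
    expectation (\<lambda>w. \<eta> w * (D j w * D k w)) = (if j = k then (t - s) * expectation \<eta> else 0)"
  proof (cases "s = t")
    case True then show ?thesis by (simp add: D_def)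
  next
    case False
    then have "s < t" using st by simp
    let ?I = "insert None (Some ` {j, k})"
    have ind: "indep_vars (\<lambda>_. borel) X ?I"
      unfolding X_def D_def using incr_indep[of "{j, k}" s t \<eta>] jk st \<open>s < t\<close> \<eta> by auto
    have sq: "in_L2 M (D j)" "in_L2 M (D k)"
      using incr_in_L2[OF jk(1) st] incr_in_L2[OF jk(2) st] by (auto simp: D_def)
    show ?thesis
    proof (cases "j = k")
      case jk': False
      have "\<And>i. i \<in> ?I \<Longrightarrow> integrable M (X i)"
        using \<eta>(2) in_L2_integrable[OF sq(1)] in_L2_integrable[OF sq(2)]
        by (auto simp: X_def)
      note * = indep_vars_lebesgue_integral[OF _ ind this] indep_vars_integrable[OF _ ind this]
      have "(\<Prod>i\<in>?I. X i w) = \<eta> w * (D j w * D k w)" for w using jk' by (simp add: X_def)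
      moreover have "(\<Prod>i\<in>?I. expectation (X i)) = 0"
        using incr_expectation[OF jk(1) st] jk' by (simp add: X_def D_def)
      ultimately show ?thesis using * jk' by simp
    next
      case True
      \<comment> \<open>For \<open>j = k\<close> the family has only the indices \<open>None\<close>
        and \<open>Some j\<close>, so a product over it contains the increment once. Squaring the
        Brownian entry and keeping the past unchanged preserves independence and restores the
        missing factor.\<close>
      define g where "g = (\<lambda>a x. case a of None \<Rightarrow> (x::real) | Some (_::'j) \<Rightarrow> x\<^sup>2)"
      have ind2: "indep_vars (\<lambda>_. borel) (\<lambda>i x. g i (X i x)) ?I"
        by (rule indep_vars_compose2[OF ind]) (auto simp: g_def split: option.split)
      have "\<And>i. i \<in> ?I \<Longrightarrow> integrable M (\<lambda>x. g i (X i x))"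
        using \<eta>(2) sq by (auto simp: X_def g_def in_L2_def)
      note * = indep_vars_lebesgue_integral[OF _ ind2 this] indep_vars_integrable[OF _ ind2 this]
      have "(\<Prod>i\<in>?I. g i (X i w)) = \<eta> w * (D j w * D k w)" for w
        using True by (simp add: X_def g_def power2_eq_square)
      moreover have "(\<Prod>i\<in>?I. expectation (\<lambda>x. g i (X i x))) = (t - s) * expectation \<eta>"
        using incr_variance[OF jk(2) st] True by (simp add: X_def g_def D_def)
      ultimately show ?thesis using * True by simp
    qed
  qed
  then show "integrable M (\<lambda>w. \<eta> w * ((B j t w - B j s w) * (B k t w - B k s w)))"
    and "expectation (\<lambda>w. \<eta> w * ((B j t w - B j s w) * (B k t w - B k s w))) =
       (if j = k then (t - s) * expectation \<eta> else 0)" by (auto simp: D_def)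
qed

section \<open>Second moments of pairs of weighted increments\<close>

definition bounded_rv :: "real \<Rightarrow> ('w \<Rightarrow> real) \<Rightarrow> bool" where
  "bounded_rv s \<xi> \<longleftrightarrow> \<xi> \<in> borel_measurable (F s) \<and> (\<exists>C. \<forall>w\<in>space M. \<bar>\<xi> w\<bar> \<le> C)"

lemma bounded_rv_mono: "bounded_rv s \<xi> \<Longrightarrow> 0 \<le> s \<Longrightarrow> s \<le> t \<Longrightarrow> t \<le> T \<Longrightarrow> bounded_rv t \<xi>"
  unfolding bounded_rv_def using F_mono by blast

text \<open>Boundedness, and not mere square integrability, is what makes the product of two values
  of simple integrands again a legitimate weight.\<close>

lemma bounded_rv_mult: "bounded_rv s \<xi> \<Longrightarrow> bounded_rv s \<zeta> \<Longrightarrow> bounded_rv s (\<lambda>w. \<xi> w * \<zeta> w)"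
  unfolding bounded_rv_def
proof safe
  fix C C' assume *: "\<forall>w\<in>space M. \<bar>\<xi> w\<bar> \<le> C" "\<forall>w\<in>space M. \<bar>\<zeta> w\<bar> \<le> C'"
  show "\<exists>C. \<forall>w\<in>space M. \<bar>\<xi> w * \<zeta> w\<bar> \<le> C"
  proof (intro exI ballI)
    fix w assume w: "w \<in> space M"
    show "\<bar>\<xi> w * \<zeta> w\<bar> \<le> C * C'" unfolding abs_mult
      using * w by (intro mult_mono) (auto intro: order_trans[OF abs_ge_zero])
  qed
qed auto

lemma bounded_rv_in_L2:
  assumes "bounded_rv s \<xi>" "0 \<le> s" "s \<le> T" shows "in_L2 M \<xi>"
proof -
  from assms obtain C where C: "\<And>w. w \<in> space M \<Longrightarrow> \<bar>\<xi> w\<bar> \<le> C" by (auto simp: bounded_rv_def)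
  have "\<xi> \<in> borel_measurable M" using assms(1) by (intro F_measurable[OF assms(2,3)]) (simp add: bounded_rv_def)
  then show ?thesis using C by (rule in_L2_bounded)
qed

lemma bounded_rv_mult_in_L2:
  assumes "bounded_rv s \<xi>" "0 \<le> s" "s \<le> T" "in_L2 M f"
  shows "in_L2 M (\<lambda>w. \<xi> w * f w)"
proof -
  from assms obtain C where C: "\<forall>w\<in>space M. \<bar>\<xi> w\<bar> \<le> C" by (auto simp: bounded_rv_def)
  have "\<xi> \<in> borel_measurable M" using assms(1) by (intro F_measurable[OF assms(2,3)]) (simp add: bounded_rv_def)
  then show ?thesis using assms(4) C
    by (intro in_L2_bound[OF assms(4), of _ C])
      (auto simp: in_L2_def abs_mult intro!: mult_right_mono)
qed

lemma in_L2_mult_incr: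
  assumes "j \<in> J" "0 \<le> a" "a \<le> b" "b \<le> T" "bounded_rv a \<xi>"
  shows "in_L2 M (\<lambda>w. \<xi> w * (B j b w - B j a w))"
  using bounded_rv_mult_in_L2[OF assms(5,2) _ incr_in_L2[OF assms(1-4)]] assms by auto

text \<open>The increments over two intervals with the same left end-point: the part beyond the shorter
  of the two intervals contributes nothing.\<close>

lemma expectation_incr_common_start:
  assumes jk: "j \<in> J" "k \<in> J" and r: "0 \<le> c" "c \<le> b" "b \<le> d" "d \<le> T" and \<eta>: "bounded_rv c \<eta>"
  shows "expectation (\<lambda>w. \<eta> w * ((B j b w - B j c w) * (B k d w - B k c w))) =
    (if j = k then (b - c) * expectation \<eta> else 0)"
proof -
  have \<eta>i: "\<eta> \<in> borel_measurable (F c)" "integrable M \<eta>"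
    using \<eta> in_L2_integrable[OF bounded_rv_in_L2[OF \<eta>]] r by (auto simp: bounded_rv_def)
  have s: "in_L2 M (\<lambda>w. \<eta> w * (B j b w - B j c w))"
    using r by (intro in_L2_mult_incr jk \<eta>) auto
  have m: "(\<lambda>w. \<eta> w * (B j b w - B j c w)) \<in> borel_measurable (F b)"
    using F_mono[OF r(1,2) _ \<eta>i(1)] incr_measurable[OF jk(1) r(1,2)] r
    by (intro borel_measurable_times) auto
  note i1 = integrable_mult_incr[OF jk(2) _ r(3,4) m in_L2_integrable[OF s]]
  note e1 = expectation_mult_incr[OF jk(2) _ r(3,4) m in_L2_integrable[OF s]]
  note i2 = integrable_mult_incr2[OF jk r(1,2) _ \<eta>i]
  note e2 = expectation_mult_incr2[OF jk r(1,2) _ \<eta>i]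
  have "expectation (\<lambda>w. \<eta> w * ((B j b w - B j c w) * (B k d w - B k c w)))
     = expectation (\<lambda>w. \<eta> w * ((B j b w - B j c w) * (B k b w - B k c w))
         + \<eta> w * (B j b w - B j c w) * (B k d w - B k b w))"
    by (intro Bochner_Integration.integral_cong refl) (simp add: algebra_simps)
  also have "\<dots> = (if j = k then (b - c) * expectation \<eta> else 0)"
    using i1 i2 e1 e2 r by simp
  finally show ?thesis .
qed

text \<open>The length of the intersection of the intervals from \<open>a\<close> to
  \<open>b\<close> and from \<open>c\<close> to \<open>d\<close>; the maximum with 0 covers disjoint
  intervals.\<close>

definition overlap :: "real \<Rightarrow> real \<Rightarrow> real \<Rightarrow> real \<Rightarrow> real" where
  "overlap a b c d = max 0 (min b d - max a c)"

text \<open>The later starting point \<open>c\<close> splits the first increment. What precedes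
  \<open>c\<close> is known at time \<open>c\<close> and hence orthogonal to the second increment;
  the rest has the same left end-point as the second increment, so that only the common length
  counts.\<close>

lemma expectation_incr_pair_le:
  assumes jk: "j \<in> J" "k \<in> J" and r: "0 \<le> a" "a \<le> b" "b \<le> T" "a \<le> c" "c \<le> d" "d \<le> T"
    and \<xi>: "bounded_rv a \<xi>" and \<zeta>: "bounded_rv c \<zeta>"
  shows "expectation (\<lambda>w. (\<xi> w * (B j b w - B j a w)) * (\<zeta> w * (B k d w - B k c w))) =
    (if j = k then overlap a b c d * expectation (\<lambda>w. \<xi> w * \<zeta> w) else 0)"
proof (cases "b \<le> c")
  case True
  have s: "in_L2 M (\<lambda>w. \<zeta> w * (\<xi> w * (B j b w - B j a w)))"
    using r by (intro bounded_rv_mult_in_L2[OF \<zeta>] in_L2_mult_incr jk \<xi>) auto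
  have m: "(\<lambda>w. \<zeta> w * (\<xi> w * (B j b w - B j a w))) \<in> borel_measurable (F c)"
  proof (intro borel_measurable_times)
    show "\<zeta> \<in> borel_measurable (F c)" using \<zeta> by (simp add: bounded_rv_def)
    show "\<xi> \<in> borel_measurable (F c)" using bounded_rv_mono[OF \<xi>, of c] r by (simp add: bounded_rv_def)
    show "(\<lambda>w. B j b w - B j a w) \<in> borel_measurable (F c)"
      using incr_measurable[OF jk(1) r(1-3)] True r by (intro F_mono[of b c]) auto
  qed
  have "expectation (\<lambda>w. (\<zeta> w * (\<xi> w * (B j b w - B j a w))) * (B k d w - B k c w)) = 0"
    using r by (intro expectation_mult_incr jk m in_L2_integrable[OF s]) auto
  moreover have "overlap a b c d = 0" using r True by (simp add: overlap_def)
  ultimately show ?thesis by (simp add: ac_simps)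
next
  case False
  then have cb: "c \<le> b" by simp
  have s: "in_L2 M (\<lambda>w. \<zeta> w * (\<xi> w * (B j c w - B j a w)))"
    using r by (intro bounded_rv_mult_in_L2[OF \<zeta>] in_L2_mult_incr jk \<xi>) auto
  have m: "(\<lambda>w. \<zeta> w * (\<xi> w * (B j c w - B j a w))) \<in> borel_measurable (F c)"
  proof (intro borel_measurable_times)
    show "\<zeta> \<in> borel_measurable (F c)" using \<zeta> by (simp add: bounded_rv_def)
    show "\<xi> \<in> borel_measurable (F c)" using bounded_rv_mono[OF \<xi>, of c] r by (simp add: bounded_rv_def)
    show "(\<lambda>w. B j c w - B j a w) \<in> borel_measurable (F c)"
      using incr_measurable[OF jk(1), of a c] r by simp
  qed
  have c0: "0 \<le> c" and cT: "c \<le> T" using r by auto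
  note i1 = integrable_mult_incr[OF jk(2) c0 r(5,6) m in_L2_integrable[OF s]]
  note e1 = expectation_mult_incr[OF jk(2) c0 r(5,6) m in_L2_integrable[OF s]]
  have \<eta>: "bounded_rv c (\<lambda>w. \<xi> w * \<zeta> w)"
    using bounded_rv_mult[OF bounded_rv_mono[OF \<xi>] \<zeta>] r by auto
  have i2: "integrable M (\<lambda>w. (\<xi> w * \<zeta> w) * ((B j b w - B j c w) * (B k d w - B k c w)))"
    using in_L2_mult[OF in_L2_mult_incr[OF jk(1) c0 cb r(3) \<eta>]
        incr_in_L2[OF jk(2) c0 r(5,6)]] by (simp add: ac_simps)
  have e2: "expectation (\<lambda>w. (\<xi> w * \<zeta> w) * ((B j b w - B j c w) * (B k d w - B k c w)))
    = (if j = k then (min b d - c) * expectation (\<lambda>w. \<xi> w * \<zeta> w) else 0)"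
  proof (cases "b \<le> d")
    case True
    then show ?thesis using expectation_incr_common_start[OF jk c0 cb True r(6) \<eta>] by simp
  next
    case False
    then have "d \<le> b" by simp
    from expectation_incr_common_start[OF jk(2,1) c0 r(5) this r(3) \<eta>] False
    show ?thesis by (auto simp: mult.commute)
  qed
  have ov: "overlap a b c d = min b d - c" using r cb by (simp add: overlap_def)
  have "expectation (\<lambda>w. (\<xi> w * (B j b w - B j a w)) * (\<zeta> w * (B k d w - B k c w)))
     = expectation (\<lambda>w. \<zeta> w * (\<xi> w * (B j c w - B j a w)) * (B k d w - B k c w)
        + (\<xi> w * \<zeta> w) * ((B j b w - B j c w) * (B k d w - B k c w)))"
    by (intro Bochner_Integration.integral_cong refl) (simp add: algebra_simps)
  also have "\<dots> = (if j = k then (min b d - c) * expectation (\<lambda>w. \<xi> w * \<zeta> w) else 0)"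
    using i1 i2 e1 e2 by simp
  finally show ?thesis unfolding ov .
qed

lemma expectation_incr_pair:
  assumes jk: "j \<in> J" "k \<in> J" and r: "0 \<le> a" "a \<le> b" "b \<le> T" "0 \<le> c" "c \<le> d" "d \<le> T"
    and \<xi>: "bounded_rv a \<xi>" and \<zeta>: "bounded_rv c \<zeta>"
  shows "expectation (\<lambda>w. (\<xi> w * (B j b w - B j a w)) * (\<zeta> w * (B k d w - B k c w))) =
    (if j = k then overlap a b c d * expectation (\<lambda>w. \<xi> w * \<zeta> w) else 0)"
proof (cases "a \<le> c")
  case True
  then show ?thesis using expectation_incr_pair_le[OF jk r(1-3) True r(5,6) \<xi> \<zeta>] by simp
next
  case False
  then have "c \<le> a" by simp
  from expectation_incr_pair_le[OF jk(2,1) r(4-6) this r(2,3) \<zeta> \<xi>]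
  show ?thesis by (auto simp: mult.commute overlap_def min.commute max.commute)
qed

end

section \<open>Elementary stochastic integrals\<close>

lemma product_integrable_times:
  assumes "sigma_finite_measure M1" "sigma_finite_measure M2"
    and f: "integrable M1 (f :: 'a \<Rightarrow> real)" and g: "integrable M2 (g :: 'b \<Rightarrow> real)"
  shows "integrable (M1 \<Otimes>\<^sub>M M2) (\<lambda>(x, y). f x * g y)"
    and "(\<integral>(x, y). f x * g y \<partial>(M1 \<Otimes>\<^sub>M M2)) = (\<integral>x. f x \<partial>M1) * (\<integral>y. g y \<partial>M2)"
proof -
  interpret M1: sigma_finite_measure M1 by fact
  interpret M2: sigma_finite_measure M2 by fact
  interpret pair_sigma_finite M1 M2 ..
  have [measurable]: "f \<in> borel_measurable M1" "g \<in> borel_measurable M2" using f g by auto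
  show i: "integrable (M1 \<Otimes>\<^sub>M M2) (\<lambda>(x, y). f x * g y)"
    by (rule Fubini_integrable) (use f g in \<open>auto simp: abs_mult\<close>)
  show "(\<integral>(x, y). f x * g y \<partial>(M1 \<Otimes>\<^sub>M M2)) = (\<integral>x. f x \<partial>M1) * (\<integral>y. g y \<partial>M2)"
    using integral_fst'[OF i] by simp
qed

lemma finite_measure_lebesgue_Icc: "finite_measure (lebesgue_on {a..b::real})"
  by (rule finite_measure_lebesgue_on) simp

lemma measurable_id_lebesgue_on: "(\<lambda>x. x) \<in> borel_measurable (lebesgue_on S)"
  by (rule measurable_restrict_space1) (simp add: measurable_completion)

lemma indicator_measurable_lebesgue_on:
  "A \<in> sets borel \<Longrightarrow> (indicator A :: real \<Rightarrow> real) \<in> borel_measurable (lebesgue_on S)"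
  by (rule measurable_restrict_space1) (simp add: measurable_completion)

text \<open>Pairing with a vector of norm at most 1 is a contraction, so the approximating simple
  integrands can be paired as well and keep their partitions. Axis vectors reduce vector-valued
  integrals to their components.\<close>

lemma ito_integral_inner:
  assumes I: "ito_integral M F T W \<phi> I" and v: "norm v \<le> 1"
  shows "ito_integral M F T W (\<lambda>t w. \<phi> t w \<bullet> v) (\<lambda>t w. I t w \<bullet> v)"
proof -
  have le: "(a \<bullet> v)\<^sup>2 \<le> (norm a)\<^sup>2" for a
  proof -
    have "\<bar>a \<bullet> v\<bar> \<le> norm a * norm v" by (rule Cauchy_Schwarz_ineq2)
    also have "\<dots> \<le> norm a" using v by (simp add: mult_left_le)
    finally show ?thesis by (metis abs_ge_zero power2_abs power_mono)
  qed
  have adapted: "meas_adapted M F T (\<lambda>t w. X t w \<bullet> v)" if "meas_adapted M F T X" for X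
  proof -
    have "(\<lambda>p. (case p of (t, w) \<Rightarrow> X t w) \<bullet> v) \<in> borel_measurable (lebesgue_on {0..T} \<Otimes>\<^sub>M M)"
      using that unfolding meas_adapted_def by (intro borel_measurable_inner) auto
    then show ?thesis using that unfolding meas_adapted_def
      by (auto simp: case_prod_unfold intro!: borel_measurable_inner)
  qed
  from I obtain p \<tau> \<xi> where a: "meas_adapted M F T \<phi>" "meas_adapted M F T I"
    and fin: "(\<integral>\<^sup>+w. (\<integral>\<^sup>+t. ennreal ((norm (\<phi> t w))\<^sup>2) \<partial>lebesgue_on {0..T}) \<partial>M) < \<infinity>"
    and c: "AE w in M. continuous_on {0..T} (\<lambda>t. I t w)"
    and s: "\<And>n. simple_integrand M F T (p n) (\<tau> n) (\<xi> n)"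
    and l1: "(\<lambda>n. \<integral>\<^sup>+w. (\<integral>\<^sup>+t. ennreal ((norm (\<phi> t w - simple_process (p n) (\<tau> n) (\<xi> n) t w))\<^sup>2)
                \<partial>lebesgue_on {0..T}) \<partial>M) \<longlonglongrightarrow> 0"
    and l2: "\<And>t. t\<in>{0..T} \<Longrightarrow> (\<lambda>n. \<integral>\<^sup>+w. ennreal ((norm (I t w -
            simple_integral W (p n) (\<tau> n) (\<xi> n) t w))\<^sup>2) \<partial>M) \<longlonglongrightarrow> 0"
    unfolding ito_integral_def by blast
  define \<xi>' where "\<xi>' = (\<lambda>n l w. \<xi> n l w \<bullet> v)"
  have sp: "simple_process (p n) (\<tau> n) (\<xi>' n) t w = simple_process (p n) (\<tau> n) (\<xi> n) t w \<bullet> v" for n t w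
    by (simp add: simple_process_def \<xi>'_def inner_sum_left)
  have si: "simple_integral W (p n) (\<tau> n) (\<xi>' n) t w = simple_integral W (p n) (\<tau> n) (\<xi> n) t w \<bullet> v" for n t w
    by (simp add: Defs.simple_integral_def \<xi>'_def inner_sum_left)
  have 1: "simple_integrand M F T (p n) (\<tau> n) (\<xi>' n)" for n
  proof -
    have "\<exists>C. \<forall>w\<in>space M. norm (\<xi>' n l w) \<le> C" if "l < p n" for l
    proof -
      from s[of n] that obtain C where C: "\<forall>w\<in>space M. norm (\<xi> n l w) \<le> C"
        unfolding simple_integrand_def by blast
      have "norm (\<xi>' n l w) \<le> C" if "w \<in> space M" for w
      proof -
        have "\<bar>\<xi> n l w \<bullet> v\<bar> \<le> norm (\<xi> n l w)" by (rule power2_le_imp_le) (simp_all add: le)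
        then show ?thesis using C that by (force simp: \<xi>'_def)
      qed
      then show ?thesis by blast
    qed
    then show ?thesis using s[of n] unfolding simple_integrand_def \<xi>'_def
      by (auto intro!: borel_measurable_inner)
  qed
  have 2: "(\<lambda>n. \<integral>\<^sup>+w. (\<integral>\<^sup>+t. ennreal ((norm (\<phi> t w \<bullet> v - simple_process (p n) (\<tau> n) (\<xi>' n) t w))\<^sup>2)
                \<partial>lebesgue_on {0..T}) \<partial>M) \<longlonglongrightarrow> 0"
    by (rule tendsto_sandwich[OF _ _ tendsto_const l1], goal_cases)
      (auto intro!: always_eventually nn_integral_mono ennreal_leI simp: sp inner_diff_left[symmetric] le)
  have 3: "(\<lambda>n. \<integral>\<^sup>+w. ennreal ((norm (I t w \<bullet> v -
            simple_integral W (p n) (\<tau> n) (\<xi>' n) t w))\<^sup>2) \<partial>M) \<longlonglongrightarrow> 0" if "t \<in> {0..T}" for t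
    by (rule tendsto_sandwich[OF _ _ tendsto_const l2[OF that]], goal_cases)
      (auto intro!: always_eventually nn_integral_mono ennreal_leI simp: si inner_diff_left[symmetric] le)
  have "(\<integral>\<^sup>+w. (\<integral>\<^sup>+t. ennreal ((norm (\<phi> t w \<bullet> v))\<^sup>2) \<partial>lebesgue_on {0..T}) \<partial>M)
     \<le> (\<integral>\<^sup>+w. (\<integral>\<^sup>+t. ennreal ((norm (\<phi> t w))\<^sup>2) \<partial>lebesgue_on {0..T}) \<partial>M)"
    by (intro nn_integral_mono ennreal_leI) (simp add: le)
  then have 4: "(\<integral>\<^sup>+w. (\<integral>\<^sup>+t. ennreal ((norm (\<phi> t w \<bullet> v))\<^sup>2) \<partial>lebesgue_on {0..T}) \<partial>M) < \<infinity>"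
    using fin by (rule le_less_trans)
  have 5: "AE w in M. continuous_on {0..T} (\<lambda>t. I t w \<bullet> v)"
    using c by eventually_elim (intro continuous_intros)
  show ?thesis unfolding ito_integral_def
    using adapted[OF a(1)] adapted[OF a(2)] 1 2 3 4 5 by blast
qed

context brownian_setting
begin

abbreviation L :: "real measure" where "L \<equiv> lebesgue_on {0..T}"
abbreviation LM :: "(real \<times> 'w) measure" where "LM \<equiv> L \<Otimes>\<^sub>M M"

sublocale L: finite_measure L by (rule finite_measure_lebesgue_Icc)
sublocale LM: pair_sigma_finite L M ..
sublocale LM: finite_measure LM
  by (rule finite_measure_pair_measure) unfold_locales

lemma
  assumes s: "simple_integrand M F T p \<tau> \<xi>" and l: "l < p"
  shows simple_integrand_range: "0 \<le> \<tau> l" "\<tau> l \<le> \<tau> (Suc l)" "\<tau> (Suc l) \<le> T"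
    and simple_integrand_bounded: "bounded_rv (\<tau> l) (\<xi> l :: 'w \<Rightarrow> real)"
proof -
  have mono: "a \<le> b \<Longrightarrow> b \<le> p \<Longrightarrow> \<tau> a \<le> \<tau> b" for a b
  proof (induction b)
    case (Suc b)
    have "\<tau> b \<le> \<tau> (Suc b)" using s Suc.prems by (auto simp: simple_integrand_def)
    then show ?case using Suc by (cases "a = Suc b") auto
  qed simp
  show "0 \<le> \<tau> l" "\<tau> l \<le> \<tau> (Suc l)" "\<tau> (Suc l) \<le> T"
    using mono[of 0 l] mono[of l "Suc l"] mono[of "Suc l" p] s l by (auto simp: simple_integrand_def)
  show "bounded_rv (\<tau> l) (\<xi> l)" using s l by (auto simp: simple_integrand_def bounded_rv_def)
qed

text \<open>If \<open>\<tau> l > t\<close>, the increment over the \<open>l\<close>-th interval stopped at \<open>t\<close> vanishes, but \<open>\<xi> l\<close> need not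
  be measurable with respect to \<open>F t\<close>; it is replaced by 0 to keep the summand adapted.\<close>

definition clip :: "real \<Rightarrow> (nat \<Rightarrow> real) \<Rightarrow> (nat \<Rightarrow> 'w \<Rightarrow> real) \<Rightarrow> nat \<Rightarrow> 'w \<Rightarrow> real" where
  "clip t \<tau> \<xi> l = (if \<tau> l \<le> t then \<xi> l else (\<lambda>_. 0))"

text \<open>Where \<open>\<xi> l\<close> survives, the minimum is \<open>\<tau> l\<close>; otherwise
  the clipped value is constant and measurable at any time.\<close>

lemma bounded_clip:
  assumes s: "simple_integrand M F T p \<tau> \<xi>" and l: "l < p"
  shows "bounded_rv (min (\<tau> l) t) (clip t \<tau> \<xi> l)"
  using simple_integrand_bounded[OF s l] by (auto simp: clip_def bounded_rv_def min_def)

lemma simple_integral_clip: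
  assumes s: "simple_integrand M F T p \<tau> \<xi>"
  shows "simple_integral W p \<tau> \<xi> t w =
    (\<Sum>l<p. clip t \<tau> \<xi> l w * (W (min (\<tau> (Suc l)) t) w - W (min (\<tau> l) t) w))"
  unfolding Defs.simple_integral_def
proof (rule sum.cong[OF refl])
  fix l assume "l \<in> {..<p}"
  then show "(W (min (\<tau> (Suc l)) t) w - W (min (\<tau> l) t) w) *\<^sub>R \<xi> l w =
    clip t \<tau> \<xi> l w * (W (min (\<tau> (Suc l)) t) w - W (min (\<tau> l) t) w)"
    using simple_integrand_range[OF s, of l] by (auto simp: clip_def min_def)
qed

lemma clip_term_in_L2:
  assumes j: "j \<in> J" and s: "simple_integrand M F T p \<tau> \<xi>" and l: "l < p" and t: "0 \<le> t" "t \<le> T"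
  shows "in_L2 M (\<lambda>w. clip t \<tau> \<xi> l w * (B j (min (\<tau> (Suc l)) t) w - B j (min (\<tau> l) t) w))"
  by (rule in_L2_mult_incr[OF j _ _ _ bounded_clip[OF s l]])
    (use simple_integrand_range[OF s l] t in auto)

lemma simple_integral_in_L2:
  assumes j: "j \<in> J" and s: "simple_integrand M F T p \<tau> \<xi>" and t: "0 \<le> t" "t \<le> T"
  shows "in_L2 M (\<lambda>w. simple_integral (B j) p \<tau> (\<xi> :: nat \<Rightarrow> 'w \<Rightarrow> real) t w)"
  unfolding simple_integral_clip[OF s]
  by (rule in_L2_sum) (use clip_term_in_L2[OF j s _ t] in auto)

text \<open>Cutting time off at \<open>t\<close> amounts to stopping all four end-points at
  \<open>t\<close>, which is how they occur in the elementary integrals at time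
  \<open>t\<close>.\<close>

lemma integral_indicator_overlap:
  assumes r: "0 \<le> a" "a \<le> b" "b \<le> T" "0 \<le> c" "c \<le> d" "d \<le> T" and t: "0 \<le> t" "t \<le> T"
    and at: "a \<le> t" and ct: "c \<le> t"
  shows "(\<integral>s. indicator {..t} s * (indicator {a<..b} s * indicator {c<..d} s) \<partial>L) =
    overlap (min a t) (min b t) (min c t) (min d t)"
proof -
  have *: "indicator {..t} s * (indicator {a<..b} s * indicator {c<..d} s) =
      (indicator {max a c<..min (min b d) t} s :: real)" for s
    by (auto split: split_indicator)
  have sub: "{max a c<..min (min b d) t} \<subseteq> {0..T}" using r t by auto
  have "(\<integral>s. indicator {..t} s * (indicator {a<..b} s * indicator {c<..d} s) \<partial>L) =
      measure L ({max a c<..min (min b d) t} \<inter> space L)"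
    unfolding * by (rule Bochner_Integration.integral_indicator)
  also have "{max a c<..min (min b d) t} \<inter> space L = {max a c<..min (min b d) t}" using sub by auto
  also have "measure L {max a c<..min (min b d) t} = measure lebesgue {max a c<..min (min b d) t}"
    using sub by (intro measure_restrict_space) auto
  also have "\<dots> = measure lborel {max a c<..min (min b d) t}" by (simp add: measure_completion)
  also have "\<dots> = max 0 (min (min b d) t - max a c)"
    by (cases "max a c \<le> min (min b d) t") auto
  also have "\<dots> = overlap (min a t) (min b t) (min c t) (min d t)"
    unfolding overlap_def using r at ct by (auto simp: min_def max_def)
  finally show ?thesis .
qed

text \<open>Brings the integral over the product space into the form of the double sum that also
  arises from the expectations of pairs of increments; the isometry is then a comparison of
  coefficients.\<close>

lemma simple_process_product:
  assumes s1: "simple_integrand M F T p1 \<tau>1 \<xi>1" and s2: "simple_integrand M F T p2 \<tau>2 (\<xi>2 :: nat \<Rightarrow> 'w \<Rightarrow> real)"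
    and t: "0 \<le> t" "t \<le> T"
  shows "(\<integral>(s, w). indicator {..t} s * (simple_process p1 \<tau>1 \<xi>1 s w * simple_process p2 \<tau>2 \<xi>2 s w) \<partial>LM)
    = (\<Sum>l<p1. \<Sum>m<p2. overlap (min (\<tau>1 l) t) (min (\<tau>1 (Suc l)) t) (min (\<tau>2 m) t) (min (\<tau>2 (Suc m)) t)
        * expectation (\<lambda>w. clip t \<tau>1 \<xi>1 l w * clip t \<tau>2 \<xi>2 m w))"
proof -
  let ?g = "\<lambda>l m s. indicator {..t} s * (indicator {\<tau>1 l<..\<tau>1 (Suc l)} s * indicator {\<tau>2 m<..\<tau>2 (Suc m)} s) :: real"
  let ?h = "\<lambda>l m w. \<xi>1 l w * \<xi>2 m w"
  have gi: "integrable L (?g l m)" for l m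
  proof (rule L.integrable_const_bound[of _ 1])
    show "?g l m \<in> borel_measurable L"
      by (intro borel_measurable_times indicator_measurable_lebesgue_on) auto
  qed (auto split: split_indicator)
  have hi: "integrable M (?h l m)" if "l < p1" "m < p2" for l m
    using that simple_integrand_range[OF s1, of l] simple_integrand_range[OF s2, of m]
    by (intro in_L2_mult bounded_rv_in_L2[OF simple_integrand_bounded[OF s1]]
       bounded_rv_in_L2[OF simple_integrand_bounded[OF s2]]) auto
  have "(\<integral>(s, w). indicator {..t} s * (simple_process p1 \<tau>1 \<xi>1 s w * simple_process p2 \<tau>2 \<xi>2 s w) \<partial>LM)
    = (\<integral>z. (\<Sum>l<p1. \<Sum>m<p2. (case z of (s, w) \<Rightarrow> ?g l m s * ?h l m w)) \<partial>LM)"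
  proof (intro Bochner_Integration.integral_cong refl, clarify)
    fix s w
    show "indicator {..t} s * (simple_process p1 \<tau>1 \<xi>1 s w * simple_process p2 \<tau>2 \<xi>2 s w) =
      (\<Sum>l<p1. \<Sum>m<p2. ?g l m s * ?h l m w)"
      unfolding simple_process_def sum_product
      unfolding sum_distrib_left
      by (intro sum.cong refl) (simp add: ac_simps)
  qed
  also have "\<dots> = (\<Sum>l<p1. \<Sum>m<p2. \<integral>(s, w). ?g l m s * ?h l m w \<partial>LM)"
    by (subst Bochner_Integration.integral_sum, intro Bochner_Integration.integrable_sum,
        (rule product_integrable_times[OF L.sigma_finite_measure_axioms sigma_finite_measure_axioms gi hi]; simp),
        intro sum.cong refl Bochner_Integration.integral_sum,
        (rule product_integrable_times[OF L.sigma_finite_measure_axioms sigma_finite_measure_axioms gi hi]; simp))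
  also have "\<dots> = (\<Sum>l<p1. \<Sum>m<p2. (\<integral>s. ?g l m s \<partial>L) * expectation (?h l m))"
    by (intro sum.cong refl
        product_integrable_times(2)[OF L.sigma_finite_measure_axioms sigma_finite_measure_axioms gi hi]) auto
  also have "\<dots> = (\<Sum>l<p1. \<Sum>m<p2. overlap (min (\<tau>1 l) t) (min (\<tau>1 (Suc l)) t) (min (\<tau>2 m) t) (min (\<tau>2 (Suc m)) t)
        * expectation (\<lambda>w. clip t \<tau>1 \<xi>1 l w * clip t \<tau>2 \<xi>2 m w))"
  proof (intro sum.cong refl, goal_cases)
    case (1 l m)
    show ?case
    proof (cases "\<tau>1 l \<le> t \<and> \<tau>2 m \<le> t")
      case True
      have "(\<integral>s. ?g l m s \<partial>L) = overlap (min (\<tau>1 l) t) (min (\<tau>1 (Suc l)) t) (min (\<tau>2 m) t) (min (\<tau>2 (Suc m)) t)"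
        using 1 True simple_integrand_range[OF s1, of l] simple_integrand_range[OF s2, of m] t
        by (intro integral_indicator_overlap) auto
      then show ?thesis using True by (simp add: clip_def)
    next
      \<comment> \<open>An interval that begins after \<open>t\<close> contributes nothing on either
        side: the indicators exclude each other, and the clipped value is 0.\<close>
      case False
      then have "?g l m = (\<lambda>_. 0)" by (intro ext) (auto split: split_indicator)
      then have "(\<integral>s. ?g l m s \<partial>L) = 0" by simp
      moreover have "(\<lambda>w. clip t \<tau>1 \<xi>1 l w * clip t \<tau>2 \<xi>2 m w) = (\<lambda>_. 0)" using False by (auto simp: clip_def)
      ultimately show ?thesis by simp
    qed
  qed
  finally show ?thesis .
qed

lemma simple_integral_isometry:
  assumes jk: "j \<in> J" "k \<in> J"
    and s1: "simple_integrand M F T p1 \<tau>1 \<xi>1" and s2: "simple_integrand M F T p2 \<tau>2 (\<xi>2 :: nat \<Rightarrow> 'w \<Rightarrow> real)"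
    and t: "0 \<le> t" "t \<le> T"
  shows "expectation (\<lambda>w. simple_integral (B j) p1 \<tau>1 \<xi>1 t w * simple_integral (B k) p2 \<tau>2 \<xi>2 t w) =
    (if j = k then (\<integral>(s, w). indicator {..t} s * (simple_process p1 \<tau>1 \<xi>1 s w * simple_process p2 \<tau>2 \<xi>2 s w) \<partial>LM)
     else 0)"
proof -
  let ?X = "\<lambda>l w. clip t \<tau>1 \<xi>1 l w * (B j (min (\<tau>1 (Suc l)) t) w - B j (min (\<tau>1 l) t) w)"
  let ?Y = "\<lambda>m w. clip t \<tau>2 \<xi>2 m w * (B k (min (\<tau>2 (Suc m)) t) w - B k (min (\<tau>2 m) t) w)"
  let ?ov = "\<lambda>l m. overlap (min (\<tau>1 l) t) (min (\<tau>1 (Suc l)) t) (min (\<tau>2 m) t) (min (\<tau>2 (Suc m)) t)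
        * expectation (\<lambda>w. clip t \<tau>1 \<xi>1 l w * clip t \<tau>2 \<xi>2 m w)"
  have i: "integrable M (\<lambda>w. ?X l w * ?Y m w)" if "l < p1" "m < p2" for l m
    by (intro in_L2_mult clip_term_in_L2[OF jk(1) s1 that(1) t]
      clip_term_in_L2[OF jk(2) s2 that(2) t])
  have "expectation (\<lambda>w. simple_integral (B j) p1 \<tau>1 \<xi>1 t w * simple_integral (B k) p2 \<tau>2 \<xi>2 t w)
    = expectation (\<lambda>w. \<Sum>l<p1. \<Sum>m<p2. ?X l w * ?Y m w)"
    unfolding simple_integral_clip[OF s1] simple_integral_clip[OF s2] sum_product ..
  also have "\<dots> = (\<Sum>l<p1. \<Sum>m<p2. expectation (\<lambda>w. ?X l w * ?Y m w))"
    by (subst Bochner_Integration.integral_sum, intro Bochner_Integration.integrable_sum, (rule i; simp),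
        intro sum.cong refl Bochner_Integration.integral_sum, (rule i; simp))
  also have "\<dots> = (\<Sum>l<p1. \<Sum>m<p2. if j = k then ?ov l m else 0)"
  proof (intro sum.cong refl, goal_cases)
    case (1 l m)
    then show ?case
      using simple_integrand_range[OF s1, of l] simple_integrand_range[OF s2, of m] t
      by (intro expectation_incr_pair jk bounded_clip[OF s1] bounded_clip[OF s2]) auto
  qed
  also have "\<dots> = (if j = k then \<Sum>l<p1. \<Sum>m<p2. ?ov l m else 0)" by simp
  finally show ?thesis unfolding simple_process_product[OF s1 s2 t] .
qed

text \<open>From \<open>r\<close> to \<open>t\<close> each summand gains a weighted increment that
  starts no earlier than \<open>r\<close>, and \<alpha> belongs to the past of this
  increment.\<close>

lemma simple_integral_orthogonal:
  assumes j: "j \<in> J" and s: "simple_integrand M F T p \<tau> (\<xi> :: nat \<Rightarrow> 'w \<Rightarrow> real)"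
    and r: "0 \<le> r" "r \<le> t" "t \<le> T" and \<alpha>: "\<alpha> \<in> borel_measurable (F r)" "in_L2 M \<alpha>"
  shows "expectation (\<lambda>w. \<alpha> w * simple_integral (B j) p \<tau> \<xi> t w) =
    expectation (\<lambda>w. \<alpha> w * simple_integral (B j) p \<tau> \<xi> r w)"
proof -
  let ?X = "\<lambda>t l w. clip t \<tau> \<xi> l w * (B j (min (\<tau> (Suc l)) t) w - B j (min (\<tau> l) t) w)"
  have i: "integrable M (\<lambda>w. \<alpha> w * ?X t l w)" if "l < p" "0 \<le> t" "t \<le> T" for l t
    by (intro in_L2_mult \<alpha> clip_term_in_L2[OF j s that])
  have *: "expectation (\<lambda>w. \<alpha> w * simple_integral (B j) p \<tau> \<xi> t w) =
    (\<Sum>l<p. expectation (\<lambda>w. \<alpha> w * ?X t l w))" if "0 \<le> t" "t \<le> T" for t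
    unfolding simple_integral_clip[OF s] sum_distrib_left
    by (rule Bochner_Integration.integral_sum) (use i that in auto)
  have "expectation (\<lambda>w. \<alpha> w * ?X t l w) = expectation (\<lambda>w. \<alpha> w * ?X r l w)" if l: "l < p" for l
  proof -
    note rg = simple_integrand_range[OF s l]
    \<comment> \<open>The end-points of the part of the \<open>l\<close>-th interval that lies
      between \<open>r\<close> and \<open>t\<close>. They are out of order only if the interval
      begins after \<open>t\<close>, and then both clipped terms are 0.\<close>
    let ?a = "max (\<tau> l) r" and ?b = "min (max (\<tau> (Suc l)) r) t"
    show ?thesis
    proof (cases "?a \<le> ?b")
      case False
      then have "?X t l w = ?X r l w" for w using rg r by (auto simp: clip_def min_def max_def split: if_splits)
      then show ?thesis by simp
    next
      case True
      have "bounded_rv ?a (\<xi> l)"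
        using True rg r by (intro bounded_rv_mono[OF simple_integrand_bounded[OF s l]]) auto
      then have \<xi>: "\<xi> l \<in> borel_measurable (F ?a)" and \<xi>2: "in_L2 M (\<lambda>w. \<xi> l w)"
        using bounded_rv_in_L2[of ?a "\<xi> l"] True rg r by (auto simp: bounded_rv_def)
      have \<alpha>a: "\<alpha> \<in> borel_measurable (F ?a)"
        using True rg r by (intro F_mono[OF _ _ _ \<alpha>(1)]) auto
      have m: "(\<lambda>w. \<alpha> w * \<xi> l w) \<in> borel_measurable (F ?a)" using \<xi> \<alpha>a by simp
      have 0: "expectation (\<lambda>w. (\<alpha> w * \<xi> l w) * (B j ?b w - B j ?a w)) = 0"
        using True rg r by (intro expectation_mult_incr j m in_L2_mult \<alpha> \<xi>2) auto
      have eq: "\<alpha> w * ?X t l w - \<alpha> w * ?X r l w = (\<alpha> w * \<xi> l w) * (B j ?b w - B j ?a w)" for w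
        using rg r True by (auto simp: clip_def min_def max_def algebra_simps split: if_splits)
      have "expectation (\<lambda>w. \<alpha> w * ?X t l w) - expectation (\<lambda>w. \<alpha> w * ?X r l w)
        = expectation (\<lambda>w. \<alpha> w * ?X t l w - \<alpha> w * ?X r l w)"
        using i[OF l] r by (intro Bochner_Integration.integral_diff[symmetric]) auto
      then show ?thesis unfolding eq 0 by simp
    qed
  qed
  then show ?thesis using * r by simp
qed

end

section \<open>Isometry and orthogonality of the stochastic integral\<close>

lemma AE_lebesgue_on_neq: "AE r in lebesgue_on {a..b::real}. r \<noteq> s"
proof -
  have "AE r in lebesgue. r \<noteq> s" by (rule AE_completion[OF AE_lborel_singleton])
  then show ?thesis by (subst AE_restrict_space_iff) (auto elim: eventually_mono)
qed

text \<open>The varying domain is traded for an indicator over a fixed measure, so that joint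
  measurability and Fubini refer to one product space for all \<open>t\<close>.\<close>

lemma integral_lebesgue_on_upto:
  fixes f :: "real \<Rightarrow> real"
  assumes "t \<le> b"
  shows "(LINT s|lebesgue_on {a..t}. f s) = (LINT s|lebesgue_on {a..b}. indicator {..t} s * f s)"
proof -
  have eq: "indicator {a..t} s *\<^sub>R f s = indicator {a..b} s *\<^sub>R (indicator {..t} s * f s)" for s
    using assms by (auto split: split_indicator)
  have "(LINT s|lebesgue_on {a..t}. f s) = (LINT s|lebesgue. indicator {a..t} s *\<^sub>R f s)"
    by (rule integral_restrict_space) simp
  also have "\<dots> = (LINT s|lebesgue_on {a..b}. indicator {..t} s * f s)"
    unfolding eq by (rule integral_restrict_space[symmetric]) simp
  finally show ?thesis .
qed

lemma measurable_indicator_atMost_pair: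
  assumes [measurable]: "f \<in> borel_measurable N" "g \<in> borel_measurable N"
  shows "(\<lambda>x. indicator {..f x} (g x :: real) :: real) \<in> borel_measurable N"
proof -
  have "(\<lambda>x. indicator {..f x} (g x) :: real) = (\<lambda>x. if g x \<le> f x then 1 else 0)"
    by (auto split: split_indicator)
  then show ?thesis by simp
qed

text \<open>Fubini on the square for the kernel f(s) g(r): the diagonal cuts the square into two
  triangles, and each of the two iterated integrals is the integral over one of them.\<close>

lemma integral_by_parts_indefinite:
  fixes f g :: "real \<Rightarrow> real" and a b :: real
  defines "L \<equiv> lebesgue_on {a..b}"
  assumes f: "integrable L f" and g: "integrable L g"
  shows "integrable L (\<lambda>s. f s * (LINT r|L. indicator {..s} r * g r))" (is ?I1)
    and "(LINT s|L. f s * (LINT r|L. indicator {..s} r * g r) + g s * (LINT r|L. indicator {..s} r * f r))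
      = (LINT s|L. f s) * (LINT s|L. g s)" (is ?E)
proof -
  interpret L: finite_measure L unfolding L_def by (rule finite_measure_lebesgue_Icc)
  interpret LL: pair_sigma_finite L L ..
  have [measurable]: "f \<in> borel_measurable L" "g \<in> borel_measurable L" using f g by auto
  have [measurable]: "(\<lambda>x. x) \<in> borel_measurable L" unfolding L_def by (rule measurable_id_lebesgue_on)
  have int: "integrable (L \<Otimes>\<^sub>M L) (\<lambda>(s, r). indicator {..s} r * (f s * g r))"
    if f: "integrable L f" and g: "integrable L g" for f g :: "real \<Rightarrow> real"
  proof (rule Bochner_Integration.integrable_bound)
    show "integrable (L \<Otimes>\<^sub>M L) (\<lambda>(s, r). f s * g r)"
      by (rule product_integrable_times[OF L.sigma_finite_measure_axioms L.sigma_finite_measure_axioms f g])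
    have [measurable]: "f \<in> borel_measurable L" "g \<in> borel_measurable L" using f g by auto
    have [measurable]: "(\<lambda>z. indicator {..fst z} (snd z) :: real) \<in> borel_measurable (L \<Otimes>\<^sub>M L)"
      by (rule measurable_indicator_atMost_pair; measurable)
    show "(\<lambda>(s, r). indicator {..s} r * (f s * g r)) \<in> borel_measurable (L \<Otimes>\<^sub>M L)"
      unfolding case_prod_unfold by measurable
  qed (auto split: split_indicator)
  have inner: "integrable L (\<lambda>s. f s * (LINT r|L. indicator {..s} r * g r))"
    if f: "integrable L f" and g: "integrable L g" for f g :: "real \<Rightarrow> real"
    using LL.integrable_fst[OF int[OF f g]] by (simp add: mult.left_commute)
  show ?I1 using inner[OF f g] .
  \<comment> \<open>Exchanging the order turns \<open>g\<close> at time \<open>s\<close> against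
    \<open>f\<close> before \<open>s\<close> into \<open>f\<close> at time \<open>s\<close> against
    \<open>g\<close> after \<open>s\<close>, the complementary triangle.\<close>
  have swap: "(LINT s|L. g s * (LINT r|L. indicator {..s} r * f r)) = (LINT s|L. f s * (LINT r|L. indicator {s..} r * g r))"
  proof -
    have "(LINT s|L. g s * (LINT r|L. indicator {..s} r * f r)) = (LINT s|L. LINT r|L. indicator {..s} r * (g s * f r))"
      by (simp add: mult.left_commute)
    also have "\<dots> = (LINT r|L. LINT s|L. indicator {..s} r * (g s * f r))"
      by (rule LL.Fubini_integral[OF int[OF g f], symmetric])
    also have "\<dots> = (LINT r|L. LINT s|L. f r * (indicator {r..} s * g s))"
      by (intro Bochner_Integration.integral_cong refl) (auto split: split_indicator)
    finally show ?thesis by simp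
  qed
  have "(LINT s|L. f s * (LINT r|L. indicator {..s} r * g r) + g s * (LINT r|L. indicator {..s} r * f r))
    = (LINT s|L. f s * (LINT r|L. indicator {..s} r * g r)) + (LINT s|L. g s * (LINT r|L. indicator {..s} r * f r))"
    using inner[OF f g] inner[OF g f] by (rule Bochner_Integration.integral_add)
  also have "\<dots> = (LINT s|L. f s * (LINT r|L. indicator {..s} r * g r)) + (LINT s|L. f s * (LINT r|L. indicator {s..} r * g r))"
    unfolding swap ..
  also have "\<dots> = (LINT s|L. f s * (LINT r|L. indicator {..s} r * g r) + f s * (LINT r|L. indicator {s..} r * g r))"
  proof (rule Bochner_Integration.integral_add[symmetric, OF inner[OF f g]])
    show "integrable L (\<lambda>s. f s * (LINT r|L. indicator {s..} r * g r))"
    proof -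
      have "integrable L (\<lambda>r. LINT s|L. indicator {..s} r * (g s * f r))"
        by (rule LL.integrable_snd[OF int[OF g f]])
      also have "(\<lambda>r. LINT s|L. indicator {..s} r * (g s * f r)) = (\<lambda>r. LINT s|L. f r * (indicator {r..} s * g s))"
        by (intro ext Bochner_Integration.integral_cong refl) (auto split: split_indicator)
      finally show ?thesis by simp
    qed
  qed
  also have "\<dots> = (LINT s|L. f s * (LINT r|L. g r))"
  proof (rule Bochner_Integration.integral_cong[OF refl])
    fix s
    have ii: "integrable L (\<lambda>r. indicator {..s} r * g r)" "integrable L (\<lambda>r. indicator {s..} r * g r)"
      by (rule_tac [1-2] Bochner_Integration.integrable_bound[OF g])
        (auto split: split_indicator intro!: borel_measurable_times
          indicator_measurable_lebesgue_on[of _ "{a..b}", folded L_def])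
    have "(LINT r|L. indicator {..s} r * g r) + (LINT r|L. indicator {s..} r * g r)
       = (LINT r|L. indicator {..s} r * g r + indicator {s..} r * g r)"
      using ii by simp
    also have "\<dots> = (LINT r|L. g r)"
    proof (rule integral_cong_AE)
      \<comment> \<open>Both half-lines contain \<open>s\<close>, so the sum of the indicators is 2
        there, but this is a single point.\<close>
      show "AE r in L. indicator {..s} r * g r + indicator {s..} r * g r = g r"
        using AE_lebesgue_on_neq[of s a b] unfolding L_def
        by eventually_elim (auto split: split_indicator)
    qed (use ii in auto)
    finally show "f s * (LINT r|L. indicator {..s} r * g r) + f s * (LINT r|L. indicator {s..} r * g r)
        = f s * (LINT r|L. g r)" by (simp add: distrib_left[symmetric])
  qed
  also have "\<dots> = (LINT s|L. f s) * (LINT s|L. g s)" by simp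
  finally show ?E .
qed

context brownian_setting
begin

lemma meas_adapted_case_prod: "meas_adapted M F T X \<Longrightarrow> case_prod X \<in> borel_measurable LM"
  by (simp add: meas_adapted_def)

lemma nn_integral_LM: "case_prod f \<in> borel_measurable LM \<Longrightarrow>
    (\<integral>\<^sup>+w. (\<integral>\<^sup>+t. f t w \<partial>L) \<partial>M) = (\<integral>\<^sup>+z. case_prod f z \<partial>LM)"
  using LM.nn_integral_snd[of "case_prod f"] by simp

lemma simple_process_in_L2:
  assumes s: "simple_integrand M F T p \<tau> (\<xi> :: nat \<Rightarrow> 'w \<Rightarrow> real)"
  shows "in_L2 LM (\<lambda>(t, w). simple_process p \<tau> \<xi> t w)"
proof -
  have "in_L2 LM (\<lambda>z. indicator {\<tau> l<..\<tau> (Suc l)} (fst z) *\<^sub>R \<xi> l (snd z))" if l: "l < p" for l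
  proof -
    obtain C where C: "\<And>w. w \<in> space M \<Longrightarrow> \<bar>\<xi> l w\<bar> \<le> C"
      using simple_integrand_bounded[OF s l] by (auto simp: bounded_rv_def)
    have \<xi>: "\<xi> l \<in> borel_measurable M"
      using simple_integrand_range[OF s l] simple_integrand_bounded[OF s l]
      by (intro F_measurable[of "\<tau> l"]) (auto simp: bounded_rv_def)
    have C': "\<bar>\<xi> l w\<bar> \<le> max 0 C" if "w \<in> space M" for w using C[OF that] by simp
    show ?thesis
    proof (rule LM.in_L2_bounded[of _ "max 0 C"])
      show "(\<lambda>z. indicator {\<tau> l<..\<tau> (Suc l)} (fst z) *\<^sub>R \<xi> l (snd z)) \<in> borel_measurable LM"
        by (intro borel_measurable_scaleR measurable_compose[OF measurable_fst indicator_measurable_lebesgue_on]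
          measurable_compose[OF measurable_snd \<xi>]) auto
    qed (use C' in \<open>auto simp: space_pair_measure split: split_indicator\<close>)
  qed
  then show ?thesis unfolding simple_process_def case_prod_unfold
    by (intro in_L2_sum) auto
qed

lemma in_L2_indicator:
  "in_L2 LM f \<Longrightarrow> in_L2 LM (\<lambda>z. indicator {..t} (fst z) * f z)"
proof -
  assume f: "in_L2 LM f"
  have "(\<lambda>z. indicator {..t} (fst z) :: real) \<in> borel_measurable LM"
    by (rule measurable_compose[OF measurable_fst indicator_measurable_lebesgue_on]) simp
  then show ?thesis
    by (intro in_L2_bound[OF f, of _ 1] borel_measurable_times in_L2_measurable[OF f])
      (auto split: split_indicator)
qed

text \<open>The witnesses hidden in \<open>ito_integral\<close> for a real integrand, with the
  limits rewritten as Bochner integrals and the time-outcome integral taken over the product space,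
  together with the square integrability of integrand and integral.\<close>

definition ito_approx ::
  "'j \<Rightarrow> (real \<Rightarrow> 'w \<Rightarrow> real) \<Rightarrow> (real \<Rightarrow> 'w \<Rightarrow> real) \<Rightarrow>
   (nat \<Rightarrow> nat) \<Rightarrow> (nat \<Rightarrow> nat \<Rightarrow> real) \<Rightarrow> (nat \<Rightarrow> nat \<Rightarrow> 'w \<Rightarrow> real) \<Rightarrow> bool" where
  "ito_approx j \<phi> I p \<tau> \<xi> \<longleftrightarrow> (\<forall>n. simple_integrand M F T (p n) (\<tau> n) (\<xi> n)) \<and>
    in_L2 LM (case_prod \<phi>) \<and>
    (\<lambda>n. \<integral>z. ((case z of (t, w) \<Rightarrow> simple_process (p n) (\<tau> n) (\<xi> n) t w) - case_prod \<phi> z)\<^sup>2 \<partial>LM) \<longlonglongrightarrow> 0 \<and>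
    (\<forall>t\<in>{0..T}. in_L2 M (I t) \<and>
      (\<lambda>n. \<integral>w. (simple_integral (B j) (p n) (\<tau> n) (\<xi> n) t w - I t w)\<^sup>2 \<partial>M) \<longlonglongrightarrow> 0)"

lemma ito_approxD:
  assumes "ito_approx j \<phi> I p \<tau> \<xi>"
  shows "simple_integrand M F T (p n) (\<tau> n) (\<xi> n)"
    and "in_L2 LM (case_prod \<phi>)"
    and "(\<lambda>n. \<integral>z. ((case z of (t, w) \<Rightarrow> simple_process (p n) (\<tau> n) (\<xi> n) t w) - case_prod \<phi> z)\<^sup>2 \<partial>LM) \<longlonglongrightarrow> 0"
    and "0 \<le> t \<Longrightarrow> t \<le> T \<Longrightarrow> in_L2 M (I t)"
    and "0 \<le> t \<Longrightarrow> t \<le> T \<Longrightarrow>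
      (\<lambda>n. \<integral>w. (simple_integral (B j) (p n) (\<tau> n) (\<xi> n) t w - I t w)\<^sup>2 \<partial>M) \<longlonglongrightarrow> 0"
  using assms by (simp_all add: ito_approx_def)

lemma ito_approx_exists:
  assumes j: "j \<in> J" and I: "ito_integral M F T (B j) \<phi> I"
  shows "\<exists>p \<tau> \<xi>. ito_approx j \<phi> I p \<tau> \<xi>"
proof -
  from I obtain p \<tau> \<xi> where a: "meas_adapted M F T \<phi>" "meas_adapted M F T I"
    and fin: "(\<integral>\<^sup>+w. (\<integral>\<^sup>+t. ennreal ((norm (\<phi> t w))\<^sup>2) \<partial>lebesgue_on {0..T}) \<partial>M) < \<infinity>"
    and s: "\<And>n. simple_integrand M F T (p n) (\<tau> n) (\<xi> n)"
    and l1: "(\<lambda>n. \<integral>\<^sup>+w. (\<integral>\<^sup>+t. ennreal ((norm (\<phi> t w - simple_process (p n) (\<tau> n) (\<xi> n) t w))\<^sup>2)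
                \<partial>lebesgue_on {0..T}) \<partial>M) \<longlonglongrightarrow> 0"
    and l2: "\<And>t. t\<in>{0..T} \<Longrightarrow> (\<lambda>n. \<integral>\<^sup>+w. ennreal ((norm (I t w -
            simple_integral (B j) (p n) (\<tau> n) (\<xi> n) t w))\<^sup>2) \<partial>M) \<longlonglongrightarrow> 0"
    unfolding ito_integral_def by blast
  let ?S = "\<lambda>n z. case z of (t, w) \<Rightarrow> simple_process (p n) (\<tau> n) (\<xi> n) t w"
  note sp = simple_process_in_L2[OF s]
  have [measurable]: "case_prod \<phi> \<in> borel_measurable LM" "?S n \<in> borel_measurable LM" for n
    using meas_adapted_case_prod[OF a(1)] in_L2_measurable[OF sp] by auto
  have "(\<integral>\<^sup>+z. ennreal ((case_prod \<phi> z)\<^sup>2) \<partial>LM) < \<infinity>"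
    using fin nn_integral_LM[of "\<lambda>t w. ennreal ((norm (\<phi> t w))\<^sup>2)"] by (simp add: case_prod_unfold)
  then have \<phi>: "in_L2 LM (case_prod \<phi>)" by (simp add: in_L2_iff_nn)
  have "(\<lambda>n. \<integral>\<^sup>+z. ennreal ((case_prod \<phi> z - ?S n z)\<^sup>2) \<partial>LM) \<longlonglongrightarrow> 0"
  proof -
    have "(\<integral>\<^sup>+w. (\<integral>\<^sup>+t. ennreal ((norm (\<phi> t w - simple_process (p n) (\<tau> n) (\<xi> n) t w))\<^sup>2)
                \<partial>lebesgue_on {0..T}) \<partial>M) = (\<integral>\<^sup>+z. ennreal ((case_prod \<phi> z - ?S n z)\<^sup>2) \<partial>LM)" for n
    proof -
      have "(\<lambda>z. ennreal ((case_prod \<phi> z - ?S n z)\<^sup>2)) \<in> borel_measurable LM" by measurable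
      then show ?thesis
        using nn_integral_LM[of "\<lambda>t w. ennreal ((norm (\<phi> t w - simple_process (p n) (\<tau> n) (\<xi> n) t w))\<^sup>2)"]
        by (simp add: case_prod_unfold)
    qed
    then show ?thesis using l1 by simp
  qed
  then have L1: "(\<lambda>n. \<integral>z. (?S n z - case_prod \<phi> z)\<^sup>2 \<partial>LM) \<longlonglongrightarrow> 0"
    by (rule tendsto_integral_square_of_nn[OF sp \<phi>])
  have It: "in_L2 M (I t)"
    and L2: "(\<lambda>n. \<integral>w. (simple_integral (B j) (p n) (\<tau> n) (\<xi> n) t w - I t w)\<^sup>2 \<partial>M) \<longlonglongrightarrow> 0"
    if t: "0 \<le> t" "t \<le> T" for t
  proof -
    note ss = simple_integral_in_L2[OF j s t]
    have *: "(\<lambda>n. \<integral>\<^sup>+w. ennreal ((I t w - simple_integral (B j) (p n) (\<tau> n) (\<xi> n) t w)\<^sup>2) \<partial>M) \<longlonglongrightarrow> 0"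
      using l2[of t] t by simp
    have "I t \<in> borel_measurable M" using a(2) t by (intro F_measurable[OF t]) (auto simp: meas_adapted_def)
    then show It: "in_L2 M (I t)" by (rule in_L2_limit[OF ss _ *])
    show "(\<lambda>n. \<integral>w. (simple_integral (B j) (p n) (\<tau> n) (\<xi> n) t w - I t w)\<^sup>2 \<partial>M) \<longlonglongrightarrow> 0"
      by (rule tendsto_integral_square_of_nn[OF ss It *])
  qed
  show ?thesis unfolding ito_approx_def using s \<phi> L1 It L2 by (intro exI[of _ p] exI[of _ \<tau>] exI[of _ \<xi>]) auto
qed

lemma
  assumes j: "j \<in> J" and I: "ito_integral M F T (B j) \<phi> (I :: real \<Rightarrow> 'w \<Rightarrow> real)"
  shows ito_integrand_in_L2: "in_L2 LM (case_prod \<phi>)"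
    and ito_integral_in_L2: "0 \<le> t \<Longrightarrow> t \<le> T \<Longrightarrow> in_L2 M (I t)"
  using ito_approx_exists[OF j I] ito_approxD(2,4) by blast+

text \<open>One approximating sequence serves both times, so the equality for elementary integrals
  passes to the limit on both sides.\<close>

lemma ito_integral_orthogonal:
  assumes j: "j \<in> J" and I: "ito_integral M F T (B j) \<phi> (I :: real \<Rightarrow> 'w \<Rightarrow> real)"
    and r: "0 \<le> r" "r \<le> t" "t \<le> T" and \<alpha>: "\<alpha> \<in> borel_measurable (F r)" "in_L2 M \<alpha>"
  shows "expectation (\<lambda>w. \<alpha> w * I t w) = expectation (\<lambda>w. \<alpha> w * I r w)"
proof -
  obtain p \<tau> \<xi> where "ito_approx j \<phi> I p \<tau> \<xi>" using ito_approx_exists[OF j I] by blast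
  note A = ito_approxD[OF this]
  have lim: "(\<lambda>n. expectation (\<lambda>w. \<alpha> w * simple_integral (B j) (p n) (\<tau> n) (\<xi> n) t w))
      \<longlonglongrightarrow> expectation (\<lambda>w. \<alpha> w * I t w)" if t: "0 \<le> t" "t \<le> T" for t
    by (rule tendsto_integral_mult[OF \<alpha>(2) \<alpha>(2) simple_integral_in_L2[OF j A(1) t] A(4)[OF t] _ A(5)[OF t]]) simp
  have "0 \<le> t" "r \<le> T" using r by auto
  from lim[OF this(1) r(3)] lim[OF r(1) this(2)] show ?thesis
    unfolding simple_integral_orthogonal[OF j A(1) r \<alpha>] by (rule LIMSEQ_unique)
qed

text \<open>Orthogonality to the constant 1, in comparison with time 0, where every elementary
  integral vanishes.\<close>

lemma ito_integral_expectation: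
  assumes j: "j \<in> J" and I: "ito_integral M F T (B j) \<phi> (I :: real \<Rightarrow> 'w \<Rightarrow> real)" and t: "0 \<le> t" "t \<le> T"
  shows "expectation (I t) = 0"
proof -
  obtain p \<tau> \<xi> where "ito_approx j \<phi> I p \<tau> \<xi>" using ito_approx_exists[OF j I] by blast
  note A = ito_approxD[OF this]
  let ?Z = "\<lambda>n. simple_integral (B j) (p n) (\<tau> n) (\<xi> n)"
  have one: "(\<lambda>_. 1) \<in> borel_measurable (F 0)" "in_L2 M (\<lambda>_. 1)"
    by (auto simp: in_L2_def)
  have lim: "(\<lambda>n. expectation (\<lambda>w. 1 * ?Z n t w)) \<longlonglongrightarrow> expectation (\<lambda>w. 1 * I t w)"
    by (rule tendsto_integral_mult[OF one(2) one(2) simple_integral_in_L2[OF j A(1) t] A(4)[OF t] _ A(5)[OF t]]) simp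
  \<comment> \<open>All partition points are nonnegative, so stopping at 0 moves both end-points of
    each increment to 0.\<close>
  have "?Z n 0 w = 0" for n w
    unfolding Defs.simple_integral_def
    using simple_integrand_range[OF A(1)] by (intro sum.neutral) (fastforce simp: min_def)
  then have "expectation (\<lambda>w. 1 * ?Z n t w) = 0" for n
    using simple_integral_orthogonal[OF j A(1) _ t one, of n] by simp
  then show ?thesis using lim by (simp add: LIMSEQ_const_iff)
qed

lemma ito_isometry:
  assumes jk: "j \<in> J" "k \<in> J" and t: "0 \<le> t" "t \<le> T"
    and I: "ito_integral M F T (B j) \<phi> (I :: real \<Rightarrow> 'w \<Rightarrow> real)"
    and I': "ito_integral M F T (B k) \<psi> (I' :: real \<Rightarrow> 'w \<Rightarrow> real)"
  shows "expectation (\<lambda>w. I t w * I' t w) =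
    (if j = k then \<integral>(s, w). indicator {..t} s * (\<phi> s w * \<psi> s w) \<partial>LM else 0)"
proof -
  obtain p \<tau> \<xi> where "ito_approx j \<phi> I p \<tau> \<xi>" using ito_approx_exists[OF jk(1) I] by blast
  note A = ito_approxD[OF this]
  obtain p' \<tau>' \<xi>' where "ito_approx k \<psi> I' p' \<tau>' \<xi>'" using ito_approx_exists[OF jk(2) I'] by blast
  note A' = ito_approxD[OF this]
  let ?S = "\<lambda>n z. case z of (t, w) \<Rightarrow> simple_process (p n) (\<tau> n) (\<xi> n) t w"
  let ?S' = "\<lambda>n z. case z of (t, w) \<Rightarrow> simple_process (p' n) (\<tau>' n) (\<xi>' n) t w"
  let ?E = "\<lambda>n. expectation (\<lambda>w. simple_integral (B j) (p n) (\<tau> n) (\<xi> n) t w * simple_integral (B k) (p' n) (\<tau>' n) (\<xi>' n) t w)"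
  let ?i = "\<lambda>z. indicator {..t} (fst z) :: real"
  note sq = simple_process_in_L2[OF A(1)]
  note ind = in_L2_indicator[of _ t]
  note isometry = simple_integral_isometry[OF jk A(1) A'(1) t]
  have lim1: "?E \<longlonglongrightarrow> expectation (\<lambda>w. I t w * I' t w)"
    by (rule tendsto_integral_mult[OF simple_integral_in_L2[OF jk(1) A(1) t] A(4)[OF t]
        simple_integral_in_L2[OF jk(2) A'(1) t] A'(4)[OF t] A(5)[OF t] A'(5)[OF t]])
  \<comment> \<open>The cut-off at \<open>t\<close> is attached to one factor only; multiplication
    by an indicator is a contraction, so the convergence of the approximants survives.\<close>
  have lim2: "(\<lambda>n. \<integral>z. (?i z * ?S n z) * ?S' n z \<partial>LM) \<longlonglongrightarrow> (\<integral>z. (?i z * case_prod \<phi> z) * case_prod \<psi> z \<partial>LM)"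
  proof (rule tendsto_integral_mult[OF ind[OF sq] ind[OF A(2)] simple_process_in_L2[OF A'(1)] A'(2) _ A'(3)])
    show "(\<lambda>n. \<integral>z. (?i z * ?S n z - ?i z * case_prod \<phi> z)\<^sup>2 \<partial>LM) \<longlonglongrightarrow> 0"
    proof (rule tendsto_sandwich[OF _ _ tendsto_const A(3)])
      show "\<forall>\<^sub>F n in sequentially. (\<integral>z. (?i z * ?S n z - ?i z * case_prod \<phi> z)\<^sup>2 \<partial>LM) \<le> (\<integral>z. (?S n z - case_prod \<phi> z)\<^sup>2 \<partial>LM)"
      proof (intro always_eventually allI integral_mono)
        fix n
        show "integrable LM (\<lambda>z. (?S n z - case_prod \<phi> z)\<^sup>2)"
          using in_L2_diff[OF sq A(2)] by (simp add: in_L2_def)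
        show "integrable LM (\<lambda>z. (?i z * ?S n z - ?i z * case_prod \<phi> z)\<^sup>2)"
          using in_L2_diff[OF ind[OF sq] ind[OF A(2)]] by (simp add: in_L2_def)
      qed (auto split: split_indicator)
    qed auto
  qed
  show ?thesis
  proof (cases "j = k")
    case True
    then have "(\<lambda>n. \<integral>z. (?i z * ?S n z) * ?S' n z \<partial>LM) = ?E"
      using isometry by (simp add: case_prod_unfold mult.assoc)
    with lim2 have "?E \<longlonglongrightarrow> (\<integral>z. (?i z * case_prod \<phi> z) * case_prod \<psi> z \<partial>LM)" by simp
    from LIMSEQ_unique[OF lim1 this] True show ?thesis by (simp add: case_prod_unfold mult.assoc)
  next
    case False
    then have "?E = (\<lambda>_. 0)" using isometry by simp
    with lim1 False show ?thesis by (simp add: LIMSEQ_const_iff)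
  qed
qed

end

section \<open>The product rule in expectation\<close>

context brownian_setting
begin

lemma in_L2_LM_section:
  assumes "in_L2 LM f"
  shows "AE w in M. in_L2 L (\<lambda>s. f (s, w))" "AE s in L. in_L2 M (\<lambda>w. f (s, w))"
proof -
  have [measurable]: "f \<in> borel_measurable LM" and i: "integrable LM (\<lambda>z. (f z)\<^sup>2)"
    using assms by (auto simp: in_L2_def)
  from i have i': "integrable LM (\<lambda>(s, w). (f (s, w))\<^sup>2)" by (simp add: case_prod_unfold)
  show "AE w in M. in_L2 L (\<lambda>s. f (s, w))"
    using LM.AE_integrable_snd[OF i'] AE_space
    by eventually_elim (auto simp: in_L2_def)
  show "AE s in L. in_L2 M (\<lambda>w. f (s, w))"
    using LM.AE_integrable_fst[OF i'] AE_space
    by eventually_elim (auto simp: in_L2_def)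
qed

lemma in_L2_snd: "in_L2 M Y \<Longrightarrow> in_L2 LM (\<lambda>z. Y (snd z))"
proof -
  assume Y: "in_L2 M Y"
  have [measurable]: "Y \<in> borel_measurable M" using Y by (simp add: in_L2_def)
  have "integrable LM (\<lambda>(s, w). 1 * (Y w)\<^sup>2)"
    using Y by (intro product_integrable_times L.sigma_finite_measure_axioms sigma_finite_measure_axioms)
      (auto simp: in_L2_def)
  then show ?thesis by (simp add: in_L2_def case_prod_unfold)
qed

lemma in_L2_time_integral:
  assumes f: "in_L2 LM f"
  shows "in_L2 M (\<lambda>w. LINT s|L. f (s, w))"
proof -
  have [measurable]: "f \<in> borel_measurable LM" using f by (simp add: in_L2_def)
  have [measurable]: "(\<lambda>(w, s). f (s, w)) \<in> borel_measurable (M \<Otimes>\<^sub>M L)"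
    unfolding case_prod_unfold by (rule measurable_compose[of _ _ LM]) measurable
  have m: "(\<lambda>w. LINT s|L. f (s, w)) \<in> borel_measurable M"
    by (rule L.borel_measurable_lebesgue_integral) simp
  have i: "integrable M (\<lambda>w. LINT s|L. (f (s, w))\<^sup>2)"
    using f by (intro LM.integrable_snd) (simp add: in_L2_def case_prod_unfold)
  \<comment> \<open>The length of the time interval, in the form in which Cauchy-Schwarz against the
    constant 1 produces it.\<close>
  define K where "K = (LINT s|L. (1::real)\<^sup>2)"
  have "integrable M (\<lambda>w. (LINT s|L. f (s, w))\<^sup>2)"
  proof (rule Bochner_Integration.integrable_bound)
    show "integrable M (\<lambda>w. K * (LINT s|L. (f (s, w))\<^sup>2))" using i by simp
    show "AE w in M. norm ((LINT s|L. f (s, w))\<^sup>2) \<le> norm (K * (LINT s|L. (f (s, w))\<^sup>2))"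
      using in_L2_LM_section(1)[OF f]
    proof eventually_elim
      case (elim w)
      have "\<bar>LINT s|L. f (s, w) * 1\<bar> \<le> sqrt (LINT s|L. (f (s, w))\<^sup>2) * sqrt K"
        unfolding K_def by (rule integral_Cauchy_Schwarz[OF elim]) (simp add: in_L2_def)
      then have "(\<bar>LINT s|L. f (s, w)\<bar>)\<^sup>2 \<le> (sqrt (LINT s|L. (f (s, w))\<^sup>2) * sqrt K)\<^sup>2"
        by (intro power_mono) auto
      also have "\<dots> = (LINT s|L. (f (s, w))\<^sup>2) * K"
        by (simp add: power_mult_distrib K_def)
      finally show ?case by (simp add: mult.commute)
    qed
  qed (use m in simp)
  with m show ?thesis by (simp add: in_L2_def)
qed

text \<open>The cut-off replaces a domain depending on \<open>t\<close>, so that the result is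
  jointly measurable in time and outcome.\<close>

definition drift_integral :: "(real \<Rightarrow> 'w \<Rightarrow> real) \<Rightarrow> real \<Rightarrow> 'w \<Rightarrow> real" where
  "drift_integral \<alpha> t w = (LINT s|L. indicator {..t} s * \<alpha> s w)"

lemma drift_integral_in_L2:
  assumes \<alpha>: "in_L2 LM (case_prod \<alpha>)"
  shows "in_L2 M (drift_integral \<alpha> t)"
  using in_L2_time_integral[OF in_L2_indicator[OF \<alpha>, of t]]
  by (simp add: drift_integral_def[abs_def])

lemma drift_integral_in_L2_LM:
  assumes \<alpha>: "in_L2 LM (case_prod \<alpha>)"
  shows "in_L2 LM (case_prod (drift_integral \<alpha>))"
proof -
  have [measurable]: "case_prod \<alpha> \<in> borel_measurable LM" using \<alpha> by (simp add: in_L2_def)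
  have [measurable]: "(\<lambda>x. x) \<in> borel_measurable L" by (rule measurable_id_lebesgue_on)
  have a1: "(\<lambda>p. \<alpha> (snd p) (snd (fst p))) \<in> borel_measurable (LM \<Otimes>\<^sub>M L)"
  proof -
    have "(\<lambda>p. (snd p, snd (fst p))) \<in> (LM \<Otimes>\<^sub>M L) \<rightarrow>\<^sub>M LM" by measurable
    from measurable_compose[OF this, of "case_prod \<alpha>" borel] show ?thesis by simp
  qed
  have a2: "(\<lambda>p. indicator {..fst (fst p)} (snd p) :: real) \<in> borel_measurable (LM \<Otimes>\<^sub>M L)"
    by (rule measurable_indicator_atMost_pair; measurable)
  have m: "case_prod (drift_integral \<alpha>) \<in> borel_measurable LM"
  proof -
    have "(\<lambda>z. LINT s|L. indicator {..fst z} s * \<alpha> s (snd z)) \<in> borel_measurable LM"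
      by (rule L.borel_measurable_lebesgue_integral)
        (use borel_measurable_times[OF a2 a1] in \<open>simp add: case_prod_unfold\<close>)
    then show ?thesis by (simp add: drift_integral_def case_prod_unfold)
  qed
  \<comment> \<open>The time integral of the absolute value dominates the drift integral at all
    times simultaneously and no longer depends on \<open>t\<close>.\<close>
  have "in_L2 LM (\<lambda>z. \<bar>case_prod \<alpha> z\<bar>)" using \<alpha> by (simp add: in_L2_def)
  from in_L2_snd[OF in_L2_time_integral[OF this]]
  have h: "in_L2 LM (\<lambda>z. LINT s|L. \<bar>\<alpha> s (snd z)\<bar>)" by simp
  have "(\<integral>\<^sup>+z. ennreal ((case_prod (drift_integral \<alpha>) z)\<^sup>2) \<partial>LM)
      = (\<integral>\<^sup>+w. (\<integral>\<^sup>+t. ennreal ((drift_integral \<alpha> t w)\<^sup>2) \<partial>L) \<partial>M)"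
    using m nn_integral_LM[of "\<lambda>t w. ennreal ((drift_integral \<alpha> t w)\<^sup>2)"] by (simp add: case_prod_unfold)
  also have "\<dots> \<le> (\<integral>\<^sup>+w. (\<integral>\<^sup>+t. ennreal ((LINT s|L. \<bar>\<alpha> s w\<bar>)\<^sup>2) \<partial>L) \<partial>M)"
  proof (rule nn_integral_mono_AE)
    show "AE w in M. (\<integral>\<^sup>+t. ennreal ((drift_integral \<alpha> t w)\<^sup>2) \<partial>L)
        \<le> (\<integral>\<^sup>+t. ennreal ((LINT s|L. \<bar>\<alpha> s w\<bar>)\<^sup>2) \<partial>L)"
      using in_L2_LM_section(1)[OF \<alpha>]
    proof eventually_elim
      case (elim w)
      then have i: "integrable L (\<lambda>s. \<alpha> s w)" using L.in_L2_integrable by simp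
      have "\<bar>drift_integral \<alpha> t w\<bar> \<le> \<bar>LINT s|L. \<bar>\<alpha> s w\<bar>\<bar>" for t
      proof -
        have "\<bar>drift_integral \<alpha> t w\<bar> \<le> (LINT s|L. \<bar>indicator {..t} s * \<alpha> s w\<bar>)"
          unfolding drift_integral_def by (rule integral_abs_bound)
        also have "\<dots> \<le> (LINT s|L. \<bar>\<alpha> s w\<bar>)"
        proof (rule integral_mono)
          show "integrable L (\<lambda>s. \<bar>\<alpha> s w\<bar>)" using i by (rule integrable_abs)
          have "(\<lambda>s. \<alpha> s w) \<in> borel_measurable L" using i by simp
          then show "integrable L (\<lambda>s. \<bar>indicator {..t} s * \<alpha> s w\<bar>)"
            by (intro integrable_abs, rule_tac Bochner_Integration.integrable_bound[OF i])
              (auto split: split_indicator intro!: borel_measurable_times indicator_measurable_lebesgue_on)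
        qed (auto split: split_indicator)
        finally show ?thesis by simp
      qed
      then have "(drift_integral \<alpha> t w)\<^sup>2 \<le> (LINT s|L. \<bar>\<alpha> s w\<bar>)\<^sup>2" for t
        by (simp add: abs_le_square_iff[symmetric])
      then show ?case by (intro nn_integral_mono ennreal_leI)
    qed
  qed
  also have "\<dots> = (\<integral>\<^sup>+z. ennreal ((LINT s|L. \<bar>\<alpha> s (snd z)\<bar>)\<^sup>2) \<partial>LM)"
    using in_L2_measurable[OF h] nn_integral_LM[of "\<lambda>t w. ennreal ((LINT s|L. \<bar>\<alpha> s w\<bar>)\<^sup>2)"]
    by (simp add: case_prod_unfold)
  also have "\<dots> < \<infinity>" using h by (simp add: in_L2_iff_nn)
  finally show ?thesis using m by (simp add: in_L2_iff_nn)
qed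

lemma expectation_drift_integral_mult:
  assumes \<alpha>: "in_L2 LM (case_prod \<alpha>)" and Y: "in_L2 M Y"
  shows "expectation (\<lambda>w. drift_integral \<alpha> t w * Y w) =
    (\<integral>(s, w). indicator {..t} s * (\<alpha> s w * Y w) \<partial>LM)"
proof -
  have i: "integrable LM (\<lambda>(s, w). indicator {..t} s * \<alpha> s w * Y w)"
    using in_L2_mult[OF in_L2_indicator[OF \<alpha>, of t] in_L2_snd[OF Y]]
    by (simp add: case_prod_unfold)
  show ?thesis using LM.integral_snd[OF i] by (simp add: drift_integral_def mult.assoc[symmetric])
qed

lemma expectation_drift_integral_drift_integral:
  assumes \<alpha>: "in_L2 LM (case_prod \<alpha>)" and \<beta>: "in_L2 LM (case_prod \<beta>)"
  shows "expectation (\<lambda>w. drift_integral \<alpha> t w * drift_integral \<beta> t w) =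
    (\<integral>(s, w). indicator {..t} s * (\<alpha> s w * drift_integral \<beta> s w + \<beta> s w * drift_integral \<alpha> s w) \<partial>LM)"
proof -
  have i: "integrable LM (\<lambda>(s, w). indicator {..t} s * (\<alpha> s w * drift_integral \<beta> s w + \<beta> s w * drift_integral \<alpha> s w))"
    using in_L2_mult[OF in_L2_indicator[OF \<alpha>, of t] drift_integral_in_L2_LM[OF \<beta>]]
      in_L2_mult[OF in_L2_indicator[OF \<beta>, of t] drift_integral_in_L2_LM[OF \<alpha>]]
    by (simp add: case_prod_unfold distrib_left mult.assoc)
  have eq: "AE w in M. drift_integral \<alpha> t w * drift_integral \<beta> t w =
      (LINT s|L. indicator {..t} s * (\<alpha> s w * drift_integral \<beta> s w + \<beta> s w * drift_integral \<alpha> s w))"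
    using in_L2_LM_section(1)[OF \<alpha>] in_L2_LM_section(1)[OF \<beta>]
  proof eventually_elim
    case (elim w)
    then have sq: "in_L2 L (\<lambda>s. \<alpha> s w)" "in_L2 L (\<lambda>s. \<beta> s w)" by auto
    have ii: "integrable L (\<lambda>s. indicator {..t} s * f s)" if "in_L2 L f" for f
      using in_L2_measurable[OF that]
      by (rule_tac Bochner_Integration.integrable_bound[OF L.in_L2_integrable[OF that]])
         (auto split: split_indicator intro!: borel_measurable_times indicator_measurable_lebesgue_on)
    have *: "indicator {..t} s * f s * (LINT r|L. indicator {..s} r * (indicator {..t} r * g r))
       = indicator {..t} s * (f s * (LINT r|L. indicator {..s} r * g r))" for f g :: "real \<Rightarrow> real" and s
    proof (cases "s \<le> t")
      case True
      then have "(\<lambda>r. indicator {..s} r * (indicator {..t} r * g r)) = (\<lambda>r. indicator {..s} r * g r)"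
        by (auto split: split_indicator)
      then show ?thesis by simp
    qed (auto split: split_indicator)
    show ?case
      using integral_by_parts_indefinite(2)[OF ii[OF sq(1)] ii[OF sq(2)]]
      by (simp only: *[of _ "\<lambda>s. \<alpha> s w" "\<lambda>s. \<beta> s w"]
          *[of _ "\<lambda>s. \<beta> s w" "\<lambda>s. \<alpha> s w"] drift_integral_def distrib_left)
  qed
  have "expectation (\<lambda>w. drift_integral \<alpha> t w * drift_integral \<beta> t w) =
     expectation (\<lambda>w. LINT s|L. indicator {..t} s * (\<alpha> s w * drift_integral \<beta> s w + \<beta> s w * drift_integral \<alpha> s w))"
    using in_L2_measurable[OF drift_integral_in_L2[OF \<alpha>]]
      in_L2_measurable[OF drift_integral_in_L2[OF \<beta>]]
      borel_measurable_integrable[OF LM.integrable_snd[OF i]] eq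
    by (intro integral_cong_AE) auto
  then show ?thesis using LM.integral_snd[OF i] by simp
qed

text \<open>The product rule holds without a covariation term between the drift and the martingale part
  because a martingale increment is orthogonal to the past: \<open>E (\<alpha> s * N t) = E (\<alpha> s * N s)\<close>.\<close>

lemma expectation_ito_product:
  fixes Z1 Z2 \<alpha>1 \<alpha>2 :: "real \<Rightarrow> 'w \<Rightarrow> real" and \<gamma>1 \<gamma>2 I1 I2 :: "'j \<Rightarrow> real \<Rightarrow> 'w \<Rightarrow> real"
  assumes K: "finite K" "K \<subseteq> J"
    and I1: "\<And>j. j \<in> K \<Longrightarrow> ito_integral M F T (B j) (\<gamma>1 j) (I1 j)"
    and I2: "\<And>j. j \<in> K \<Longrightarrow> ito_integral M F T (B j) (\<gamma>2 j) (I2 j)"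
    and Z: "in_L2 LM (case_prod Z1)" "in_L2 LM (case_prod Z2)"
    and Zm: "\<And>t. 0 \<le> t \<Longrightarrow> t \<le> T \<Longrightarrow> Z1 t \<in> borel_measurable M"
            "\<And>t. 0 \<le> t \<Longrightarrow> t \<le> T \<Longrightarrow> Z2 t \<in> borel_measurable M"
    and \<alpha>: "in_L2 LM (case_prod \<alpha>1)" "in_L2 LM (case_prod \<alpha>2)"
    and \<alpha>F: "\<And>t. 0 \<le> t \<Longrightarrow> t \<le> T \<Longrightarrow> \<alpha>1 t \<in> borel_measurable (F t)"
            "\<And>t. 0 \<le> t \<Longrightarrow> t \<le> T \<Longrightarrow> \<alpha>2 t \<in> borel_measurable (F t)"
    and eq1: "AE w in M. \<forall>t\<in>{0..T}. Z1 t w = z1 + (LINT s|lebesgue_on {0..t}. \<alpha>1 s w) + (\<Sum>j\<in>K. I1 j t w)"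
    and eq2: "AE w in M. \<forall>t\<in>{0..T}. Z2 t w = z2 + (LINT s|lebesgue_on {0..t}. \<alpha>2 s w) + (\<Sum>j\<in>K. I2 j t w)"
    and t: "0 \<le> t" "t \<le> T"
  shows "integrable M (\<lambda>w. Z1 t w * Z2 t w)"
    and "expectation (\<lambda>w. Z1 t w * Z2 t w) = z1 * z2 +
      (\<integral>(s, w). indicator {..t} s * (\<alpha>1 s w * Z2 s w + \<alpha>2 s w * Z1 s w + (\<Sum>j\<in>K. \<gamma>1 j s w * \<gamma>2 j s w)) \<partial>LM)"
proof -
  define A1 A2 where "A1 = drift_integral \<alpha>1" and "A2 = drift_integral \<alpha>2"
  define N1 N2 where "N1 = (\<lambda>t w. \<Sum>j\<in>K. I1 j t w)" and "N2 = (\<lambda>t w. \<Sum>j\<in>K. I2 j t w)"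
  \<comment> \<open>The martingale parts are read off from \<open>Z1\<close> and \<open>Z2\<close>,
    which gives their square integrability on the product space at once; the sums \<open>N1\<close>
    and \<open>N2\<close> of stochastic integrals agree with them almost surely and supply isometry
    and orthogonality.\<close>
  define n1 n2 where "n1 = (\<lambda>t w. Z1 t w - z1 - A1 t w)" and "n2 = (\<lambda>t w. Z2 t w - z2 - A2 t w)"
  have A: "in_L2 M (A1 t)" "in_L2 M (A2 t)" for t
    unfolding A1_def A2_def by (intro drift_integral_in_L2 \<alpha>)+
  have A_LM: "in_L2 LM (case_prod A1)" "in_L2 LM (case_prod A2)"
    unfolding A1_def A2_def by (intro drift_integral_in_L2_LM \<alpha>)+
  have const: "in_L2 LM (\<lambda>_. z :: real)" "in_L2 M (\<lambda>_. z :: real)" for z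
    by (auto simp: in_L2_def)
  have n_LM: "in_L2 LM (case_prod n1)" "in_L2 LM (case_prod n2)"
    using in_L2_diff[OF in_L2_diff[OF Z(1) const(1)] A_LM(1)]
      in_L2_diff[OF in_L2_diff[OF Z(2) const(1)] A_LM(2)]
    by (simp_all add: n1_def n2_def case_prod_unfold)
  have N: "in_L2 M (N1 t)" "in_L2 M (N2 t)" if "0 \<le> t" "t \<le> T" for t
    unfolding N1_def N2_def using K(2) that
    by (auto intro!: in_L2_sum ito_integral_in_L2[OF _ I1] ito_integral_in_L2[OF _ I2])
  have nN: "AE w in M. n1 t w = N1 t w" "AE w in M. n2 t w = N2 t w" if "0 \<le> t" "t \<le> T" for t
    using eventually_mono[OF eq1, of "\<lambda>w. n1 t w = N1 t w"]
      eventually_mono[OF eq2, of "\<lambda>w. n2 t w = N2 t w"]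
      that integral_lebesgue_on_upto[OF that(2), where a=0]
    by (auto simp: n1_def n2_def N1_def N2_def A1_def A2_def drift_integral_def)
  have n: "in_L2 M (n1 t)" "in_L2 M (n2 t)" if "0 \<le> t" "t \<le> T" for t
    using in_L2_cong_AE[OF N(1)[OF that] _ nN(1)[OF that]]
      in_L2_cong_AE[OF N(2)[OF that] _ nN(2)[OF that]] Zm[OF that] in_L2_measurable[OF A(1)]
      in_L2_measurable[OF A(2)]
    by (auto simp: n1_def n2_def)
  have to_N: "expectation (\<lambda>w. Y w * n w) = expectation (\<lambda>w. Y w * N w)"
    if "Y \<in> borel_measurable M" "in_L2 M n" "in_L2 M N" "AE w in M. n w = N w"
    for Y n N :: "'w \<Rightarrow> real"
    using that by (intro integral_cong_AE) (auto simp: in_L2_def)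
  have sum_E: "expectation (\<lambda>w. Y w * (\<Sum>j\<in>K. I j t w)) = (\<Sum>j\<in>K. expectation (\<lambda>w. Y w * I j t w))"
    if "in_L2 M Y" "\<And>j. j \<in> K \<Longrightarrow> ito_integral M F T (B j) (\<gamma> j) (I j)" "0 \<le> t" "t \<le> T"
    for Y t \<gamma> and I :: "'j \<Rightarrow> real \<Rightarrow> 'w \<Rightarrow> real"
    unfolding sum_distrib_left using K(2) that
    by (intro Bochner_Integration.integral_sum in_L2_mult that
       ito_integral_in_L2[OF _ that(2)]) auto
  have orth: "expectation (\<lambda>w. Y w * (\<Sum>j\<in>K. I j t w)) = expectation (\<lambda>w. Y w * (\<Sum>j\<in>K. I j s w))"
    if "Y \<in> borel_measurable (F s)" "in_L2 M Y"
      "\<And>j. j \<in> K \<Longrightarrow> ito_integral M F T (B j) (\<gamma> j) (I j)" "0 \<le> s" "s \<le> t" "t \<le> T"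
    for Y t s \<gamma> and I :: "'j \<Rightarrow> real \<Rightarrow> 'w \<Rightarrow> real"
  proof -
    have r: "0 \<le> t" "s \<le> T" using that by auto
    have "expectation (\<lambda>w. Y w * (\<Sum>j\<in>K. I j t w)) = (\<Sum>j\<in>K. expectation (\<lambda>w. Y w * I j t w))"
      by (rule sum_E[OF that(2,3) r(1) that(6)])
    also have "\<dots> = (\<Sum>j\<in>K. expectation (\<lambda>w. Y w * I j s w))"
      using K(2) by (intro sum.cong refl ito_integral_orthogonal[OF _ that(3) that(4-6) that(1,2)]) auto
    also have "\<dots> = expectation (\<lambda>w. Y w * (\<Sum>j\<in>K. I j s w))"
      by (rule sum_E[OF that(2,3) that(4) r(2), symmetric])
    finally show ?thesis .
  qed
  have E0: "expectation (n1 t) = 0" "expectation (n2 t) = 0"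
  proof -
    have one: "in_L2 M (\<lambda>_. 1)" using const(2) .
    have "expectation (\<lambda>w. 1 * (\<Sum>j\<in>K. I j t w)) = 0"
      if I: "\<And>j. j \<in> K \<Longrightarrow> ito_integral M F T (B j) (\<gamma> j) (I j)"
      for \<gamma> and I :: "'j \<Rightarrow> real \<Rightarrow> 'w \<Rightarrow> real"
    proof -
      have "expectation (\<lambda>w. 1 * (\<Sum>j\<in>K. I j t w)) = (\<Sum>j\<in>K. expectation (\<lambda>w. 1 * I j t w))"
        by (rule sum_E[OF one I t])
      also have "\<dots> = 0" using K(2) ito_integral_expectation[OF _ I t] by (intro sum.neutral) auto
      finally show ?thesis .
    qed
    from this[OF I1] this[OF I2] show "expectation (n1 t) = 0" "expectation (n2 t) = 0"
      using to_N[of "\<lambda>_. 1" "n1 t" "N1 t", OF _ n(1)[OF t] N(1)[OF t] nN(1)[OF t]]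
        to_N[of "\<lambda>_. 1" "n2 t" "N2 t", OF _ n(2)[OF t] N(2)[OF t] nN(2)[OF t]] by (auto simp: N1_def N2_def)
  qed
  have gi: "integrable LM (\<lambda>(s, w). indicator {..t} s * (\<gamma>1 j s w * \<gamma>2 j s w))" if "j \<in> K" for j
    using in_L2_mult[OF in_L2_indicator[OF ito_integrand_in_L2[OF _ I1[OF that]], of t]
      ito_integrand_in_L2[OF _ I2[OF that]]] that K(2)
    by (auto simp: case_prod_unfold mult.assoc)
  have E_nn: "expectation (\<lambda>w. n1 t w * n2 t w) =
    (\<Sum>j\<in>K. \<integral>(s, w). indicator {..t} s * (\<gamma>1 j s w * \<gamma>2 j s w) \<partial>LM)"
  proof -
    have "expectation (\<lambda>w. n1 t w * n2 t w) = expectation (\<lambda>w. n1 t w * N2 t w)"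
      by (rule to_N[OF in_L2_measurable n(2)[OF t] N(2)[OF t] nN(2)[OF t], OF n(1)[OF t]])
    also have "\<dots> = expectation (\<lambda>w. N2 t w * n1 t w)" by (simp add: mult.commute)
    also have "\<dots> = expectation (\<lambda>w. N2 t w * N1 t w)"
      by (rule to_N[OF in_L2_measurable n(1)[OF t] N(1)[OF t] nN(1)[OF t], OF N(2)[OF t]])
    also have "\<dots> = (\<Sum>j\<in>K. expectation (\<lambda>w. N2 t w * I1 j t w))"
      unfolding N1_def by (rule sum_E[OF N(2)[OF t] I1 t])
    also have "\<dots> = (\<Sum>j\<in>K. \<Sum>k\<in>K. expectation (\<lambda>w. I1 j t w * I2 k t w))"
    proof (rule sum.cong[OF refl])
      fix j assume j: "j \<in> K"
      have "in_L2 M (I1 j t)"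
        using j K(2) by (intro ito_integral_in_L2[OF _ I1 t]) auto
      from sum_E[OF this I2 t]
      show "expectation (\<lambda>w. N2 t w * I1 j t w) = (\<Sum>k\<in>K. expectation (\<lambda>w. I1 j t w * I2 k t w))"
        by (simp add: N2_def mult.commute)
    qed
    also have "\<dots> = (\<Sum>j\<in>K. \<Sum>k\<in>K. if j = k then \<integral>(s, w). indicator {..t} s * (\<gamma>1 j s w * \<gamma>2 k s w) \<partial>LM else 0)"
      using K(2) by (intro sum.cong refl ito_isometry[OF _ _ t I1 I2]) auto
    also have "\<dots> = (\<Sum>j\<in>K. \<integral>(s, w). indicator {..t} s * (\<gamma>1 j s w * \<gamma>2 j s w) \<partial>LM)"
      using K(1) by simp
    finally show ?thesis .
  qed
  \<comment> \<open>Fubini puts the time integral outside. At a time s \<le> t the drift is known,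
    so the martingale at \<open>t\<close> may be replaced by its value at \<open>s\<close>. As only
    almost every section of \<alpha> is square integrable, this is done for almost every
    \<open>s\<close>.\<close>
  have mart: "expectation (\<lambda>w. drift_integral \<alpha> t w * n t w) = (\<integral>(s, w). indicator {..t} s * (\<alpha> s w * n s w) \<partial>LM)"
    if \<alpha>: "in_L2 LM (case_prod \<alpha>)" and \<alpha>F: "\<And>t. 0 \<le> t \<Longrightarrow> t \<le> T \<Longrightarrow> \<alpha> t \<in> borel_measurable (F t)"
      and n: "\<And>t. 0 \<le> t \<Longrightarrow> t \<le> T \<Longrightarrow> in_L2 M (n t)" and n_LM: "in_L2 LM (case_prod n)"
      and I: "\<And>j. j \<in> K \<Longrightarrow> ito_integral M F T (B j) (\<gamma> j) (I j)"
      and nN: "\<And>t. 0 \<le> t \<Longrightarrow> t \<le> T \<Longrightarrow> AE w in M. n t w = (\<Sum>j\<in>K. I j t w)"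
      and N: "\<And>t. 0 \<le> t \<Longrightarrow> t \<le> T \<Longrightarrow> in_L2 M (\<lambda>w. \<Sum>j\<in>K. I j t w)"
    for \<alpha> n \<gamma> and I :: "'j \<Rightarrow> real \<Rightarrow> 'w \<Rightarrow> real"
  proof -
    have ii: "integrable LM (\<lambda>(s, w). indicator {..t} s * (\<alpha> s w * n t w))"
      using in_L2_mult[OF in_L2_indicator[OF \<alpha>, of t] in_L2_snd[OF n[OF t]]]
      by (simp add: case_prod_unfold mult.assoc)
    have ii': "integrable LM (\<lambda>(s, w). indicator {..t} s * (\<alpha> s w * n s w))"
      using in_L2_mult[OF in_L2_indicator[OF \<alpha>, of t] n_LM]
      by (simp add: case_prod_unfold mult.assoc)
    have "AE s in L. (LINT w|M. indicator {..t} s * (\<alpha> s w * n t w)) = (LINT w|M. indicator {..t} s * (\<alpha> s w * n s w))"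
      using in_L2_LM_section(2)[OF \<alpha>] AE_space
    proof eventually_elim
      case (elim s)
      show ?case
      proof (cases "s \<le> t")
        case True
        have s: "0 \<le> s" "s \<le> T" using elim by auto
        have \<alpha>s: "in_L2 M (\<alpha> s)" using elim by simp
        have "(LINT w|M. \<alpha> s w * n t w) = (LINT w|M. \<alpha> s w * n s w)"
          using to_N[OF in_L2_measurable[OF \<alpha>s] n[OF t] N[OF t] nN[OF t]]
            to_N[OF in_L2_measurable[OF \<alpha>s] n[OF s] N[OF s] nN[OF s]]
            orth[OF \<alpha>F[OF s] \<alpha>s I s(1) True t(2)] by simp
        then show ?thesis by simp
      qed simp
    qed
    then have "(LINT s|L. LINT w|M. indicator {..t} s * (\<alpha> s w * n t w))
        = (LINT s|L. LINT w|M. indicator {..t} s * (\<alpha> s w * n s w))"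
      using borel_measurable_integrable[OF LM.integrable_fst[OF ii]] borel_measurable_integrable[OF LM.integrable_fst[OF ii']]
      by (intro integral_cong_AE)
    then show ?thesis
      unfolding expectation_drift_integral_mult[OF \<alpha> n[OF t]]
      using LM.integral_fst[OF ii] LM.integral_fst[OF ii'] by simp
  qed
  have mart1: "expectation (\<lambda>w. A1 t w * n2 t w) = (\<integral>(s, w). indicator {..t} s * (\<alpha>1 s w * n2 s w) \<partial>LM)"
    unfolding A1_def using mart[OF \<alpha>(1) \<alpha>F(1) n(2) n_LM(2) I2 nN(2)[unfolded N2_def] N(2)[unfolded N2_def]] .
  have mart2: "expectation (\<lambda>w. A2 t w * n1 t w) = (\<integral>(s, w). indicator {..t} s * (\<alpha>2 s w * n1 s w) \<partial>LM)"
    unfolding A2_def using mart[OF \<alpha>(2) \<alpha>F(2) n(1) n_LM(1) I1 nN(1)[unfolded N1_def] N(1)[unfolded N1_def]] .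
  have E_A: "expectation (drift_integral \<alpha> t) = (\<integral>(s, w). indicator {..t} s * \<alpha> s w \<partial>LM)"
    if "in_L2 LM (case_prod \<alpha>)" for \<alpha>
    using expectation_drift_integral_mult[OF that const(2)[of 1], of t] by simp
  have AA: "expectation (\<lambda>w. A1 t w * A2 t w) =
    (\<integral>(s, w). indicator {..t} s * (\<alpha>1 s w * A2 s w + \<alpha>2 s w * A1 s w) \<partial>LM)"
    unfolding A1_def A2_def by (rule expectation_drift_integral_drift_integral[OF \<alpha>])
  have i_LM: "integrable LM (\<lambda>(s, w). indicator {..t} s * (\<alpha> s w * Y s w))"
    if "in_L2 LM (case_prod \<alpha>)" "in_L2 LM (case_prod Y)" for \<alpha> Y
    using in_L2_mult[OF in_L2_indicator[OF that(1), of t] that(2)]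
    by (simp add: case_prod_unfold mult.assoc)
  have i1_LM: "integrable LM (\<lambda>(s, w). indicator {..t} s * \<alpha> s w)"
    if "in_L2 LM (case_prod \<alpha>)" for \<alpha>
    using LM.in_L2_integrable[OF in_L2_indicator[OF that, of t]] by (simp add: case_prod_unfold)
  have i_M: "integrable M (\<lambda>w. Y w * Y' w)" if "in_L2 M Y" "in_L2 M Y'" for Y Y'
    by (rule in_L2_mult[OF that])
  have Zs: "in_L2 M (Z1 t)" "in_L2 M (Z2 t)"
    using in_L2_add[OF in_L2_add[OF const(2)[of z1] A(1)[of t]] n(1)[OF t]]
      in_L2_add[OF in_L2_add[OF const(2)[of z2] A(2)[of t]] n(2)[OF t]]
    by (simp_all add: n1_def n2_def)
  show "integrable M (\<lambda>w. Z1 t w * Z2 t w)" by (rule i_M[OF Zs])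
  note int = in_L2_integrable
  note iM = int[OF A(1), of t] int[OF A(2), of t] int[OF n(1)[OF t]] int[OF n(2)[OF t]]
    i_M[OF A(1)[of t] A(2)[of t]] i_M[OF A(1)[of t] n(2)[OF t]] i_M[OF A(2)[of t] n(1)[OF t]] i_M[OF n(1)[OF t] n(2)[OF t]]
  \<comment> \<open>Both factors are split into initial value, drift part and martingale part. The
    products of an initial value with a martingale part have expectation 0; the other terms reappear
    when the right-hand side is split in the same way.\<close>
  have "expectation (\<lambda>w. Z1 t w * Z2 t w) = expectation (\<lambda>w. z1 * z2 + z1 * A2 t w + z2 * A1 t w + z1 * n2 t w
     + z2 * n1 t w + A1 t w * A2 t w + A1 t w * n2 t w + A2 t w * n1 t w + n1 t w * n2 t w)"
    by (intro Bochner_Integration.integral_cong refl) (simp add: n1_def n2_def algebra_simps)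
  also have "\<dots> = z1 * z2 + z1 * expectation (A2 t) + z2 * expectation (A1 t) +
      expectation (\<lambda>w. A1 t w * A2 t w) + expectation (\<lambda>w. A1 t w * n2 t w)
      + expectation (\<lambda>w. A2 t w * n1 t w) + expectation (\<lambda>w. n1 t w * n2 t w)"
    using iM by (simp add: E0 prob_space)
  finally have lhs: "expectation (\<lambda>w. Z1 t w * Z2 t w) = \<dots>" .
  let ?i = "\<lambda>z. indicator {..t} (fst z) :: real"
  have "(\<integral>(s, w). indicator {..t} s * (\<alpha>1 s w * Z2 s w + \<alpha>2 s w * Z1 s w + (\<Sum>j\<in>K. \<gamma>1 j s w * \<gamma>2 j s w)) \<partial>LM)
    = (\<integral>z. z2 * (case z of (s, w) \<Rightarrow> indicator {..t} s * \<alpha>1 s w) + z1 * (case z of (s, w) \<Rightarrow> indicator {..t} s * \<alpha>2 s w)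
      + (case z of (s, w) \<Rightarrow> indicator {..t} s * (\<alpha>1 s w * A2 s w + \<alpha>2 s w * A1 s w))
      + (case z of (s, w) \<Rightarrow> indicator {..t} s * (\<alpha>1 s w * n2 s w))
      + (case z of (s, w) \<Rightarrow> indicator {..t} s * (\<alpha>2 s w * n1 s w))
      + (\<Sum>j\<in>K. case z of (s, w) \<Rightarrow> indicator {..t} s * (\<gamma>1 j s w * \<gamma>2 j s w)) \<partial>LM)"
    by (intro Bochner_Integration.integral_cong refl)
      (simp add: case_prod_unfold n1_def n2_def sum_distrib_left distrib_left right_diff_distrib mult.commute mult.left_commute)
  also have "\<dots> = z2 * expectation (A1 t) + z1 * expectation (A2 t) + expectation (\<lambda>w. A1 t w * A2 t w)
      + expectation (\<lambda>w. A1 t w * n2 t w) + expectation (\<lambda>w. A2 t w * n1 t w)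
      + expectation (\<lambda>w. n1 t w * n2 t w)"
  proof -
    have iAA: "integrable LM (\<lambda>(s, w). indicator {..t} s * (\<alpha>1 s w * A2 s w + \<alpha>2 s w * A1 s w))"
      using Bochner_Integration.integrable_add[OF i_LM[OF \<alpha>(1) A_LM(2)] i_LM[OF \<alpha>(2) A_LM(1)]]
      by (simp add: case_prod_unfold distrib_left)
    show ?thesis
      unfolding AA mart1 mart2 E_nn unfolding A1_def A2_def E_A[OF \<alpha>(1)] E_A[OF \<alpha>(2)] unfolding A1_def[symmetric] A2_def[symmetric]
      using i1_LM[OF \<alpha>(1)] i1_LM[OF \<alpha>(2)] iAA i_LM[OF \<alpha>(1) n_LM(2)] i_LM[OF \<alpha>(2) n_LM(1)]
        Bochner_Integration.integrable_sum[of K LM, OF gi] Bochner_Integration.integral_sum[of K LM, OF gi]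
      by simp
  qed
  finally show "expectation (\<lambda>w. Z1 t w * Z2 t w) = z1 * z2 +
      (\<integral>(s, w). indicator {..t} s * (\<alpha>1 s w * Z2 s w + \<alpha>2 s w * Z1 s w + (\<Sum>j\<in>K. \<gamma>1 j s w * \<gamma>2 j s w)) \<partial>LM)"
    unfolding lhs by simp
qed

end

section \<open>The fundamental theorem of calculus for absolutely continuous functions\<close>

text \<open>\<open>abs_cont_on\<close> numbers its intervals by an initial segment of the naturals.
  Divisions are finite sets of intervals or of tagged intervals, and an enumeration transfers the
  estimate to them.\<close>

lemma abs_cont_on_finite_family:
  assumes "abs_cont_on a b f" "0 < e"
  shows "\<exists>d>0. \<forall>S l r. finite S \<longrightarrow> (\<forall>i\<in>S. a \<le> l i \<and> l i \<le> r i \<and> r i \<le> b) \<longrightarrow>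
      disjoint_family_on (\<lambda>i. {l i<..<r i}) S \<longrightarrow> (\<Sum>i\<in>S. r i - l i) < d \<longrightarrow>
      (\<Sum>i\<in>(S :: 'i set). norm (f (r i) - f (l i))) < e"
proof -
  obtain d where d: "0 < d" "\<And>(p::nat) l r. (\<forall>k<p. a \<le> l k \<and> l k \<le> r k \<and> r k \<le> b) \<and>
     (\<forall>j<p. \<forall>k<p. j \<noteq> k \<longrightarrow> {l j<..<r j} \<inter> {l k<..<r k} = {}) \<and>
     (\<Sum>k<p. r k - l k) < d \<Longrightarrow> (\<Sum>k<p. norm (f (r k) - f (l k))) < e"
    using assms unfolding abs_cont_on_def by blast
  show ?thesis
  proof (intro exI[of _ d] conjI d(1) allI impI)
    fix S :: "'i set" and l r :: "'i \<Rightarrow> real"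
    assume S: "finite S" and lr: "\<forall>i\<in>S. a \<le> l i \<and> l i \<le> r i \<and> r i \<le> b"
      and dis: "disjoint_family_on (\<lambda>i. {l i<..<r i}) S" and sum: "(\<Sum>i\<in>S. r i - l i) < d"
    obtain h where h: "bij_betw h {..<card S} S"
      using ex_bij_betw_nat_finite[OF S] by (auto simp: atLeast0LessThan)
    have hS: "h k \<in> S" if "k < card S" for k using bij_betwE[OF h] that by auto
    have inj: "h j \<noteq> h k" if "j < card S" "k < card S" "j \<noteq> k" for j k
      using h that by (auto simp: bij_betw_def inj_on_def)
    have "(\<Sum>k<card S. norm (f (r (h k)) - f (l (h k)))) < e"
    proof (rule d(2), intro conjI allI impI)
      fix j k assume "j < card S" "k < card S" "j \<noteq> k"
      then show "{l (h j)<..<r (h j)} \<inter> {l (h k)<..<r (h k)} = {}"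
        using dis hS inj unfolding disjoint_family_on_def by blast
    next
      show "(\<Sum>k<card S. r (h k) - l (h k)) < d"
        using sum sum.reindex_bij_betw[OF h, of "\<lambda>i. r i - l i"] by simp
    qed (use lr hS in auto)
    then show "(\<Sum>i\<in>S. norm (f (r i) - f (l i))) < e"
      using sum.reindex_bij_betw[OF h, of "\<lambda>i. norm (f (r i) - f (l i))"] by simp
  qed
qed

lemma negligible_outer_open:
  assumes "negligible N" "0 < (d::real)"
  obtains U where "open U" "N \<subseteq> U" "U \<in> lmeasurable" "measure lebesgue U < d"
proof -
  have N: "N \<in> null_sets lebesgue" using assms(1) by (simp add: negligible_iff_null_sets)
  obtain U where U: "open U" "N \<subseteq> U" "(U - N) \<in> lmeasurable" "emeasure lebesgue (U - N) < ennreal d"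
    using sets_lebesgue_outer_open[of N d] N assms(2) by blast
  have "emeasure lebesgue U = emeasure lebesgue (U - N)"
    using N U(1) by (intro emeasure_Diff_null_set[symmetric]) auto
  with U(4) have U4: "emeasure lebesgue U < ennreal d" by simp
  then have "U \<in> lmeasurable" using U(1) by (intro fmeasurableI) (auto intro: less_trans)
  moreover have "measure lebesgue U < d"
    using U4 assms(2) unfolding measure_def by (cases "emeasure lebesgue U") (auto simp: ennreal_less_iff)
  ultimately show ?thesis using U that by blast
qed

text \<open>The gauge confines the intervals with tags in the null set \<open>N\<close> to an open set of small measure,
  where absolute continuity bounds the increments of \<open>f\<close>. No differentiation theorem for monotone
  functions is needed, because differentiability almost everywhere is assumed.\<close>

lemma abs_cont_has_integral_deriv:
  fixes f :: "real \<Rightarrow> 'a::euclidean_space"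
  assumes ac: "abs_cont_on 0 T f" and N: "negligible N"
    and der: "\<And>t. t \<in> {0..T} - N \<Longrightarrow> (f has_vector_derivative f' t) (at t)"
    and ab: "0 \<le> a" "a \<le> b" "b \<le> T"
  shows "(f' has_integral (f b - f a)) {a..b}"
proof -
  \<comment> \<open>With the value 0 on \<open>N\<close>, the tags in \<open>N\<close> drop out of
    the Riemann sum, and there only the increments of \<open>f\<close> remain to be
    estimated.\<close>
  define g where "g t = (if t \<in> N then 0 else f' t)" for t
  have "(g has_integral (f b - f a)) {a..b}"
    unfolding has_integral_real
  proof (intro allI impI)
    fix e :: real assume e: "0 < e"
    \<comment> \<open>The summand 1 keeps the denominator positive for a = b and makes the total
      error over an interval of length b - a strictly less than e / 2.\<close>
    define e1 where "e1 = e / (2 * (b - a + 1))"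
    have e1: "0 < e1" "e1 * (b - a) < e / 2"
      using e ab by (auto simp: e1_def field_simps)
    have e2: "0 < e / 2" using e by simp
    obtain d where d0: "0 < d" and d1: "\<forall>S l r. finite S \<longrightarrow> (\<forall>i\<in>S. 0 \<le> l i \<and> l i \<le> r i \<and> r i \<le> T) \<longrightarrow>
      disjoint_family_on (\<lambda>i. {l i<..<r i}) S \<longrightarrow> (\<Sum>i\<in>S. r i - l i) < d \<longrightarrow>
      (\<Sum>i\<in>(S :: (real \<times> real set) set). norm (f (r i) - f (l i))) < e / 2"
      using abs_cont_on_finite_family[OF ac e2] by blast
    note d = d0 d1[rule_format]
    obtain U where U: "open U" "N \<subseteq> U" "U \<in> lmeasurable" "measure lebesgue U < d"
      using negligible_outer_open[OF N d(1)] .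
    have "\<exists>\<delta>>0. t \<in> {0..T} - N \<longrightarrow> (\<forall>y. norm (y - t) < \<delta> \<longrightarrow>
        norm (f y - f t - (y - t) *\<^sub>R f' t) \<le> e1 * norm (y - t))" for t
      using der[of t] e1(1) unfolding has_vector_derivative_def has_derivative_at_alt
      by (cases "t \<in> {0..T} - N") (auto intro: exI[of _ "1::real"])
    then obtain \<delta> where \<delta>: "\<And>t. \<delta> t > 0" "\<And>t y. t \<in> {0..T} - N \<Longrightarrow> norm (y - t) < \<delta> t \<Longrightarrow>
        norm (f y - f t - (y - t) *\<^sub>R f' t) \<le> e1 * norm (y - t)" by metis
    define \<gamma> where "\<gamma> t = (if t \<in> N then U else ball t (\<delta> t))" for t
    have gauge: "gauge \<gamma>" using U(1,2) \<delta>(1) by (auto simp: gauge_def \<gamma>_def)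
    show "\<exists>\<gamma>. gauge \<gamma> \<and> (\<forall>\<D>. \<D> tagged_division_of {a..b} \<and> \<gamma> fine \<D> \<longrightarrow>
        norm ((\<Sum>(x, k)\<in>\<D>. measure lborel k *\<^sub>R g x) - (f b - f a)) < e)"
    proof (intro exI[of _ \<gamma>] conjI gauge allI impI)
      fix D assume "D tagged_division_of {a..b} \<and> \<gamma> fine D"
      then have D: "D tagged_division_of {a..b}" and fine: "\<gamma> fine D" by auto
      note finD = tagged_division_ofD(1)[OF D]
      have K: "\<exists>u v. u \<le> v \<and> K = {u..v} \<and> Inf K = u \<and> Sup K = v \<and> a \<le> u \<and> v \<le> b \<and> x \<in> {u..v} \<and> {u..v} \<subseteq> \<gamma> x"
        if KD: "(x, K) \<in> D" for x K
      proof -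
        obtain u v where uv: "K = {u..v}" using tagged_division_ofD(4)[OF D KD] by auto
        moreover have "x \<in> K" using tagged_division_ofD(2)[OF D KD] .
        moreover have "K \<subseteq> {a..b}" using tagged_division_ofD(3)[OF D KD] .
        moreover have "K \<subseteq> \<gamma> x" using fine KD by (auto simp: fine_def)
        ultimately show ?thesis by (intro exI[of _ u] exI[of _ v]) auto
      qed
      define \<Delta> where "\<Delta> = (\<lambda>(x::real, K). f (Sup K) - f (Inf K))"
      define c where "c = (\<lambda>(x, K::real set). measure lborel K *\<^sub>R g x)"
      define D1 D2 where "D1 = {z\<in>D. fst z \<notin> N}" and "D2 = {z\<in>D. fst z \<in> N}"
      have D12: "D = D1 \<union> D2" "D1 \<inter> D2 = {}" "finite D1" "finite D2" using finD by (auto simp: D1_def D2_def)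
      have "(\<Sum>(x, k)\<in>D. measure lborel k *\<^sub>R g x) - (f b - f a) = (\<Sum>z\<in>D. c z - \<Delta> z)"
        using additive_tagged_division_1[OF ab(2) D, of f] by (simp add: sum_subtractf c_def \<Delta>_def case_prod_unfold)
      also have "norm \<dots> \<le> (\<Sum>z\<in>D. norm (c z - \<Delta> z))" by (rule norm_sum)
      also have "\<dots> = (\<Sum>z\<in>D1. norm (c z - \<Delta> z)) + (\<Sum>z\<in>D2. norm (c z - \<Delta> z))"
        unfolding D12(1) using D12 by (intro sum.union_disjoint) auto
      also have "\<dots> < e / 2 + e / 2"
      proof (rule add_strict_mono)
        have "(\<Sum>z\<in>D1. norm (c z - \<Delta> z)) \<le> (\<Sum>z\<in>D1. e1 * measure lborel (snd z))"
        proof (rule sum_mono)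
          fix z assume z: "z \<in> D1"
          obtain x k where xk: "z = (x, k)" by (cases z)
          from z xk have "(x, k) \<in> D" "x \<notin> N" by (auto simp: D1_def)
          from K[OF this(1)] obtain u v where uv: "u \<le> v" "k = {u..v}" "Inf k = u" "Sup k = v" "a \<le> u" "v \<le> b"
            "x \<in> {u..v}" "{u..v} \<subseteq> \<gamma> x" by blast
          have "u \<in> \<gamma> x" "v \<in> \<gamma> x" using uv by auto
          then have "norm (u - x) < \<delta> x" "norm (v - x) < \<delta> x"
            using \<open>x \<notin> N\<close> by (auto simp: \<gamma>_def dist_norm norm_minus_commute)
          moreover have "x \<in> {0..T} - N" using uv ab \<open>x \<notin> N\<close> by auto
          ultimately have 1: "norm (f u - f x - (u - x) *\<^sub>R f' x) \<le> e1 * norm (u - x)"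
            and 2: "norm (f v - f x - (v - x) *\<^sub>R f' x) \<le> e1 * norm (v - x)" using \<delta>(2) by blast+
          \<comment> \<open>The tag lies inside the interval, so the linear approximations at the
            two end-points combine to the increment, and their errors add up to \<open>e1\<close>
            times the length.\<close>
          have "c z - \<Delta> z = (f u - f x - (u - x) *\<^sub>R f' x) - (f v - f x - (v - x) *\<^sub>R f' x)"
            using uv \<open>x \<notin> N\<close> by (simp add: xk c_def \<Delta>_def g_def algebra_simps)
          also have "norm \<dots> \<le> e1 * norm (u - x) + e1 * norm (v - x)"
            using norm_triangle_ineq4 1 2 by (rule order_trans[OF _ add_mono])
          also have "\<dots> = e1 * measure lborel (snd z)" using uv by (simp add: xk algebra_simps)
          finally show "norm (c z - \<Delta> z) \<le> e1 * measure lborel (snd z)" .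
        qed
        also have "\<dots> \<le> (\<Sum>z\<in>D. e1 * measure lborel (snd z))"
          using e1(1) finD by (intro sum_mono2) (auto simp: D12(1))
        also have "\<dots> = e1 * (b - a)"
          using additive_content_tagged_division[of D a b] D ab by (simp add: sum_distrib_left[symmetric] case_prod_unfold)
        also have "\<dots> < e / 2" by (rule e1(2))
        finally show "(\<Sum>z\<in>D1. norm (c z - \<Delta> z)) < e / 2" .
      next
        have int: "{Inf (snd z)<..<Sup (snd z)} = interior (snd z)" if "z \<in> D" for z
          using K[of "fst z" "snd z"] that by (metis interior_atLeastAtMost_real prod.collapse)
        have dis: "disjoint_family_on (\<lambda>z. {Inf (snd z)<..<Sup (snd z)}) D2"
          unfolding disjoint_family_on_def
        proof (intro ballI impI)
          fix y z assume yz: "y \<in> D2" "z \<in> D2" "y \<noteq> z"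
          have "interior (snd y) \<inter> interior (snd z) = {}"
            using tagged_division_ofD(5)[OF D, of "fst y" "snd y" "fst z" "snd z"] yz by (auto simp: D2_def)
          then show "{Inf (snd y)<..<Sup (snd y)} \<inter> {Inf (snd z)<..<Sup (snd z)} = {}"
            using int yz by (auto simp: D2_def)
        qed
        \<comment> \<open>These intervals do not overlap and lie in \<open>U\<close>, so their total
          length is the measure of their union and stays below the \<open>d\<close> of absolute
          continuity.\<close>
        have "(\<Sum>z\<in>D2. Sup (snd z) - Inf (snd z)) = (\<Sum>z\<in>D2. measure lebesgue {Inf (snd z)<..<Sup (snd z)})"
        proof (rule sum.cong[OF refl])
          fix z assume "z \<in> D2"
          then have "(fst z, snd z) \<in> D" by (simp add: D2_def)
          from K[OF this] have "Inf (snd z) \<le> Sup (snd z)" by blast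
          then show "Sup (snd z) - Inf (snd z) = measure lebesgue {Inf (snd z)<..<Sup (snd z)}"
            by (simp add: measure_completion)
        qed
        also have "\<dots> = measure lebesgue (\<Union>z\<in>D2. {Inf (snd z)<..<Sup (snd z)})"
        proof (rule measure_finite_Union[symmetric])
          have "emeasure lborel {l<..<u::real} \<noteq> \<infinity>" for l u by (cases "l \<le> u") auto
          then show "\<And>z. z \<in> D2 \<Longrightarrow> emeasure lebesgue {Inf (snd z)<..<Sup (snd z)} \<noteq> \<infinity>" by simp
        qed (use D12 dis in auto)
        also have "\<dots> \<le> measure lebesgue U"
        proof (rule measure_mono_fmeasurable)
          show "(\<Union>z\<in>D2. {Inf (snd z)<..<Sup (snd z)}) \<subseteq> U"
          proof
            fix s assume "s \<in> (\<Union>z\<in>D2. {Inf (snd z)<..<Sup (snd z)})"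
            then obtain x K where z: "(x, K) \<in> D" "x \<in> N" "s \<in> {Inf K<..<Sup K}" by (auto simp: D2_def)
            from K[OF z(1)] z(3) have "s \<in> \<gamma> x" by auto
            with z(2) show "s \<in> U" by (simp add: \<gamma>_def)
          qed
        qed (use U D12 in auto)
        also have "\<dots> < d" by (rule U(4))
        finally have "(\<Sum>z\<in>D2. norm (f (Sup (snd z)) - f (Inf (snd z)))) < e / 2"
        proof (intro d(2) dis D12(4))
          fix z assume "z \<in> D2"
          then show "0 \<le> Inf (snd z) \<and> Inf (snd z) \<le> Sup (snd z) \<and> Sup (snd z) \<le> T"
            using K[of "fst z" "snd z"] ab by (auto simp: D2_def)
        qed
        moreover have "norm (c z - \<Delta> z) = norm (f (Sup (snd z)) - f (Inf (snd z)))" if "z \<in> D2" for z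
          using that by (auto simp: D2_def c_def \<Delta>_def g_def norm_minus_commute case_prod_unfold)
        ultimately show "(\<Sum>z\<in>D2. norm (c z - \<Delta> z)) < e / 2" by simp
      qed
      finally show "norm ((\<Sum>(x, k)\<in>D. measure lborel k *\<^sub>R g x) - (f b - f a)) < e" by simp
    qed
  qed
  then show ?thesis
    by (rule has_integral_spike[OF N, rotated]) (auto simp: g_def)
qed

text \<open>A gauge integral alone does not give Lebesgue integrability. On an interval shorter than
  \<open>d\<close>, absolute continuity with tolerance 1 bounds the variation of the indefinite
  integral, which makes the integrand absolutely integrable there; finitely many such intervals
  exhaust the whole one.\<close>

lemma abs_cont_deriv_absolutely_integrable:
  fixes f :: "real \<Rightarrow> 'a::euclidean_space"
  assumes ac: "abs_cont_on 0 T f" and T: "0 \<le> T"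
    and hi: "\<And>a b. 0 \<le> a \<Longrightarrow> a \<le> b \<Longrightarrow> b \<le> T \<Longrightarrow> (f' has_integral (f b - f a)) {a..b}"
  shows "f' absolutely_integrable_on {0..T}"
proof -
  obtain d where d0: "0 < d" and d1: "\<forall>S l r. finite S \<longrightarrow> (\<forall>i\<in>S. 0 \<le> l i \<and> l i \<le> r i \<and> r i \<le> T) \<longrightarrow>
      disjoint_family_on (\<lambda>i. {l i<..<r i}) S \<longrightarrow> (\<Sum>i\<in>S. r i - l i) < d \<longrightarrow>
      (\<Sum>i\<in>(S :: real set set). norm (f (r i) - f (l i))) < 1"
      using abs_cont_on_finite_family[OF ac zero_less_one] by blast
    note d = d0 d1[rule_format]
  have small: "f' absolutely_integrable_on {a..b}" if ab: "0 \<le> a" "a \<le> b" "b \<le> T" "b - a < d" for a b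
  proof -
    have "f' absolutely_integrable_on cbox a b"
    proof (rule bounded_variation_absolutely_integrable_interval[where B=1])
      show "f' integrable_on cbox a b" using hi[OF ab(1-3)] by auto
      fix D assume D: "D division_of cbox a b"
      note finD = division_ofD(1)[OF D]
      have K: "\<exists>u v. u \<le> v \<and> K = {u..v} \<and> Inf K = u \<and> Sup K = v \<and> a \<le> u \<and> v \<le> b" if KD: "K \<in> D" for K
      proof -
        obtain u v where uv: "K = {u..v}" using division_ofD(4)[OF D KD] by auto
        moreover have "K \<noteq> {}" using division_ofD(3)[OF D KD] .
        moreover have "K \<subseteq> {a..b}" using division_ofD(2)[OF D KD] by simp
        ultimately show ?thesis by (intro exI[of _ u] exI[of _ v]) auto
      qed
      have "(\<Sum>K\<in>D. norm (f (Sup K) - f (Inf K))) < 1"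
      proof (rule d(2)[OF finD])
        show "0 \<le> Inf K \<and> Inf K \<le> Sup K \<and> Sup K \<le> T" if "K \<in> D" for K
          using K[OF that] ab by auto
        show "disjoint_family_on (\<lambda>K. {Inf K<..<Sup K}) D"
          unfolding disjoint_family_on_def
        proof (intro ballI impI)
          fix y z assume yz: "y \<in> D" "z \<in> D" "y \<noteq> z"
          have "{Inf z<..<Sup z} = interior z" if "z \<in> D" for z using K[OF that] by (metis interior_atLeastAtMost_real)
          then show "{Inf y<..<Sup y} \<inter> {Inf z<..<Sup z} = {}"
            using division_ofD(5)[OF D yz] yz by simp
        qed
        have "(\<Sum>K\<in>D. Sup K - Inf K) = (\<Sum>K\<in>D. measure lborel K)"
        proof (rule sum.cong[OF refl])
          fix K assume "K \<in> D"
          from K[OF this] obtain u v where "u \<le> v" "K = {u..v}" "Inf K = u" "Sup K = v" by blast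
          then show "Sup K - Inf K = measure lborel K" by simp
        qed
        also have "\<dots> = b - a" using additive_content_division[OF D] ab by simp
        finally show "(\<Sum>K\<in>D. Sup K - Inf K) < d" using ab by simp
      qed
      moreover have "integral K f' = f (Sup K) - f (Inf K)" if KD: "K \<in> D" for K
      proof -
        from K[OF KD] obtain u v where uv: "u \<le> v" "K = {u..v}" "Inf K = u" "Sup K = v" "a \<le> u" "v \<le> b" by blast
        then show ?thesis using hi[of u v] ab by (auto intro: integral_unique)
      qed
      ultimately show "(\<Sum>K\<in>D. norm (integral K f')) \<le> 1" by simp
    qed
    then show ?thesis by simp
  qed
  \<comment> \<open>Half of \<open>d\<close>, because \<open>small\<close> requires intervals
    strictly shorter than \<open>d\<close>.\<close>
  define h where "h = d / 2"
  have h: "0 < h" "h < d" using d(1) by (auto simp: h_def)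
  have "f' absolutely_integrable_on {0..min (real k * h) T}" for k :: nat
  proof (induction k)
    case 0
    show ?case using small[of 0 0] T d(1) by simp
  next
    case (Suc k)
    have le: "min (real k * h) T \<le> min (real (Suc k) * h) T" using h by (auto simp: algebra_simps)
    have "f' absolutely_integrable_on {min (real k * h) T..min (real (Suc k) * h) T}"
      using le h T by (intro small) (auto simp: algebra_simps)
    from absolutely_integrable_Un[OF Suc this]
    have "f' absolutely_integrable_on ({0..min (real k * h) T} \<union> {min (real k * h) T..min (real (Suc k) * h) T})" .
    also have "{0..min (real k * h) T} \<union> {min (real k * h) T..min (real (Suc k) * h) T} = {0..min (real (Suc k) * h) T}"
      using le h T by (intro ivl_disj_un_two_touch) auto
    finally show ?case .
  qed
  moreover obtain k :: nat where "T < real k * h" using reals_Archimedean3[OF h(1)] by blast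
  then have "min (real k * h) T = T" by simp
  ultimately show ?thesis by metis
qed

text \<open>The increments of \<open>f\<close> are gauge integrals off a negligible set; absolute
  integrability identifies them with Lebesgue integrals, the form used on the product space.\<close>

lemma abs_cont_deriv_FTC:
  fixes f :: "real \<Rightarrow> 'a::euclidean_space"
  assumes ac: "abs_cont_deriv T f f'" and T: "0 \<le> T"
  shows "integrable (lebesgue_on {0..T}) f'"
    and "\<And>t. 0 \<le> t \<Longrightarrow> t \<le> T \<Longrightarrow> f t = f 0 + (LINT s|lebesgue_on {0..t}. f' s)"
proof -
  from ac have AE: "AE t in lebesgue_on {0..T}. (f has_vector_derivative f' t) (at t)"
    and ac': "abs_cont_on 0 T f" by (auto simp: abs_cont_deriv_def)
  from AE_E3[OF AE] obtain N where N: "\<And>t. t \<in> {0..T} - N \<Longrightarrow> (f has_vector_derivative f' t) (at t)"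
    and N0: "N \<in> null_sets (lebesgue_on {0..T})" by auto
  have "negligible N" using N0 by (simp add: negligible_iff_null_sets null_sets_restrict_space)
  then have hi: "(f' has_integral (f b - f a)) {a..b}" if "0 \<le> a" "a \<le> b" "b \<le> T" for a b
    using abs_cont_has_integral_deriv[OF ac' _ _ that] N by blast
  have ai: "f' absolutely_integrable_on {0..T}"
    by (rule abs_cont_deriv_absolutely_integrable[OF ac' T hi])
  then show i: "integrable (lebesgue_on {0..T}) f'"
    by (simp add: integrable_restrict_space set_integrable_def)
  fix t assume t: "0 \<le> t" "t \<le> T"
  have "f' absolutely_integrable_on {0..t}"
    by (rule set_integrable_subset[OF ai]) (use t in auto)
  then have "integrable (lebesgue_on {0..t}) f'"
    by (simp add: integrable_restrict_space set_integrable_def)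
  then have "(LINT s|lebesgue_on {0..t}. f' s) = f t - f 0"
    using lebesgue_integral_eq_integral[of "{0..t}" f'] integral_unique[OF hi[OF order_refl t]] by simp
  then show "f t = f 0 + (LINT s|lebesgue_on {0..t}. f' s)" by simp
qed

lemma abs_cont_on_continuous_on:
  assumes "abs_cont_on a b f" shows "continuous_on {a..b} f"
  unfolding continuous_on_iff
proof (intro ballI allI impI)
  fix x e :: real assume x: "x \<in> {a..b}" and e: "0 < e"
  obtain d where d0: "0 < d" and d1: "\<forall>S l r. finite S \<longrightarrow> (\<forall>i\<in>S. a \<le> l i \<and> l i \<le> r i \<and> r i \<le> b) \<longrightarrow>
      disjoint_family_on (\<lambda>i. {l i<..<r i}) S \<longrightarrow> (\<Sum>i\<in>S. r i - l i) < d \<longrightarrow>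
      (\<Sum>i\<in>(S :: unit set). norm (f (r i) - f (l i))) < e"
      using abs_cont_on_finite_family[OF assms e] by blast
    note d = d0 d1[rule_format]
  have "dist (f y) (f x) < e" if y: "y \<in> {a..b}" "dist y x < d" for y
  proof -
    have "(\<Sum>i\<in>{()}. norm (f (max x y) - f (min x y))) < e"
      using x y by (intro d(2)) (auto simp: disjoint_family_on_def dist_real_def)
    then show ?thesis by (auto simp: dist_norm min_def max_def norm_minus_commute split: if_splits)
  qed
  then show "\<exists>d>0. \<forall>x'\<in>{a..b}. dist x' x < d \<longrightarrow> dist (f x') (f x) < e" using d(1) by blast
qed

section \<open>Quadratic functionals of processes with stochastic differentials\<close>

lemma continuous_on_Icc_measurable_lebesgue_on:
  fixes p :: "real \<Rightarrow> 'a::euclidean_space"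
  shows "continuous_on {a..b} p \<Longrightarrow> p \<in> borel_measurable (lebesgue_on {a..b})"
  by (rule continuous_imp_measurable_on_sets_lebesgue) auto

lemma borel_measurable_vec_nth:
  fixes f :: "'a \<Rightarrow> 'b::real_normed_vector^'n"
  shows "f \<in> borel_measurable N \<Longrightarrow> (\<lambda>x. f x $ i) \<in> borel_measurable N"
proof -
  assume f: "f \<in> borel_measurable N"
  have "continuous_on UNIV (\<lambda>x :: 'b^'n. x $ i)" by (intro continuous_intros)
  from measurable_compose[OF f borel_measurable_continuous_onI[OF this]] show ?thesis .
qed

lemma in_L2_norm_nth:
  fixes f :: "'a \<Rightarrow> real^'n"
  assumes "f \<in> borel_measurable N" "in_L2 N (\<lambda>x. norm (f x))"
  shows "in_L2 N (\<lambda>x. f x $ r)"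
  by (rule in_L2_bound[OF assms(2), of _ 1])
    (use assms(1) in \<open>auto simp: component_le_norm_cart intro: borel_measurable_vec_nth\<close>)

lemma quadratic_form_nth: "(A *v x) \<bullet> y = (\<Sum>r\<in>UNIV. \<Sum>s\<in>UNIV. A $ r $ s * (x $ s * y $ r))"
  for A :: "real^'m^'n"
  by (simp add: inner_vec_def matrix_vector_mult_def sum_distrib_right mult.assoc)

context brownian_setting
begin

text \<open>A deterministic product rule for \<open>p\<close> and the expectation of
  \<open>Y\<close>, whose density is the expectation of \<psi>. Since \<open>p'\<close> is only
  integrable in time, its product with \<open>Y\<close> is controlled by the uniform bound
  \<open>C\<close> on first absolute moments; \<open>p\<close> itself is bounded by
  continuity.\<close>

lemma expectation_weighted_ito:
  fixes p p' :: "real \<Rightarrow> real" and Y \<psi> :: "real \<Rightarrow> 'w \<Rightarrow> real"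
  assumes p': "integrable L p'" and pc: "continuous_on {0..T} p"
    and p: "\<And>t. 0 \<le> t \<Longrightarrow> t \<le> T \<Longrightarrow> p t = p 0 + (LINT s|L. indicator {..t} s * p' s)"
    and Y: "case_prod Y \<in> borel_measurable LM"
    and C: "\<And>t. 0 \<le> t \<Longrightarrow> t \<le> T \<Longrightarrow> (\<integral>\<^sup>+w. ennreal \<bar>Y t w\<bar> \<partial>M) \<le> ennreal C"
    and \<psi>: "integrable LM (case_prod \<psi>)"
    and E: "\<And>t. 0 \<le> t \<Longrightarrow> t \<le> T \<Longrightarrow> expectation (Y t) = y0 + (\<integral>(s, w). indicator {..t} s * \<psi> s w \<partial>LM)"
  shows "integrable LM (\<lambda>(s, w). p' s * Y s w + p s * \<psi> s w)"
    and "p T * expectation (Y T) = p 0 * y0 + (\<integral>(s, w). p' s * Y s w + p s * \<psi> s w \<partial>LM)"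
proof -
  have [measurable]: "p' \<in> borel_measurable L" "p \<in> borel_measurable L" "case_prod \<psi> \<in> borel_measurable LM" "case_prod Y \<in> borel_measurable LM"
    using p' continuous_on_Icc_measurable_lebesgue_on[OF pc] \<psi> Y by auto
  obtain Cp where Cp: "\<And>t. t \<in> {0..T} \<Longrightarrow> \<bar>p t\<bar> \<le> Cp"
    using compact_imp_bounded[OF compact_continuous_image[OF pc compact_Icc]]
    unfolding bounded_iff by (metis imageI real_norm_def)
  have i1: "integrable LM (\<lambda>(s, w). p' s * Y s w)"
    unfolding integrable_iff_bounded
  proof
    show "(\<lambda>(s, w). p' s * Y s w) \<in> borel_measurable LM" unfolding case_prod_unfold by measurable
    then have "(\<integral>\<^sup>+z. ennreal (norm (case z of (s, w) \<Rightarrow> p' s * Y s w)) \<partial>LM)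
       = (\<integral>\<^sup>+s. \<integral>\<^sup>+w. ennreal (norm (p' s * Y s w)) \<partial>M \<partial>L)"
      by (subst nn_integral_fst[symmetric]) (auto intro: measurable_compose[where g="\<lambda>x. ennreal (norm x)"])
    also have "\<dots> \<le> (\<integral>\<^sup>+s. ennreal \<bar>p' s\<bar> * ennreal C \<partial>L)"
    proof (rule nn_integral_mono)
      fix s assume s: "s \<in> space L"
      have Ys: "Y s \<in> borel_measurable M" using measurable_Pair2[OF Y s] by simp
      have "(\<integral>\<^sup>+w. ennreal (norm (p' s * Y s w)) \<partial>M) = (\<integral>\<^sup>+w. ennreal \<bar>p' s\<bar> * ennreal \<bar>Y s w\<bar> \<partial>M)"
        by (simp add: abs_mult ennreal_mult)
      also have "\<dots> = ennreal \<bar>p' s\<bar> * (\<integral>\<^sup>+w. ennreal \<bar>Y s w\<bar> \<partial>M)"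
        using Ys by (intro nn_integral_cmult) simp
      also have "\<dots> \<le> ennreal \<bar>p' s\<bar> * ennreal C"
        using C[of s] s by (intro mult_left_mono) auto
      finally show "(\<integral>\<^sup>+w. ennreal (norm (p' s * Y s w)) \<partial>M) \<le> ennreal \<bar>p' s\<bar> * ennreal C" .
    qed
    also have "\<dots> = (\<integral>\<^sup>+s. ennreal \<bar>p' s\<bar> \<partial>L) * ennreal C" by (rule nn_integral_multc) simp
    also have "\<dots> < \<infinity>"
      using p' by (simp add: integrable_iff_bounded ennreal_mult_less_top)
    finally show "(\<integral>\<^sup>+z. ennreal (norm (case z of (s, w) \<Rightarrow> p' s * Y s w)) \<partial>LM) < \<infinity>" .
  qed
  have i2: "integrable LM (\<lambda>(s, w). p s * \<psi> s w)"
  proof (rule Bochner_Integration.integrable_bound)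
    show "integrable LM (\<lambda>z. Cp * case_prod \<psi> z)" using \<psi> by simp
    show "(\<lambda>(s, w). p s * \<psi> s w) \<in> borel_measurable LM" unfolding case_prod_unfold by measurable
    show "AE z in LM. norm (case z of (s, w) \<Rightarrow> p s * \<psi> s w) \<le> norm (Cp * case_prod \<psi> z)"
    proof (rule AE_I2)
      fix z assume "z \<in> space LM"
      then have "\<bar>p (fst z)\<bar> \<le> \<bar>Cp\<bar>" using Cp[of "fst z"] by (auto simp: space_pair_measure)
      then show "norm (case z of (s, w) \<Rightarrow> p s * \<psi> s w) \<le> norm (Cp * case_prod \<psi> z)"
        by (auto simp: case_prod_unfold abs_mult intro: mult_right_mono)
    qed
  qed
  show "integrable LM (\<lambda>(s, w). p' s * Y s w + p s * \<psi> s w)"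
    using Bochner_Integration.integrable_add[OF i1 i2] by (simp add: case_prod_unfold)
  define \<Psi> where "\<Psi> s = expectation (\<psi> s)" for s
  have \<Psi>: "integrable L \<Psi>" unfolding \<Psi>_def using LM.integrable_fst[OF \<psi>] .
  define \<phi> where "\<phi> t = expectation (Y t)" for t
  have ind: "integrable LM (\<lambda>(s, w). indicator {..t} s * \<psi> s w)" for t
  proof (rule Bochner_Integration.integrable_bound[OF \<psi>])
    have [measurable]: "(indicator {..t} :: real \<Rightarrow> real) \<in> borel_measurable L"
      by (rule indicator_measurable_lebesgue_on) simp
    show "(\<lambda>(s, w). indicator {..t} s * \<psi> s w) \<in> borel_measurable LM" unfolding case_prod_unfold by measurable
  qed (auto split: split_indicator)
  have \<phi>: "\<phi> t = y0 + (LINT s|L. indicator {..t} s * \<Psi> s)" if "0 \<le> t" "t \<le> T" for t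
    unfolding \<phi>_def E[OF that] \<Psi>_def using LM.integral_fst[OF ind[of t]] by simp
  have full: "(LINT s|L. indicator {..T} s * f s) = (LINT s|L. f s)" for f :: "real \<Rightarrow> real"
    by (intro Bochner_Integration.integral_cong refl) auto
  have j1: "integrable L (\<lambda>s. p' s * \<phi> s)" and e1: "(LINT s|L. p' s * \<phi> s) = (\<integral>(s, w). p' s * Y s w \<partial>LM)"
    using LM.integrable_fst[OF i1] LM.integral_fst[OF i1] by (simp_all add: \<phi>_def)
  have j2: "integrable L (\<lambda>s. p s * \<Psi> s)" and e2: "(LINT s|L. p s * \<Psi> s) = (\<integral>(s, w). p s * \<psi> s w \<partial>LM)"
    using LM.integrable_fst[OF i2] LM.integral_fst[OF i2] by (simp_all add: \<Psi>_def)
  have "(\<integral>(s, w). p' s * Y s w + p s * \<psi> s w \<partial>LM) = (\<integral>(s, w). p' s * Y s w \<partial>LM) + (\<integral>(s, w). p s * \<psi> s w \<partial>LM)"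
    using Bochner_Integration.integral_add[OF i1 i2] by (simp add: case_prod_unfold)
  also have "\<dots> = (LINT s|L. p' s * \<phi> s) + (LINT s|L. p s * \<Psi> s)" by (simp only: e1 e2)
  \<comment> \<open>Subtracting the initial values leaves two pure indefinite integrals, to which
    integration by parts applies.\<close>
  also have "\<dots> = (LINT s|L. y0 * p' s + p 0 * \<Psi> s + (p' s * (\<phi> s - y0) + \<Psi> s * (p s - p 0)))"
    using j1 j2 by (subst Bochner_Integration.integral_add[symmetric])
      (auto intro!: Bochner_Integration.integral_cong simp: algebra_simps)
  also have "\<dots> = (LINT s|L. y0 * p' s + p 0 * \<Psi> s + (p' s * (LINT r|L. indicator {..s} r * \<Psi> r)
      + \<Psi> s * (LINT r|L. indicator {..s} r * p' r)))"
  proof (intro Bochner_Integration.integral_cong refl)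
    fix s assume "s \<in> space L"
    then have s: "0 \<le> s" "s \<le> T" by auto
    show "y0 * p' s + p 0 * \<Psi> s + (p' s * (\<phi> s - y0) + \<Psi> s * (p s - p 0)) =
      y0 * p' s + p 0 * \<Psi> s + (p' s * (LINT r|L. indicator {..s} r * \<Psi> r) + \<Psi> s * (LINT r|L. indicator {..s} r * p' r))"
      unfolding \<phi>[OF s] p[OF s] by simp
  qed
  also have "\<dots> = y0 * (LINT s|L. p' s) + p 0 * (LINT s|L. \<Psi> s) + (LINT s|L. p' s) * (LINT s|L. \<Psi> s)"
    unfolding integral_by_parts_indefinite(2)[OF p' \<Psi>, symmetric]
    using p' \<Psi> integral_by_parts_indefinite(1)[OF p' \<Psi>] integral_by_parts_indefinite(1)[OF \<Psi> p'] by simp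
  also have "\<dots> = p T * \<phi> T - p 0 * y0"
    using p[OF T_nonneg order_refl, unfolded full] \<phi>[OF T_nonneg order_refl, unfolded full]
    by (simp add: algebra_simps)
  finally show "p T * expectation (Y T) = p 0 * y0 + (\<integral>(s, w). p' s * Y s w + p s * \<psi> s w \<partial>LM)"
    by (simp add: \<phi>_def)
qed

text \<open>Moving the supremum outside the expectation turns membership in the solution space into
  a bound on second moments that is uniform in time.\<close>

lemma sup_sq_finite_bound:
  fixes X :: "real \<Rightarrow> 'w \<Rightarrow> 'a::euclidean_space"
  assumes "sup_sq_finite M T X"
  obtains C where "0 \<le> C" "\<And>t. 0 \<le> t \<Longrightarrow> t \<le> T \<Longrightarrow> (\<integral>\<^sup>+w. ennreal ((norm (X t w))\<^sup>2) \<partial>M) \<le> ennreal C"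
proof -
  let ?S = "\<integral>\<^sup>+w. (SUP t\<in>{0..T}. ennreal ((norm (X t w))\<^sup>2)) \<partial>M"
  have fin: "?S < \<infinity>" using assms by (simp add: sup_sq_finite_def)
  show ?thesis
  proof (rule that[of "enn2real ?S"])
    fix t assume t: "0 \<le> t" "t \<le> T"
    have "(\<integral>\<^sup>+w. ennreal ((norm (X t w))\<^sup>2) \<partial>M) \<le> ?S"
      using t by (intro nn_integral_mono SUP_upper2[of t]) auto
    then show "(\<integral>\<^sup>+w. ennreal ((norm (X t w))\<^sup>2) \<partial>M) \<le> ennreal (enn2real ?S)" using fin by simp
  qed simp
qed

lemma in_L2_LM_of_bound:
  assumes X: "case_prod X \<in> borel_measurable LM"
    and C: "AE t in L. (\<integral>\<^sup>+w. ennreal ((norm (X t w))\<^sup>2) \<partial>M) \<le> ennreal C"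
  shows "in_L2 LM (\<lambda>(t, w). norm (X t w :: 'a::euclidean_space))"
proof -
  have m: "(\<lambda>(t, w). norm (X t w)) \<in> borel_measurable LM"
    using measurable_compose[OF X borel_measurable_norm]
    by (simp add: case_prod_unfold)
  have "(\<integral>\<^sup>+z. ennreal ((case z of (t, w) \<Rightarrow> norm (X t w))\<^sup>2) \<partial>LM)
      = (\<integral>\<^sup>+t. \<integral>\<^sup>+w. ennreal ((norm (X t w))\<^sup>2) \<partial>M \<partial>L)"
    using m by (subst nn_integral_fst[symmetric]) auto
  also have "\<dots> \<le> (\<integral>\<^sup>+t. ennreal C \<partial>L)" by (rule nn_integral_mono_AE[OF C])
  also have "\<dots> < \<infinity>"
    by (simp add: ennreal_mult_eq_top_iff less_top[symmetric])
  finally show ?thesis using m by (simp add: in_L2_iff_nn)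
qed

lemma sup_sq_finite_in_L2:
  assumes "case_prod X \<in> borel_measurable LM" "sup_sq_finite M T X"
  shows "in_L2 LM (\<lambda>(t, w). norm (X t w :: 'a::euclidean_space))"
proof (rule sup_sq_finite_bound[OF assms(2)])
  fix C assume "0 \<le> C" and C: "\<And>t. 0 \<le> t \<Longrightarrow> t \<le> T \<Longrightarrow> (\<integral>\<^sup>+w. ennreal ((norm (X t w))\<^sup>2) \<partial>M) \<le> ennreal C"
  show ?thesis by (rule in_L2_LM_of_bound[OF assms(1), of C]) (use C in auto)
qed

lemma LINT_nth_lebesgue_on:
  fixes a :: "real \<Rightarrow> real^'n"
  assumes a: "integrable L a" and t: "t \<le> T"
  shows "(LINT s|lebesgue_on {0..t}. a s) $ r = (LINT s|lebesgue_on {0..t}. a s $ r)"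
proof -
  have "set_integrable lebesgue {0..T} a" using a by (simp add: set_integrable_def integrable_restrict_space)
  then have "set_integrable lebesgue {0..t} a" by (rule set_integrable_subset) (use t in auto)
  then have "integrable (lebesgue_on {0..t}) a" by (simp add: set_integrable_def integrable_restrict_space)
  then show ?thesis using integral_bounded_linear[OF bounded_linear_vec_nth] by metis
qed

text \<open>Each entry of \<open>P\<close> weights the product of two components of
  \<open>X\<close>, whose expectation is known from the product rule; summing over the entries
  restores the quadratic form. The sum over the noises in \<open>g\<close> is the second-order term
  of Ito's formula.\<close>

lemma expectation_quadratic_ito:
  fixes X a :: "real \<Rightarrow> 'w \<Rightarrow> real^'n" and c :: "'j \<Rightarrow> real \<Rightarrow> 'w \<Rightarrow> real^'n"
    and P P' :: "real \<Rightarrow> real^'n^'n"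
  assumes K: "finite K" "K \<subseteq> J" and X: "ito_process M F T B K x0 a c X"
    and a: "in_L2 LM (\<lambda>(t, w). norm (a t w))"
    and P: "abs_cont_deriv T P P'"
  defines "g \<equiv> \<lambda>t w. (P' t *v X t w) \<bullet> X t w + (P t *v X t w) \<bullet> a t w + (P t *v a t w) \<bullet> X t w
      + (\<Sum>j\<in>K. (P t *v c j t w) \<bullet> c j t w)"
  shows "integrable M (\<lambda>w. (P T *v X T w) \<bullet> X T w)"
    and "integrable LM (case_prod g)"
    and "expectation (\<lambda>w. (P T *v X T w) \<bullet> X T w) = (P 0 *v x0) \<bullet> x0 + (\<integral>z. case_prod g z \<partial>LM)"
proof -
  from X obtain I where Xa: "meas_adapted M F T X" and sup: "sup_sq_finite M T X"
    and aa: "meas_adapted M F T a" and ai: "AE w in M. integrable L (\<lambda>t. a t w)"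
    and I: "\<And>j. j \<in> K \<Longrightarrow> ito_integral M F T (B j) (c j) (I j)"
    and eq: "AE w in M. \<forall>t\<in>{0..T}.
           X t w = x0 + (LINT s|lebesgue_on {0..t}. a s w) + (\<Sum>j\<in>K. I j t w)"
    unfolding ito_process_def by blast
  note mX = meas_adapted_case_prod[OF Xa] and ma = meas_adapted_case_prod[OF aa]
  obtain C where C: "\<And>t. 0 \<le> t \<Longrightarrow> t \<le> T \<Longrightarrow> (\<integral>\<^sup>+w. ennreal ((norm (X t w))\<^sup>2) \<partial>M) \<le> ennreal C"
    by (rule sup_sq_finite_bound[OF sup]) blast
  have Ir: "ito_integral M F T (B j) (\<lambda>t w. c j t w $ r) (\<lambda>t w. I j t w $ r)" if "j \<in> K" for j r
    using ito_integral_inner[OF I[OF that], of "axis r 1"] by (simp add: inner_axis norm_axis_1)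
  have Xr: "in_L2 LM (\<lambda>(t, w). X t w $ r)" for r
    using in_L2_norm_nth[OF mX] sup_sq_finite_in_L2[OF mX sup] by (simp add: case_prod_unfold)
  have ar: "in_L2 LM (\<lambda>(t, w). a t w $ r)" for r
    using in_L2_norm_nth[OF ma] a by (simp add: case_prod_unfold)
  have Xrm: "(\<lambda>w. X t w $ r) \<in> borel_measurable M" if t: "0 \<le> t" "t \<le> T" for t r
    using Xa t by (intro borel_measurable_vec_nth F_measurable[OF t]) (auto simp: meas_adapted_def)
  have arm: "(\<lambda>w. a t w $ r) \<in> borel_measurable (F t)" if t: "0 \<le> t" "t \<le> T" for t r
    using aa t by (intro borel_measurable_vec_nth) (auto simp: meas_adapted_def)
  have eqr: "AE w in M. \<forall>t\<in>{0..T}.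
           X t w $ r = x0 $ r + (LINT s|lebesgue_on {0..t}. a s w $ r) + (\<Sum>j\<in>K. I j t w $ r)" for r
    using eq ai
  proof eventually_elim
    case (elim w)
    show ?case
    proof
      fix t assume "t \<in> {0..T}"
      then show "X t w $ r = x0 $ r + (LINT s|lebesgue_on {0..t}. a s w $ r) + (\<Sum>j\<in>K. I j t w $ r)"
        using elim LINT_nth_lebesgue_on[of "\<lambda>s. a s w" t r] by simp
    qed
  qed
  define \<psi> where "\<psi> r s t w = a t w $ r * X t w $ s + a t w $ s * X t w $ r + (\<Sum>j\<in>K. c j t w $ r * c j t w $ s)" for r s t w
  have prod: "integrable M (\<lambda>w. X t w $ r * X t w $ s)"
    "expectation (\<lambda>w. X t w $ r * X t w $ s) = x0 $ r * x0 $ s + (\<integral>(u, w). indicator {..t} u * \<psi> r s u w \<partial>LM)"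
    if t: "0 \<le> t" "t \<le> T" for t r s
    unfolding \<psi>_def
    by (rule expectation_ito_product[OF K Ir Ir Xr Xr Xrm Xrm ar ar arm arm eqr eqr t]; assumption)+
  have \<psi>i: "integrable LM (case_prod (\<psi> r s))" for r s
  proof -
    have "integrable LM (\<lambda>z. (case z of (t, w) \<Rightarrow> a t w $ r) * (case z of (t, w) \<Rightarrow> X t w $ s)
      + (case z of (t, w) \<Rightarrow> a t w $ s) * (case z of (t, w) \<Rightarrow> X t w $ r)
      + (\<Sum>j\<in>K. (case z of (t, w) \<Rightarrow> c j t w $ r) * (case z of (t, w) \<Rightarrow> c j t w $ s)))"
      using K(2) ito_integrand_in_L2[OF _ Ir]
      by (intro Bochner_Integration.integrable_add Bochner_Integration.integrable_sum in_L2_mult ar Xr) auto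
    then show ?thesis by (simp add: \<psi>_def case_prod_unfold)
  qed
  have P0: "continuous_on {0..T} P" using P abs_cont_on_continuous_on by (auto simp: abs_cont_deriv_def)
  note FTC = abs_cont_deriv_FTC[OF P T_nonneg]
  have P'i: "integrable L (\<lambda>t. P' t $ r $ s)" for r s
    using integrable_bounded_linear[OF bounded_linear_vec_nth integrable_bounded_linear[OF bounded_linear_vec_nth FTC(1)]] .
  have Prs: "P t $ r $ s = P 0 $ r $ s + (LINT u|L. indicator {..t} u * P' u $ r $ s)"
    if t: "0 \<le> t" "t \<le> T" for t r s
  proof -
    have "set_integrable lebesgue {0..T} P'" using FTC(1) by (simp add: set_integrable_def integrable_restrict_space)
    then have "set_integrable lebesgue {0..t} P'" by (rule set_integrable_subset) (use t in auto)
    then have i: "integrable (lebesgue_on {0..t}) P'" by (simp add: set_integrable_def integrable_restrict_space)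
    have "(LINT u|lebesgue_on {0..t}. P' u) $ r $ s = (LINT u|lebesgue_on {0..t}. P' u $ r $ s)"
      by (simp add: integral_bounded_linear[OF bounded_linear_vec_nth i, symmetric]
        integral_bounded_linear[OF bounded_linear_vec_nth integrable_bounded_linear[OF bounded_linear_vec_nth i], symmetric])
    then show ?thesis using FTC(2)[OF t] integral_lebesgue_on_upto[OF t(2), of 0 "\<lambda>u. P' u $ r $ s"] by simp
  qed
  have Prsc: "continuous_on {0..T} (\<lambda>t. P t $ r $ s)" for r s
    using P0 by (intro continuous_intros)
  have Ym: "(\<lambda>(t, w). X t w $ s * X t w $ r) \<in> borel_measurable LM" for r s
    using in_L2_measurable[OF Xr[of r]] in_L2_measurable[OF Xr[of s]]
    by (auto simp: case_prod_unfold)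
  \<comment> \<open>A product of two components is at most the squared norm, so one constant serves
    all entries.\<close>
  have YC: "(\<integral>\<^sup>+w. ennreal \<bar>X t w $ s * X t w $ r\<bar> \<partial>M) \<le> ennreal C" if t: "0 \<le> t" "t \<le> T" for t r s
  proof -
    have "\<bar>X t w $ s * X t w $ r\<bar> \<le> (norm (X t w))\<^sup>2" for w
      unfolding abs_mult power2_eq_square by (intro mult_mono component_le_norm_cart) auto
    then have "(\<integral>\<^sup>+w. ennreal \<bar>X t w $ s * X t w $ r\<bar> \<partial>M) \<le> (\<integral>\<^sup>+w. ennreal ((norm (X t w))\<^sup>2) \<partial>M)"
      by (intro nn_integral_mono ennreal_leI)
    also have "\<dots> \<le> ennreal C" by (rule C[OF t])
    finally show ?thesis .
  qed
  define G where "G r s = (\<lambda>(t, w). P' t $ r $ s * (X t w $ s * X t w $ r) + P t $ r $ s * \<psi> s r t w)" for r s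
  note W = expectation_weighted_ito[OF P'i Prsc Prs Ym YC \<psi>i prod(2)]
  have G: "integrable LM (G r s)"
    "P T $ r $ s * expectation (\<lambda>w. X T w $ s * X T w $ r) = P 0 $ r $ s * (x0 $ s * x0 $ r) + (\<integral>z. G r s z \<partial>LM)" for r s
    unfolding G_def using W[of r s s r] by auto
  have gG: "case_prod g z = (\<Sum>r\<in>UNIV. \<Sum>s\<in>UNIV. G r s z)" for z
  proof -
    obtain t w where z: "z = (t, w)" by (cases z)
    have sw: "(\<Sum>r\<in>UNIV. \<Sum>s\<in>UNIV. \<Sum>j\<in>K. f r s j) = (\<Sum>j\<in>K. \<Sum>r\<in>UNIV. \<Sum>s\<in>UNIV. f r s j)"
      for f :: "'n \<Rightarrow> 'n \<Rightarrow> 'j \<Rightarrow> real"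
    proof -
      have "(\<Sum>r\<in>UNIV. \<Sum>s\<in>UNIV. \<Sum>j\<in>K. f r s j) = (\<Sum>r\<in>UNIV. \<Sum>j\<in>K. \<Sum>s\<in>UNIV. f r s j)"
        by (intro sum.cong refl sum.swap)
      also have "\<dots> = (\<Sum>j\<in>K. \<Sum>r\<in>UNIV. \<Sum>s\<in>UNIV. f r s j)" by (rule sum.swap)
      finally show ?thesis .
    qed
    have "(\<Sum>r\<in>UNIV. \<Sum>s\<in>UNIV. G r s z) =
      (\<Sum>r\<in>UNIV. \<Sum>s\<in>UNIV. P' t $ r $ s * (X t w $ s * X t w $ r)
        + P t $ r $ s * (X t w $ s * a t w $ r) + P t $ r $ s * (a t w $ s * X t w $ r)
        + (\<Sum>j\<in>K. P t $ r $ s * (c j t w $ s * c j t w $ r)))"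
      by (intro sum.cong refl) (simp add: z G_def \<psi>_def distrib_left sum_distrib_left mult.commute mult.left_commute)
    also have "\<dots> = g t w"
      unfolding g_def quadratic_form_nth sum.distrib sw ..
    finally show ?thesis by (simp add: z)
  qed
  then have gG': "case_prod g = (\<lambda>z. \<Sum>r\<in>UNIV. \<Sum>s\<in>UNIV. G r s z)" by auto
  show "integrable LM (case_prod g)" unfolding gG' by (intro Bochner_Integration.integrable_sum G)
  show "integrable M (\<lambda>w. (P T *v X T w) \<bullet> X T w)"
    unfolding quadratic_form_nth using prod(1)[OF T_nonneg order_refl]
    by (intro Bochner_Integration.integrable_sum integrable_mult_right) auto
  have "expectation (\<lambda>w. (P T *v X T w) \<bullet> X T w)
    = (\<Sum>r\<in>UNIV. \<Sum>s\<in>UNIV. P T $ r $ s * expectation (\<lambda>w. X T w $ s * X T w $ r))"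
    unfolding quadratic_form_nth using prod(1)[OF T_nonneg order_refl]
    by (subst Bochner_Integration.integral_sum; (intro Bochner_Integration.integrable_sum integrable_mult_right sum.cong refl)?)
      (auto intro!: sum.cong simp: Bochner_Integration.integral_sum)
  also have "\<dots> = (\<Sum>r\<in>UNIV. \<Sum>s\<in>UNIV. P 0 $ r $ s * (x0 $ s * x0 $ r)) + (\<Sum>r\<in>UNIV. \<Sum>s\<in>UNIV. \<integral>z. G r s z \<partial>LM)"
    unfolding G(2) sum.distrib ..
  also have "(\<Sum>r\<in>UNIV. \<Sum>s\<in>UNIV. \<integral>z. G r s z \<partial>LM) = (\<integral>z. case_prod g z \<partial>LM)"
    unfolding gG' using G(1) by (simp add: Bochner_Integration.integral_sum)
  finally show "expectation (\<lambda>w. (P T *v X T w) \<bullet> X T w) = (P 0 *v x0) \<bullet> x0 + (\<integral>z. case_prod g z \<partial>LM)"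
    unfolding quadratic_form_nth .
qed

end

section \<open>Square integrability of the decentralized strategies\<close>

lemma power2_norm_vec: "(norm x)\<^sup>2 = (\<Sum>i\<in>UNIV. (norm (x $ i))\<^sup>2)"
  by (simp add: norm_vec_def L2_set_def sum_nonneg)

text \<open>The norm of a matrix, taken as a vector of rows, is the Frobenius norm; Cauchy-Schwarz
  is applied to each row.\<close>

lemma norm_matrix_vector_mult_le: "norm (A *v x) \<le> norm A * norm x" for A :: "real^'m^'n"
proof (rule power2_le_imp_le)
  have "(norm (A *v x))\<^sup>2 = (\<Sum>i\<in>UNIV. (A $ i \<bullet> x)\<^sup>2)"
    by (simp add: power2_norm_vec matrix_vector_mul_component)
  also have "\<dots> \<le> (\<Sum>i\<in>UNIV. (norm (A $ i))\<^sup>2 * (norm x)\<^sup>2)"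
  proof (rule sum_mono)
    fix i
    have "(\<bar>A $ i \<bullet> x\<bar>)\<^sup>2 \<le> (norm (A $ i) * norm x)\<^sup>2"
      by (rule power_mono[OF Cauchy_Schwarz_ineq2]) simp
    then show "(A $ i \<bullet> x)\<^sup>2 \<le> (norm (A $ i))\<^sup>2 * (norm x)\<^sup>2" by (simp add: power_mult_distrib)
  qed
  also have "\<dots> = (norm A * norm x)\<^sup>2"
    by (simp add: power_mult_distrib power2_norm_vec[of A] sum_distrib_right)
  finally show "(norm (A *v x))\<^sup>2 \<le> (norm A * norm x)\<^sup>2" .
qed simp

lemma norm_transpose: "norm (transpose A) = norm A" for A :: "real^'m^'n"
proof -
  have "(norm (transpose A))\<^sup>2 = (norm A)\<^sup>2"
    unfolding power2_norm_vec transpose_def by (simp, rule sum.swap)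
  then show ?thesis by (simp add: power2_eq_iff_nonneg)
qed

text \<open>A row of the product is the transpose of \<open>B\<close> applied to a row of
  \<open>A\<close>, which reduces the claim to the matrix-vector estimate.\<close>

lemma norm_matrix_matrix_mult_le: "norm (A ** B) \<le> norm A * norm B" for A :: "real^'m^'n" and B :: "real^'k^'m"
proof (rule power2_le_imp_le)
  have row: "(A ** B) $ i = transpose B *v (A $ i)" for i
    by (simp add: vec_eq_iff matrix_matrix_mult_def matrix_vector_mult_def transpose_def mult.commute)
  have "(norm (A ** B))\<^sup>2 = (\<Sum>i\<in>UNIV. (norm (transpose B *v (A $ i)))\<^sup>2)"
    unfolding power2_norm_vec[of "A ** B"] row ..
  also have "\<dots> \<le> (\<Sum>i\<in>UNIV. (norm B)\<^sup>2 * (norm (A $ i))\<^sup>2)"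
  proof (rule sum_mono)
    fix i
    have "(norm (transpose B *v (A $ i)))\<^sup>2 \<le> (norm B * norm (A $ i))\<^sup>2"
      by (rule power_mono[OF norm_matrix_vector_mult_le[of "transpose B", unfolded norm_transpose]]) simp
    then show "(norm (transpose B *v (A $ i)))\<^sup>2 \<le> (norm B)\<^sup>2 * (norm (A $ i))\<^sup>2" by (simp add: power_mult_distrib)
  qed
  also have "\<dots> = (norm A * norm B)\<^sup>2"
    by (simp add: power_mult_distrib power2_norm_vec[of A] sum_distrib_left mult.commute)
  finally show "(norm (A ** B))\<^sup>2 \<le> (norm A * norm B)\<^sup>2" .
qed simp

text \<open>Cauchy-Schwarz turns coercivity into l |v| \<le> |A v|, so \<open>A\<close> is
  injective, hence invertible, and the same estimate applied to the preimage of \<open>h\<close>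
  bounds the inverse. Only the quadratic form enters, which suits \<open>R_Sigma\<close>, of which
  merely the symmetric part is controlled.\<close>

lemma norm_matrix_inv_le:
  fixes A :: "real^'n^'n"
  assumes l: "0 < l" and A: "\<And>v. l * (v \<bullet> v) \<le> v \<bullet> (A *v v)"
  shows "norm (matrix_inv A *v h) \<le> norm h / l"
proof -
  have le: "l * norm v \<le> norm (A *v v)" for v
  proof (cases "v = 0")
    case False
    have "l * norm v * norm v \<le> norm v * norm (A *v v)"
      using A[of v] norm_cauchy_schwarz[of v "A *v v"] by (simp add: power2_norm_eq_inner[symmetric] power2_eq_square mult.assoc)
    then show ?thesis using False by (simp add: mult.commute)
  qed simp
  have "inj ((*v) A)"
  proof (rule injI)
    fix x y assume "A *v x = A *v y"
    then have "A *v (x - y) = 0" by (simp add: matrix_vector_mult_diff_distrib)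
    then have "l * norm (x - y) \<le> 0" using le[of "x - y"] by simp
    then have "norm (x - y) \<le> 0" using l by (simp add: mult_le_0_iff)
    then show "x = y" by simp
  qed
  then have "invertible A" by (simp add: invertible_left_inverse matrix_left_invertible_injective)
  then have "A ** matrix_inv A = mat 1"
    unfolding matrix_inv_def invertible_def by (metis (mono_tags, lifting) someI_ex)
  then have "A *v (matrix_inv A *v h) = h" by (simp add: matrix_vector_mul_assoc)
  then have "l * norm (matrix_inv A *v h) \<le> norm h" using le[of "matrix_inv A *v h"] by simp
  then show ?thesis using l by (simp add: field_simps)
qed

text \<open>Bounds without measurability: the feedback gains are only estimated in norm, as
  measurability of the strategy is part of \<open>decentralized_strategy\<close>. Requiring C \<ge>
  0 lets bounds be multiplied.\<close>

definition ae_bounded :: "real \<Rightarrow> (real \<Rightarrow> 'a::real_normed_vector) \<Rightarrow> bool" where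
  "ae_bounded T f \<longleftrightarrow> (\<exists>C\<ge>0. AE t in lebesgue_on {0..T}. norm (f t) \<le> C)"

lemma ae_boundedI: "AE t in lebesgue_on {0..T}. norm (f t) \<le> C \<Longrightarrow> ae_bounded T f"
  unfolding ae_bounded_def by (rule exI[of _ "max 0 C"]) (auto elim!: eventually_mono)

lemma ae_boundedE:
  assumes "ae_bounded T f"
  obtains C where "0 \<le> C" "AE t in lebesgue_on {0..T}. norm (f t) \<le> C"
  using assms by (auto simp: ae_bounded_def)

lemma Linf_ae_bounded: "Linf T f \<Longrightarrow> ae_bounded T f"
  by (auto simp: Linf_def intro: ae_boundedI)

lemma continuous_ae_bounded:
  assumes "continuous_on {0..T} f" shows "ae_bounded T f"
proof -
  obtain C where "\<And>t. t \<in> {0..T} \<Longrightarrow> norm (f t) \<le> C"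
    using compact_imp_bounded[OF compact_continuous_image[OF assms compact_Icc]]
    unfolding bounded_iff by (metis imageI)
  then show ?thesis by (intro ae_boundedI[where C=C] AE_I2) auto
qed

lemma ae_bounded_add: 
  assumes "ae_bounded T f" "ae_bounded T g" shows "ae_bounded T (\<lambda>t. f t + g t)"
proof -
  from assms obtain C D where "AE t in lebesgue_on {0..T}. norm (f t) \<le> C" "AE t in lebesgue_on {0..T}. norm (g t) \<le> D"
    by (auto simp: ae_bounded_def)
  then have "AE t in lebesgue_on {0..T}. norm (f t + g t) \<le> C + D"
    by eventually_elim (rule order_trans[OF norm_triangle_ineq add_mono])
  then show ?thesis by (rule ae_boundedI)
qed

lemma ae_bounded_scaleR: "ae_bounded T f \<Longrightarrow> ae_bounded T (\<lambda>t. k *\<^sub>R f t)"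
proof -
  assume "ae_bounded T f"
  then obtain C where "AE t in lebesgue_on {0..T}. norm (f t) \<le> C" by (auto simp: ae_bounded_def)
  then have "AE t in lebesgue_on {0..T}. norm (k *\<^sub>R f t) \<le> \<bar>k\<bar> * C"
    by eventually_elim (auto intro: mult_left_mono)
  then show ?thesis by (rule ae_boundedI)
qed

lemma ae_bounded_transpose: "ae_bounded T f \<Longrightarrow> ae_bounded T (\<lambda>t. transpose (f t :: real^'m^'n))"
  by (simp add: ae_bounded_def norm_transpose)

lemma ae_bounded_mult:
  fixes f :: "real \<Rightarrow> real^'m^'n" and g :: "real \<Rightarrow> real^'k^'m"
  assumes "ae_bounded T f" "ae_bounded T g" shows "ae_bounded T (\<lambda>t. f t ** g t)"
proof -
  from assms obtain C D where CD: "0 \<le> C" "AE t in lebesgue_on {0..T}. norm (f t) \<le> C" "AE t in lebesgue_on {0..T}. norm (g t) \<le> D"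
    by (auto simp: ae_bounded_def)
  have "AE t in lebesgue_on {0..T}. norm (f t ** g t) \<le> C * D"
    using CD(2,3) by eventually_elim
      (rule order_trans[OF norm_matrix_matrix_mult_le mult_mono], use CD(1) in auto)
  then show ?thesis by (rule ae_boundedI)
qed

lemma ae_bounded_mult_vec:
  fixes f :: "real \<Rightarrow> real^'m^'n" and g :: "real \<Rightarrow> real^'m"
  assumes "ae_bounded T f" "ae_bounded T g" shows "ae_bounded T (\<lambda>t. f t *v g t)"
proof -
  from assms obtain C D where CD: "0 \<le> C" "AE t in lebesgue_on {0..T}. norm (f t) \<le> C" "AE t in lebesgue_on {0..T}. norm (g t) \<le> D"
    by (auto simp: ae_bounded_def)
  have "AE t in lebesgue_on {0..T}. norm (f t *v g t) \<le> C * D"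
    using CD(2,3) by eventually_elim
      (rule order_trans[OF norm_matrix_vector_mult_le mult_mono], use CD(1) in auto)
  then show ?thesis by (rule ae_boundedI)
qed

lemmas ae_bounded_intros = ae_bounded_add ae_bounded_scaleR ae_bounded_transpose ae_bounded_mult ae_bounded_mult_vec

lemma unif_pd_coercive:
  assumes "unif_pd T M"
  obtains l where "0 < l" "AE t in lebesgue_on {0..T}. \<forall>v. l * (v \<bullet> v) \<le> v \<bullet> (M t *v v)"
proof -
  from assms obtain l where l: "0 < l" "AE t in lebesgue_on {0..T}. psd (M t - l *\<^sub>R mat 1)"
    by (auto simp: unif_pd_def)
  from l(2) have "AE t in lebesgue_on {0..T}. \<forall>v. l * (v \<bullet> v) \<le> v \<bullet> (M t *v v)"
    by eventually_elim
      (auto simp: psd_def matrix_vector_mult_diff_rdistrib inner_diff_right scaleR_matrix_vector_assoc[symmetric])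
  with l(1) show ?thesis by (rule that)
qed

lemma unif_pd_inv_bound:
  assumes "unif_pd T M"
  obtains K where "0 \<le> K" "AE t in lebesgue_on {0..T}. \<forall>h. norm (matrix_inv (M t) *v h) \<le> K * norm h"
proof (rule unif_pd_coercive[OF assms])
  fix l assume l: "0 < l" "AE t in lebesgue_on {0..T}. \<forall>v. l * (v \<bullet> v) \<le> v \<bullet> (M t *v v)"
  from l(2) have "AE t in lebesgue_on {0..T}. \<forall>h. norm (matrix_inv (M t) *v h) \<le> (1 / l) * norm h"
    by eventually_elim (use norm_matrix_inv_le[OF l(1)] in auto)
  then show ?thesis using l(1) by (intro that[of "1 / l"]) auto
qed

text \<open>A matrix and its transpose have the same quadratic form, so coercivity of their sum with
  constant \<open>l\<close> is coercivity of \<open>M\<close> with constant \<open>l / 2\<close>,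
  whence the bound \<open>2 / l\<close>.\<close>

lemma unif_pd_symmetrized_inv_bound:
  fixes M :: "real \<Rightarrow> real^'n^'n"
  assumes "unif_pd T (\<lambda>t. M t + transpose (M t))"
  obtains K where "0 \<le> K" "AE t in lebesgue_on {0..T}. \<forall>h. norm (matrix_inv (M t) *v h) \<le> K * norm h"
proof (rule unif_pd_coercive[OF assms])
  fix l assume l: "0 < l" "AE t in lebesgue_on {0..T}. \<forall>v. l * (v \<bullet> v) \<le> v \<bullet> ((M t + transpose (M t)) *v v)"
  have tr: "v \<bullet> (transpose A *v v) = v \<bullet> (A *v v)" for A :: "real^'n^'n" and v
    by (metis dot_lmul_matrix inner_commute transpose_matrix_vector)
  from l(2) have "AE t in lebesgue_on {0..T}. \<forall>h. norm (matrix_inv (M t) *v h) \<le> (2 / l) * norm h"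
  proof eventually_elim
    case (elim t)
    have "(l / 2) * (v \<bullet> v) \<le> v \<bullet> (M t *v v)" for v
      using elim[rule_format, of v, unfolded matrix_vector_mult_add_rdistrib inner_add_right tr] by simp
    from norm_matrix_inv_le[OF _ this] l(1) show ?case by (simp add: mult.commute)
  qed
  then show ?thesis using l(1) by (intro that[of "2 / l"]) auto
qed

text \<open>Conditional Jensen for the square in each coordinate; the squared Euclidean norm is the
  sum of the squared coordinates.\<close>

lemma (in prob_space) cond_exp_vec_L2:
  fixes X :: "'a \<Rightarrow> real^'n"
  assumes G: "subalgebra M G" and X: "X \<in> borel_measurable M"
    and fin: "(\<integral>\<^sup>+w. ennreal ((norm (X w))\<^sup>2) \<partial>M) < \<infinity>"
  shows "cond_exp_vec M G X \<in> borel_measurable M"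
    and "(\<integral>\<^sup>+w. ennreal ((norm (cond_exp_vec M G X w))\<^sup>2) \<partial>M) \<le> (\<integral>\<^sup>+w. ennreal ((norm (X w))\<^sup>2) \<partial>M)"
proof -
  interpret finite_measure_subalgebra M G by unfold_locales (rule G)
  have norm_sum: "ennreal ((norm x)\<^sup>2) = (\<Sum>r\<in>UNIV. ennreal ((x $ r)\<^sup>2))" for x :: "real^'n"
    by (simp add: power2_norm_vec)
  have "in_L2 M (\<lambda>w. norm (X w))" using X fin by (simp add: in_L2_iff_nn)
  from in_L2_norm_nth[OF X this] have sq: "in_L2 M (\<lambda>w. X w $ r)" for r .
  have m [measurable]: "real_cond_exp M G (\<lambda>w. X w $ r) \<in> borel_measurable M" for r
    by (rule borel_measurable_cond_exp2)
  have [measurable]: "(\<lambda>w. X w $ r) \<in> borel_measurable M" for r using sq by (simp add: in_L2_def)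
  show "cond_exp_vec M G X \<in> borel_measurable M"
    unfolding cond_exp_vec_def[abs_def]
    by (rule borel_measurable_euclidean_space[THEN iffD2]) (auto simp: Basis_vec_def inner_axis)
  have le: "(\<integral>\<^sup>+w. ennreal ((real_cond_exp M G (\<lambda>w. X w $ r) w)\<^sup>2) \<partial>M) \<le> (\<integral>\<^sup>+w. ennreal ((X w $ r)\<^sup>2) \<partial>M)" for r
  proof -
    have i: "integrable M (\<lambda>w. X w $ r)" "integrable M (\<lambda>w. (X w $ r)\<^sup>2)"
      using in_L2_integrable[OF sq] sq by (auto simp: in_L2_def)
    have "convex_on UNIV (\<lambda>x::real. x\<^sup>2)" by (rule convex_power2)
    from real_cond_exp_jensens_inequality(2)[OF i(1) _ _ i(2) this]
    have j: "AE w in M. (real_cond_exp M G (\<lambda>w. X w $ r) w)\<^sup>2 \<le> real_cond_exp M G (\<lambda>w. (X w $ r)\<^sup>2) w"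
      by simp
    have "(\<integral>\<^sup>+w. ennreal ((real_cond_exp M G (\<lambda>w. X w $ r) w)\<^sup>2) \<partial>M)
      \<le> (\<integral>\<^sup>+w. ennreal (real_cond_exp M G (\<lambda>w. (X w $ r)\<^sup>2) w) \<partial>M)"
      using j by (intro nn_integral_mono_AE) (auto elim!: eventually_mono intro: ennreal_leI)
    also have "\<dots> = ennreal (\<integral>w. real_cond_exp M G (\<lambda>w. (X w $ r)\<^sup>2) w \<partial>M)"
      using real_cond_exp_int(1)[OF i(2)] j
      by (intro nn_integral_eq_integral) (auto elim!: eventually_mono intro: order_trans[OF zero_le_power2])
    also have "\<dots> = ennreal (\<integral>w. (X w $ r)\<^sup>2 \<partial>M)" using real_cond_exp_int(2)[OF i(2)] by simp
    also have "\<dots> = (\<integral>\<^sup>+w. ennreal ((X w $ r)\<^sup>2) \<partial>M)" using i(2) by (intro nn_integral_eq_integral[symmetric]) auto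
    finally show ?thesis .
  qed
  have "(\<integral>\<^sup>+w. ennreal ((norm (cond_exp_vec M G X w))\<^sup>2) \<partial>M)
    = (\<Sum>r\<in>UNIV. \<integral>\<^sup>+w. ennreal ((real_cond_exp M G (\<lambda>w. X w $ r) w)\<^sup>2) \<partial>M)"
    unfolding norm_sum cond_exp_vec_def by (subst nn_integral_sum) auto
  also have "\<dots> \<le> (\<Sum>r\<in>UNIV. \<integral>\<^sup>+w. ennreal ((X w $ r)\<^sup>2) \<partial>M)" by (intro sum_mono le)
  also have "\<dots> = (\<integral>\<^sup>+w. ennreal ((norm (X w))\<^sup>2) \<partial>M)"
    unfolding norm_sum by (subst nn_integral_sum) auto
  finally show "(\<integral>\<^sup>+w. ennreal ((norm (cond_exp_vec M G X w))\<^sup>2) \<partial>M) \<le> (\<integral>\<^sup>+w. ennreal ((norm (X w))\<^sup>2) \<partial>M)" .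
qed

lemma subalgebra_obs_filt:
  assumes "\<And>k s. k \<in> K \<Longrightarrow> 0 \<le> s \<Longrightarrow> s \<le> t \<Longrightarrow> Y k s \<in> borel_measurable M"
    and "\<And>s. 0 \<le> s \<Longrightarrow> s \<le> t \<Longrightarrow> \<theta> s \<in> borel_measurable M"
  shows "subalgebra M (obs_filt M K Y \<theta> t)"
proof -
  let ?G = "{Y k s -` A \<inter> space M | k s A. k \<in> K \<and> s \<in> {0..t} \<and> A \<in> sets borel} \<union>
      {\<theta> s -` A \<inter> space M | s A. s \<in> {0..t} \<and> A \<in> sets borel} \<union> null_sets M"
  have G: "?G \<subseteq> sets M" using assms by (auto intro: measurable_sets)
  then have "?G \<subseteq> Pow (space M)" using sets.space_closed by blast
  then show ?thesis
    unfolding subalgebra_def obs_filt_def using sets.sigma_sets_subset[OF G] by (simp add: space_measure_of_conv)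
qed

context brownian_setting
begin

lemma meas_adapted_measurable:
  "meas_adapted M F T X \<Longrightarrow> 0 \<le> t \<Longrightarrow> t \<le> T \<Longrightarrow> X t \<in> borel_measurable M"
  by (rule F_measurable) (auto simp: meas_adapted_def)

lemma in_L2_feedback:
  fixes U :: "real \<Rightarrow> 'w \<Rightarrow> real^'m" and V W :: "real \<Rightarrow> 'w \<Rightarrow> real^'n"
  assumes U: "case_prod U \<in> borel_measurable LM"
    and V: "\<And>t. 0 \<le> t \<Longrightarrow> t \<le> T \<Longrightarrow> V t \<in> borel_measurable M"
      "\<And>t. 0 \<le> t \<Longrightarrow> t \<le> T \<Longrightarrow> (\<integral>\<^sup>+w. ennreal ((norm (V t w))\<^sup>2) \<partial>M) \<le> ennreal CV"
    and W: "\<And>t. 0 \<le> t \<Longrightarrow> t \<le> T \<Longrightarrow> W t \<in> borel_measurable M"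
      "\<And>t. 0 \<le> t \<Longrightarrow> t \<le> T \<Longrightarrow> (\<integral>\<^sup>+w. ennreal ((norm (W t w))\<^sup>2) \<partial>M) \<le> ennreal CW"
    and C0: "0 \<le> CV" "0 \<le> CW" "0 \<le> K"
    and le: "AE t in L. AE w in M. norm (U t w) \<le> K * (norm (V t w) + norm (W t w) + 1)"
  shows "in_L2 LM (\<lambda>(t, w). norm (U t w))"
proof (rule in_L2_LM_of_bound[OF U, of "3 * K\<^sup>2 * (CV + CW + 1)"])
  \<comment> \<open>Cauchy-Schwarz for three summands, the origin of the factor 3: the two sides
    differ by (x - y)^2 + (x - 1)^2 + (y - 1)^2.\<close>
  have sq: "(x + y + 1)\<^sup>2 \<le> 3 * (x\<^sup>2 + y\<^sup>2 + 1)" for x y :: real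
    using sum_squares_ge_zero[of "x - y" "x - 1"] zero_le_power2[of "y - 1"]
    by (simp add: power2_eq_square algebra_simps)
  show "AE t in L. (\<integral>\<^sup>+w. ennreal ((norm (U t w))\<^sup>2) \<partial>M) \<le> ennreal (3 * K\<^sup>2 * (CV + CW + 1))"
    using le AE_space
  proof eventually_elim
    case (elim t)
    then have t: "0 \<le> t" "t \<le> T" by auto
    note [measurable] = V(1)[OF t] W(1)[OF t]
    have "(\<integral>\<^sup>+w. ennreal ((norm (U t w))\<^sup>2) \<partial>M)
      \<le> (\<integral>\<^sup>+w. ennreal (3 * K\<^sup>2) * (ennreal ((norm (V t w))\<^sup>2) + ennreal ((norm (W t w))\<^sup>2) + 1) \<partial>M)"
    proof (rule nn_integral_mono_AE)
      show "AE w in M. ennreal ((norm (U t w))\<^sup>2)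
        \<le> ennreal (3 * K\<^sup>2) * (ennreal ((norm (V t w))\<^sup>2) + ennreal ((norm (W t w))\<^sup>2) + 1)"
        using elim(1)
      proof eventually_elim
        case (elim w)
        have "(norm (U t w))\<^sup>2 \<le> (K * (norm (V t w) + norm (W t w) + 1))\<^sup>2"
          by (rule power_mono[OF elim]) simp
        also have "\<dots> = K\<^sup>2 * (norm (V t w) + norm (W t w) + 1)\<^sup>2" by (simp add: power_mult_distrib)
        also have "\<dots> \<le> K\<^sup>2 * (3 * ((norm (V t w))\<^sup>2 + (norm (W t w))\<^sup>2 + 1))"
          by (intro mult_left_mono sq) simp
        finally have "(norm (U t w))\<^sup>2 \<le> (3 * K\<^sup>2) * ((norm (V t w))\<^sup>2 + (norm (W t w))\<^sup>2 + 1)"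
          by (simp add: algebra_simps)
        then have "ennreal ((norm (U t w))\<^sup>2) \<le> ennreal ((3 * K\<^sup>2) * ((norm (V t w))\<^sup>2 + (norm (W t w))\<^sup>2 + 1))"
          by (rule ennreal_leI)
        then show ?case by (simp add: ennreal_mult ennreal_plus)
      qed
    qed
    also have "\<dots> = ennreal (3 * K\<^sup>2) * ((\<integral>\<^sup>+w. ennreal ((norm (V t w))\<^sup>2) \<partial>M) + (\<integral>\<^sup>+w. ennreal ((norm (W t w))\<^sup>2) \<partial>M) + 1)"
      by (simp add: nn_integral_cmult nn_integral_add emeasure_space_1)
    also have "\<dots> \<le> ennreal (3 * K\<^sup>2) * (ennreal CV + ennreal CW + 1)"
      using V(2)[OF t] W(2)[OF t] by (intro mult_left_mono add_mono) auto
    also have "\<dots> = ennreal (3 * K\<^sup>2 * (CV + CW + 1))"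
      using C0 by (simp add: ennreal_mult ennreal_plus)
    finally show ?case .
  qed
qed

end

text \<open>The feedback relation bounds the strategy linearly by the filtered state and by
  \<open>x0\<close>, with gains that are essentially bounded through the coercivity of
  \<open>R_Pi\<close> and of the symmetric part of \<open>R_Sigma\<close>. The self-reference of
  \<open>ub\<close> is harmless: \<open>Xb j\<close> has bounded second moments as a member of the
  solution space, and conditioning does not increase them.\<close>

lemma decentralized_strategy_in_L2:
  fixes B :: "'d::finite noise \<Rightarrow> real \<Rightarrow> 'w \<Rightarrow> real"
    and c :: "('n::finite, 'm::finite, 'd) lq_data"
  assumes bs: "brownian_setting M F T J B"
    and H: "H1 T c" "H2 T c" and \<pi>: "Pi_solution T c \<pi>" and \<Sigma>: "Sigma_solution T c \<Sigma>"
    and \<rho>: "rho_solution T c \<Sigma> \<rho>"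
    and \<theta>: "theta_eq M F T B c \<theta>" and x0: "x_zero_eq M F T B c \<Sigma> \<rho> x x0"
    and ds: "decentralized_strategy M F T B c x \<theta> \<pi> \<Sigma> \<rho> x0 j Xb Yb ub"
  shows "in_L2 (lebesgue_on {0..T} \<Otimes>\<^sub>M M) (\<lambda>(t, w). norm (ub j t w))"
proof -
  interpret brownian_setting M F T J B by (rule bs)
  have Xb: "meas_adapted M F T (Xb j)" "sup_sq_finite M T (Xb j)" and Yb: "meas_adapted M F T (Yb j)"
    and ubm: "meas_adapted M F T (ub j)"
    and fb: "AE t in L. AE w in M.
        ub j t w =
          - (matrix_inv (R_Pi c \<pi> t) *v (transpose (Pi_tilde c \<pi> t) *v
               (cond_exp_vec M (obs_filt M {j} Yb \<theta> t) (Xb j t) w - x0 t w)))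
          - matrix_inv (R_Sigma c \<Sigma> t) *v (Sigma_barT c \<Sigma> t *v x0 t w + rho_tilde c \<Sigma> \<rho> t)"
    using ds unfolding decentralized_strategy_def Let_def ito_process_def by blast+
  have x0: "meas_adapted M F T x0" "sup_sq_finite M T x0"
    using x0 unfolding x_zero_eq_def ito_process_def by blast+
  have \<theta>: "meas_adapted M F T \<theta>" using \<theta> unfolding theta_eq_def ito_process_def by blast
  have bd: "ae_bounded T (Bc c)" "ae_bounded T (Dc c)" "ae_bounded T (Dbar c)" "ae_bounded T (Fc c)" "ae_bounded T (bbar c)"
      "ae_bounded T (Sc c)" "ae_bounded T (rc c)"
    using H unfolding H1_def H2_def by (blast intro: Linf_ae_bounded)+
  have cb: "ae_bounded T \<pi>" "ae_bounded T \<Sigma>" "ae_bounded T \<rho>"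
    using \<pi> \<Sigma> \<rho> abs_cont_on_continuous_on
    unfolding Pi_solution_def Sigma_solution_def rho_solution_def abs_cont_deriv_def
    by (blast intro: continuous_ae_bounded)+
  obtain K1 where K1: "0 \<le> K1" "AE t in L. \<forall>h. norm (matrix_inv (R_Pi c \<pi> t) *v h) \<le> K1 * norm h"
    using \<pi> unfolding Pi_solution_def by (blast elim: unif_pd_inv_bound)
  obtain K2 where K2: "0 \<le> K2" "AE t in L. \<forall>h. norm (matrix_inv (R_Sigma c \<Sigma> t) *v h) \<le> K2 * norm h"
    using \<Sigma> unfolding Sigma_solution_def by (blast elim: unif_pd_symmetrized_inv_bound)
  have "ae_bounded T (\<lambda>t. transpose (Pi_tilde c \<pi> t))"
    unfolding Pi_tilde_def by (intro ae_bounded_intros bd cb)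
  then obtain C1 where C1: "0 \<le> C1" "AE t in L. norm (transpose (Pi_tilde c \<pi> t)) \<le> C1" by (rule ae_boundedE)
  have "ae_bounded T (Sigma_barT c \<Sigma>)"
    unfolding Sigma_barT_def[abs_def] by (intro ae_bounded_intros bd cb)
  then obtain C2 where C2: "0 \<le> C2" "AE t in L. norm (Sigma_barT c \<Sigma> t) \<le> C2" by (rule ae_boundedE)
  have "ae_bounded T (rho_tilde c \<Sigma> \<rho>)"
    unfolding rho_tilde_def[abs_def] by (intro ae_bounded_intros bd cb)
  then obtain C3 where C3: "0 \<le> C3" "AE t in L. norm (rho_tilde c \<Sigma> \<rho> t) \<le> C3" by (rule ae_boundedE)
  define V where "V t = cond_exp_vec M (obs_filt M {j} Yb \<theta> t) (Xb j t)" for t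
  obtain CV where CV: "0 \<le> CV" "\<And>t. 0 \<le> t \<Longrightarrow> t \<le> T \<Longrightarrow> (\<integral>\<^sup>+w. ennreal ((norm (Xb j t w))\<^sup>2) \<partial>M) \<le> ennreal CV"
    by (rule sup_sq_finite_bound[OF Xb(2)]) blast
  obtain CW where CW: "0 \<le> CW" "\<And>t. 0 \<le> t \<Longrightarrow> t \<le> T \<Longrightarrow> (\<integral>\<^sup>+w. ennreal ((norm (x0 t w))\<^sup>2) \<partial>M) \<le> ennreal CW"
    by (rule sup_sq_finite_bound[OF x0(2)]) blast
  have V: "V t \<in> borel_measurable M" "(\<integral>\<^sup>+w. ennreal ((norm (V t w))\<^sup>2) \<partial>M) \<le> ennreal CV" if t: "0 \<le> t" "t \<le> T" for t
  proof -
    have G: "subalgebra M (obs_filt M {j} Yb \<theta> t)"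
      using t by (intro subalgebra_obs_filt meas_adapted_measurable[OF \<theta>]) (auto intro: meas_adapted_measurable[OF Yb])
    have fin: "(\<integral>\<^sup>+w. ennreal ((norm (Xb j t w))\<^sup>2) \<partial>M) < \<infinity>"
      using CV(2)[OF t] by (rule le_less_trans) simp
    note ce = cond_exp_vec_L2[OF G meas_adapted_measurable[OF Xb(1) t] fin]
    show "V t \<in> borel_measurable M" unfolding V_def by (rule ce(1))
    show "(\<integral>\<^sup>+w. ennreal ((norm (V t w))\<^sup>2) \<partial>M) \<le> ennreal CV"
      unfolding V_def using ce(2) CV(2)[OF t] by (rule order_trans)
  qed
  \<comment> \<open>The first product bounds the gain of the filter term. In the second,
    \<open>C2\<close> belongs to \<open>x0\<close> and \<open>C3\<close> to the inhomogeneous term,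
    which the summand 1 of the linear bound absorbs.\<close>
  define K where "K = K1 * C1 + K2 * (C2 + C3)"
  show ?thesis
  proof (rule in_L2_feedback[where V=V and W=x0 and K=K and CV=CV and CW=CW])
    show "case_prod (ub j) \<in> borel_measurable LM" by (rule meas_adapted_case_prod[OF ubm])
    show "AE t in L. AE w in M. norm (ub j t w) \<le> K * (norm (V t w) + norm (x0 t w) + 1)"
      using fb K1(2) K2(2) C1(2) C2(2) C3(2)
    proof eventually_elim
      case (elim t)
      from elim(1) show ?case
      proof eventually_elim
        case (elim w)
        let ?v = "V t w - x0 t w"
        let ?n = "norm (V t w) + norm (x0 t w) + 1"
        have n: "norm ?v \<le> ?n" "norm (x0 t w) \<le> ?n" "1 \<le> ?n" using norm_triangle_ineq4[of "V t w" "x0 t w"] by auto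
        have 1: "norm (matrix_inv (R_Pi c \<pi> t) *v (transpose (Pi_tilde c \<pi> t) *v ?v)) \<le> K1 * (C1 * ?n)"
        proof -
          have "norm (transpose (Pi_tilde c \<pi> t) *v ?v) \<le> C1 * ?n"
            using norm_matrix_vector_mult_le mult_mono[OF \<open>norm (transpose (Pi_tilde c \<pi> t)) \<le> C1\<close> n(1) C1(1) norm_ge_zero]
            by (rule order_trans)
          then have "K1 * norm (transpose (Pi_tilde c \<pi> t) *v ?v) \<le> K1 * (C1 * ?n)" using K1(1) by (rule mult_left_mono)
          then show ?thesis
            using \<open>\<forall>h. norm (matrix_inv (R_Pi c \<pi> t) *v h) \<le> K1 * norm h\<close> order_trans by blast
        qed
        have 2: "norm (matrix_inv (R_Sigma c \<Sigma> t) *v (Sigma_barT c \<Sigma> t *v x0 t w + rho_tilde c \<Sigma> \<rho> t)) \<le> K2 * ((C2 + C3) * ?n)"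
        proof -
          have "norm (Sigma_barT c \<Sigma> t *v x0 t w) \<le> C2 * ?n"
            using norm_matrix_vector_mult_le mult_mono[OF \<open>norm (Sigma_barT c \<Sigma> t) \<le> C2\<close> n(2) C2(1) norm_ge_zero]
            by (rule order_trans)
          moreover have "norm (rho_tilde c \<Sigma> \<rho> t) \<le> C3 * ?n"
            using \<open>norm (rho_tilde c \<Sigma> \<rho> t) \<le> C3\<close> mult_left_mono[OF n(3) C3(1)] by simp
          ultimately have "norm (Sigma_barT c \<Sigma> t *v x0 t w + rho_tilde c \<Sigma> \<rho> t) \<le> (C2 + C3) * ?n"
            using norm_triangle_ineq[of "Sigma_barT c \<Sigma> t *v x0 t w" "rho_tilde c \<Sigma> \<rho> t"] by (simp only: distrib_right)
          then have "K2 * norm (Sigma_barT c \<Sigma> t *v x0 t w + rho_tilde c \<Sigma> \<rho> t) \<le> K2 * ((C2 + C3) * ?n)" using K2(1) by (rule mult_left_mono)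
          then show ?thesis
            using \<open>\<forall>h. norm (matrix_inv (R_Sigma c \<Sigma> t) *v h) \<le> K2 * norm h\<close> order_trans by blast
        qed
        have "norm (ub j t w) \<le> K1 * (C1 * ?n) + K2 * ((C2 + C3) * ?n)"
          unfolding elim V_def[symmetric]
          by (rule order_trans[OF norm_triangle_ineq4]) (use 1 2 in \<open>simp only: norm_minus_cancel add_mono\<close>)
        also have "\<dots> = K * ?n" unfolding K_def by (simp only: distrib_right mult.assoc)
        finally show ?case .
      qed
    qed
  qed (use V CV CW meas_adapted_measurable[OF x0(1)] K1(1) K2(1) C1(1) C2(1) C3(1) in \<open>auto simp: K_def\<close>)
qed

section \<open>The two cost functionals\<close>

lemma inner_transpose_left: "(transpose A *v y) \<bullet> x = y \<bullet> (A *v x)" for A :: "real^'m^'n"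
  by (metis dot_lmul_matrix transpose_matrix_vector)

lemma inner_symmetric_matrix: "transpose A = A \<Longrightarrow> (A *v x) \<bullet> y = (A *v y) \<bullet> x" for A :: "real^'n^'n"
  by (metis inner_commute inner_transpose_left)

text \<open>Each component of an idiosyncratic Brownian motion contributes the quadratic form of one
  column to Ito's formula; together they form the trace terms of \<open>MP_tilde\<close>.\<close>

lemma trace_transpose_mult_mult:
  fixes A :: "real^'n^'n" and s :: "real^'d^'n"
  shows "trace (transpose s ** A ** s) = (\<Sum>e\<in>UNIV. (A *v column e s) \<bullet> column e s)"
  unfolding trace_def
proof (rule sum.cong[OF refl])
  fix e
  have "(transpose s ** A ** s) $ e $ e = (\<Sum>k\<in>UNIV. \<Sum>l\<in>UNIV. A $ l $ k * s $ k $ e * s $ l $ e)"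
    by (simp add: matrix_matrix_mult_def transpose_def sum_distrib_right sum_distrib_left mult_ac)
  also have "\<dots> = (\<Sum>l\<in>UNIV. \<Sum>k\<in>UNIV. A $ l $ k * s $ k $ e * s $ l $ e)" by (rule sum.swap)
  also have "\<dots> = (A *v column e s) \<bullet> column e s"
    by (simp add: inner_vec_def matrix_vector_mult_def column_def sum_distrib_right)
  finally show "(transpose s ** A ** s) $ e $ e = (A *v column e s) \<bullet> column e s" .
qed

lemma sum_agent_noise:
  fixes f :: "'d::finite noise \<Rightarrow> real"
  shows "(\<Sum>j\<in>agent_noise k. f j) = f Common + (\<Sum>e\<in>UNIV. f (Idio k e)) + (\<Sum>e\<in>UNIV. f (Obs k e))"
proof -
  have "(\<Sum>j\<in>agent_noise k. f j) = f Common + (\<Sum>j\<in>range (Idio k) \<union> range (Obs k). f j)"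
    unfolding agent_noise_def by (subst sum.insert) auto
  also have "(\<Sum>j\<in>range (Idio k) \<union> range (Obs k). f j) = (\<Sum>j\<in>range (Idio k). f j) + (\<Sum>j\<in>range (Obs k). f j)"
    by (rule sum.union_disjoint) auto
  also have "(\<Sum>j\<in>range (Idio k). f j) = (\<Sum>e\<in>UNIV. f (Idio k e))"
    by (rule sum.reindex_cong[where l="Idio k"]) (auto simp: inj_on_def)
  also have "(\<Sum>j\<in>range (Obs k). f j) = (\<Sum>e\<in>UNIV. f (Obs k e))"
    by (rule sum.reindex_cong[where l="Obs k"]) (auto simp: inj_on_def)
  finally show ?thesis by simp
qed

text \<open>The last bracket is the integrand of the expected change of \<langle>P X, X\<rangle>.
  Expanded in the four vectors, the drift yields the terms in which \<open>P\<close> meets one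
  coefficient, the common noise those in which \<open>P\<close> stands between two diffusion
  coefficients, and the remaining noises the traces; collecting monomials gives the coefficients of
  \<open>cost_P\<close>.\<close>

lemma running_cost_identity:
  fixes c :: "('n::finite, 'm::finite, 'd::finite) lq_data"
  assumes Q: "transpose (Qc c t) = Qc c t" and R: "transpose (Rc c t) = Rc c t" and P: "transpose (P t) = P t"
  shows "(QP c P P' t *v x + 2 *\<^sub>R qP_tilde c P t + 2 *\<^sub>R (SP c P t *v v)) \<bullet> x
        + (RP c P t *v v + 2 *\<^sub>R rP_tilde c P t) \<bullet> v
        + (QP_tilde c P t *v xN) \<bullet> xN
        + 2 * ((QP_bar c P t *v x + rP_bar c P t *v v + qP_bar c P t) \<bullet> xN)
        + (RP_tilde c P t *v uN) \<bullet> uN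
        + 2 * ((QP_hat c P t *v x + rP_hat c P t *v v + qP_hat c P t) \<bullet> uN)
        + MP_tilde c P t
        + 2 * ((SP_tilde c P t *v uN) \<bullet> xN)
      = (Qc c t *v (x - alpha1 c *\<^sub>R xN) + 2 *\<^sub>R qc c t) \<bullet> (x - alpha1 c *\<^sub>R xN)
        + (Rc c t *v (v - beta1 c *\<^sub>R uN) + 2 *\<^sub>R rc c t) \<bullet> (v - beta1 c *\<^sub>R uN)
        + 2 * ((Sc c t *v (v - beta2 c *\<^sub>R uN)) \<bullet> (x - alpha2 c *\<^sub>R xN))
        + ((P' t *v x) \<bullet> x + (P t *v x) \<bullet> x_drift c t x v xN uN + (P t *v x_drift c t x v xN uN) \<bullet> x
          + ((P t *v x_diff0 c t x v xN uN) \<bullet> x_diff0 c t x v xN uN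
            + trace (transpose (sig c t) ** P t ** sig c t)
            + trace (transpose (sigbar c t) ** P t ** sigbar c t)))"
proof -
  \<comment> \<open>Once linearity has been used up, naming the bilinear forms turns the claim into
    commutative algebra in their values. The symmetry of \<open>p\<close>, \<open>q\<close> and
    \<open>r\<close> then merges mixed terms that occur in both orders.\<close>
  define p q r s where "p y z = (P t *v y) \<bullet> z" and "q y z = (Qc c t *v y) \<bullet> z" and "r y' z' = (Rc c t *v y') \<bullet> z'"
    and "s h z = (Sc c t *v h) \<bullet> z" for y z y' z' h
  have fold: "(P t *v y) \<bullet> z = p y z" "z \<bullet> (P t *v y) = p y z" "(Qc c t *v y) \<bullet> z = q y z"
    "(Rc c t *v y') \<bullet> z' = r y' z'" "(Sc c t *v h) \<bullet> z = s h z" "z \<bullet> (Sc c t *v h) = s h z" for y z y' z' h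
    by (simp_all add: p_def q_def r_def s_def inner_commute)
  have sym: "p y z = p z y" "q y z = q z y" "r y' z' = r z' y'" for y z y' z'
    unfolding p_def q_def r_def by (intro inner_symmetric_matrix P Q R)+
  have pl: "p (y + z) h = p y h + p z h" "p h (y + z) = p h y + p h z" for y z h
    by (simp_all add: p_def matrix_vector_right_distrib inner_add_left inner_add_right)
  have ql: "q (y - k *\<^sub>R z) h = q y h - k * q z h" "q h (y - k *\<^sub>R z) = q h y - k * q h z" for y z h k
    by (simp_all add: q_def matrix_vector_mult_diff_distrib matrix_vector_mult_scaleR inner_diff_left inner_diff_right)
  have rl: "r (y - k *\<^sub>R z) h = r y h - k * r z h" "r h (y - k *\<^sub>R z) = r h y - k * r h z" for y z h k
    by (simp_all add: r_def matrix_vector_mult_diff_distrib matrix_vector_mult_scaleR inner_diff_left inner_diff_right)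
  have sl: "s (y - k *\<^sub>R z) h = s y h - k * s z h" for y z h k
    by (simp add: s_def matrix_vector_mult_diff_distrib matrix_vector_mult_scaleR inner_diff_left)
  have sl2: "s h (y - k *\<^sub>R z) = s h y - k * s h z" for y z h k
    by (simp add: s_def inner_diff_right)
  have neg: "(- A) *v y = - (A *v y)" for A :: "real^'k^'l" and y
    by (simp add: vec_eq_iff matrix_vector_mult_def sum_negf)
  show ?thesis
    unfolding QP_def SP_def RP_def QP_tilde_def QP_bar_def qP_tilde_def qP_bar_def QP_hat_def SP_tilde_def
      RP_tilde_def rP_tilde_def rP_bar_def qP_hat_def rP_hat_def MP_tilde_def x_drift_def x_diff0_def
    apply (simp only: matrix_vector_mult_add_rdistrib matrix_vector_mult_diff_rdistrib neg
      scaleR_matrix_vector_assoc[symmetric] matrix_vector_mul_assoc[symmetric] inner_add_left inner_diff_left inner_minus_left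
      inner_scaleR_left inner_transpose_left fold pl ql rl sl sl2)
    apply (simp only: inner_diff_right inner_add_right inner_scaleR_right fold pl)
    using sym
    by (simp add: algebra_simps power2_eq_square)
qed

section \<open>Measurability and square integrability of vector-valued functions\<close>

lemma borel_measurable_vecI:
  fixes f :: "'a \<Rightarrow> real^'n"
  shows "(\<And>i. (\<lambda>x. f x $ i) \<in> borel_measurable N) \<Longrightarrow> f \<in> borel_measurable N"
  by (rule borel_measurable_euclidean_space[THEN iffD2]) (auto simp: Basis_vec_def inner_axis)

lemma borel_measurable_matrix_vector_mult:
  fixes A :: "'a \<Rightarrow> real^'m^'n" and y :: "'a \<Rightarrow> real^'m"
  assumes "A \<in> borel_measurable N" "y \<in> borel_measurable N"
  shows "(\<lambda>z. A z *v y z) \<in> borel_measurable N"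
  by (rule borel_measurable_vecI)
    (auto simp: matrix_vector_mult_def intro!: borel_measurable_sum borel_measurable_times borel_measurable_vec_nth assms)

text \<open>Measurability of \<open>k\<close> is a consequence: Lebesgue measure is complete, so a
  change on a null set does no harm. This serves the integrand of \<open>cost_P\<close>, which
  agrees with a measurable function at almost every time.\<close>

lemma integral_lebesgue_on_cong_AE:
  fixes h k :: "real \<Rightarrow> real"
  assumes S: "S \<in> sets lebesgue" and h: "h \<in> borel_measurable (lebesgue_on S)"
    and ae: "AE t in lebesgue_on S. h t = k t"
  shows "(LINT t|lebesgue_on S. k t) = (LINT t|lebesgue_on S. h t)"
proof (rule integral_cong_AE[OF _ h])
  have "(\<lambda>t. if t \<in> S then h t else 0) \<in> borel_measurable lebesgue"
    using h S by (simp add: borel_measurable_if)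
  moreover have "AE t in lebesgue. (if t \<in> S then h t else 0) = (if t \<in> S then k t else 0)"
    using ae S by (simp add: AE_restrict_space_iff)
  ultimately have "(\<lambda>t. if t \<in> S then k t else 0) \<in> borel_measurable lebesgue" by (rule borel_measurable_AE)
  then show "k \<in> borel_measurable (lebesgue_on S)" by (rule borel_measurable_if_D)
  show "AE t in lebesgue_on S. k t = h t" using ae by eventually_elim simp
qed

text \<open>Supports closure rules under sums, averages and essentially bounded coefficients, so
  that integrability of drift and cost follows from the shape of their terms.\<close>

definition L2_fun :: "'a measure \<Rightarrow> ('a \<Rightarrow> 'b::euclidean_space) \<Rightarrow> bool" where
  "L2_fun N Z \<longleftrightarrow> Z \<in> borel_measurable N \<and> in_L2 N (\<lambda>z. norm (Z z))"

lemma L2_fun_bound: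
  assumes "in_L2 N h" "Z \<in> borel_measurable N" "AE z in N. norm (Z z) \<le> \<bar>h z\<bar>"
  shows "L2_fun N Z"
  unfolding L2_fun_def using assms by (auto intro!: in_L2_bound[OF assms(1), of _ 1])

lemma L2_fun_add: "L2_fun N Y \<Longrightarrow> L2_fun N Z \<Longrightarrow> L2_fun N (\<lambda>z. Y z + Z z)"
proof -
  assume Y: "L2_fun N Y" and Z: "L2_fun N Z"
  show ?thesis
    by (rule L2_fun_bound[OF in_L2_add[of N "\<lambda>z. norm (Y z)" "\<lambda>z. norm (Z z)"]])
      (use Y Z in \<open>auto simp: L2_fun_def intro: order_trans[OF norm_triangle_ineq]\<close>)
qed

lemma L2_fun_scaleR: "L2_fun N Y \<Longrightarrow> L2_fun N (\<lambda>z. k *\<^sub>R Y z)"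
proof -
  assume Y: "L2_fun N Y"
  show ?thesis
    by (rule L2_fun_bound[OF in_L2_cmult[of N "\<lambda>z. norm (Y z)" k]])
      (use Y in \<open>auto simp: L2_fun_def abs_mult\<close>)
qed

lemma L2_fun_diff: "L2_fun N Y \<Longrightarrow> L2_fun N Z \<Longrightarrow> L2_fun N (\<lambda>z. Y z - Z z)"
  using L2_fun_add[of N Y "\<lambda>z. (-1) *\<^sub>R Z z"] L2_fun_scaleR[of N Z "-1"] by simp

lemma L2_fun_sum: "(\<And>i. i \<in> K \<Longrightarrow> L2_fun N (Y i)) \<Longrightarrow> L2_fun N (\<lambda>z. \<Sum>i\<in>K. Y i z)"
proof (induction K rule: infinite_finite_induct)
  case (insert i K)
  then show ?case using L2_fun_add[of N "Y i" "\<lambda>z. \<Sum>i\<in>K. Y i z"] by simp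
qed (auto simp: L2_fun_def in_L2_def)

lemma L2_fun_avg: "(\<And>k. k \<in> {1..n} \<Longrightarrow> L2_fun N (Y k)) \<Longrightarrow> L2_fun N (\<lambda>z. avg n (\<lambda>k. Y k z))"
  unfolding avg_def by (intro L2_fun_scaleR L2_fun_sum)

lemma L2_fun_mult:
  fixes A :: "'a \<Rightarrow> real^'m^'n" and Y :: "'a \<Rightarrow> real^'m"
  assumes A: "A \<in> borel_measurable N" "AE z in N. norm (A z) \<le> C" and Y: "L2_fun N Y"
  shows "L2_fun N (\<lambda>z. A z *v Y z)"
proof (rule L2_fun_bound[OF in_L2_cmult[of N "\<lambda>z. norm (Y z)" C]])
  show "AE z in N. norm (A z *v Y z) \<le> \<bar>C * norm (Y z)\<bar>"
    using A(2)
  proof eventually_elim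
    case (elim z)
    have "norm (A z *v Y z) \<le> norm (A z) * norm (Y z)" by (rule norm_matrix_vector_mult_le)
    also have "\<dots> \<le> C * norm (Y z)" using elim by (rule mult_right_mono) simp
    finally show ?case by simp
  qed
qed (use A Y in \<open>auto simp: L2_fun_def intro: borel_measurable_matrix_vector_mult\<close>)

lemma L2_fun_mult_const: "L2_fun N Y \<Longrightarrow> L2_fun N (\<lambda>z. A *v Y z)" for A :: "real^'m^'n"
  by (rule L2_fun_mult[where C="norm A"]) auto

lemma L2_fun_bounded:
  assumes "finite_measure N" "q \<in> borel_measurable N" "AE z in N. norm (q z) \<le> C"
  shows "L2_fun N q"
proof (rule L2_fun_bound[where h="\<lambda>_. C"])
  interpret finite_measure N by fact
  show "in_L2 N (\<lambda>_. C)" by (simp add: in_L2_def)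
qed (use assms in auto)

lemma L2_fun_inner:
  assumes "L2_fun N Y" "L2_fun N Z"
  shows "integrable N (\<lambda>z. Y z \<bullet> Z z)"
proof (rule Bochner_Integration.integrable_bound)
  show "integrable N (\<lambda>z. norm (Y z) * norm (Z z))"
    using assms by (intro in_L2_mult) (auto simp: L2_fun_def)
  show "AE z in N. norm (Y z \<bullet> Z z) \<le> norm (norm (Y z) * norm (Z z))"
    by (intro AE_I2) (simp add: Cauchy_Schwarz_ineq2)
qed (use assms in \<open>auto simp: L2_fun_def intro: borel_measurable_inner\<close>)

context brownian_setting
begin

text \<open>A null set of times stays null after multiplication with the whole probability
  space.\<close>

lemma AE_LM_fst:
  assumes "AE t in L. Q t" shows "AE z in LM. Q (fst z)"
proof -
  from AE_E3[OF assms] obtain S where S: "\<And>t. t \<in> space L - S \<Longrightarrow> Q t" "S \<in> null_sets L" by auto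
  have "S \<times> space M \<in> null_sets LM" using S(2) by (rule times_in_null_sets1) simp
  then show ?thesis
  proof (rule AE_I')
    show "{z \<in> space LM. \<not> Q (fst z)} \<subseteq> S \<times> space M"
      unfolding space_pair_measure using S(1) by fastforce
  qed
qed

lemma Linf_LM:
  assumes "Linf T A"
  obtains C where "(\<lambda>z. A (fst z)) \<in> borel_measurable LM" "AE z in LM. norm (A (fst z)) \<le> C"
proof -
  from assms obtain C where m: "A \<in> borel_measurable L" and C: "AE t in L. norm (A t) \<le> C"
    by (auto simp: Linf_def)
  show ?thesis
    by (rule that[OF measurable_compose[OF measurable_fst m] AE_LM_fst[OF C]])
qed

lemma L2_fun_Linf_mult: "Linf T A \<Longrightarrow> L2_fun LM Y \<Longrightarrow> L2_fun LM (\<lambda>z. A (fst z) *v Y z)"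
  for A :: "real \<Rightarrow> real^'m^'n"
  by (erule Linf_LM) (rule L2_fun_mult)

lemma L2_fun_Linf: "Linf T q \<Longrightarrow> L2_fun LM (\<lambda>z. q (fst z))"
  by (erule Linf_LM) (rule L2_fun_bounded[OF LM.finite_measure_axioms])

lemma L2_fun_LM_sup_sq_finite:
  assumes "case_prod X \<in> borel_measurable LM" "sup_sq_finite M T X"
  shows "L2_fun LM (\<lambda>z. X (fst z) (snd z))"
  using assms sup_sq_finite_in_L2[OF assms] by (simp add: L2_fun_def case_prod_unfold)

lemma L2_fun_sup_sq_finite:
  assumes "X t \<in> borel_measurable M" "sup_sq_finite M T X" "0 \<le> t" "t \<le> T"
  shows "L2_fun M (X t)"
proof (rule sup_sq_finite_bound[OF assms(2)])
  fix C assume "\<And>t. 0 \<le> t \<Longrightarrow> t \<le> T \<Longrightarrow> (\<integral>\<^sup>+w. ennreal ((norm (X t w))\<^sup>2) \<partial>M) \<le> ennreal C"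
  from this[OF assms(3,4)] have "(\<integral>\<^sup>+w. ennreal ((norm (X t w))\<^sup>2) \<partial>M) < \<infinity>" by (rule le_less_trans) simp
  then show ?thesis using assms(1) by (simp add: L2_fun_def in_L2_iff_nn)
qed

end

theorem lemma5p5:
  fixes T :: real
    and M :: "'w measure"
    and \<F> :: "real \<Rightarrow> 'w measure"
    and B :: "'d::finite noise \<Rightarrow> real \<Rightarrow> 'w \<Rightarrow> real"
    and c :: "('n::finite, 'm::finite, 'd) lq_data"
    and P P' \<pi> \<Sigma> :: "real \<Rightarrow> real^'n^'n"
    and \<rho> :: "real \<Rightarrow> real^'n"
    and N i :: nat
    and x :: "real^'n"
    and \<theta> :: "real \<Rightarrow> 'w \<Rightarrow> real"
    and x0 :: "real \<Rightarrow> 'w \<Rightarrow> real^'n"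
    and Xb Yb X0 Y0 X Y :: "nat \<Rightarrow> real \<Rightarrow> 'w \<Rightarrow> real^'n"
    and ub :: "nat \<Rightarrow> real \<Rightarrow> 'w \<Rightarrow> real^'m"
    and u :: "real \<Rightarrow> 'w \<Rightarrow> real^'m"
  assumes "0 \<le> T"
    and "filtered_space M \<F> T"
    and "brownian_family M \<F> T (all_noise N) B"
    and "H1 T c" and "H2 T c"
    and "relaxed_compensator T c P P'"
    and "Pi_solution T c \<pi>"
    and "Sigma_solution T c \<Sigma>"
    and "\<And>\<Sigma>'. Sigma_solution T c \<Sigma>' \<Longrightarrow> \<forall>t\<in>{0..T}. \<Sigma>' t = \<Sigma> t"
    and "rho_solution T c \<Sigma> \<rho>"
    and "theta_eq M \<F> T B c \<theta>"
    and "x_zero_eq M \<F> T B c \<Sigma> \<rho> x x0"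
    and "1 \<le> i" and "i \<le> N"
    and "\<And>j. j \<in> {1..N} - {i} \<Longrightarrow>
           decentralized_strategy M \<F> T B c x \<theta> \<pi> \<Sigma> \<rho> x0 j Xb Yb ub"
    and "uncontrolled_eqs M \<F> T B c N x X0 Y0"
    and "state_eqs M \<F> T B c N x (ub(i := u)) X Y"
    and "admissible_c M T N \<theta> Y0 Y u"
  shows "cost M T c N i X (ub(i := u))
       = cost_P M T c P P' N i X (ub(i := u)) + 1/2 * ((P 0 *v x) \<bullet> x)"
proof -
  define U where "U = ub(i := u)"
  have bs: "brownian_setting M \<F> T (all_noise N) B"
    using assms(1-3) by (simp add: brownian_setting_def brownian_setting_axioms_def filtered_space_def)
  interpret brownian_setting M \<F> T "all_noise N" B by (rule bs)
  have i: "i \<in> {1..N}" using assms by simp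
  have noise: "finite (agent_noise i :: 'd noise set)" "(agent_noise i :: 'd noise set) \<subseteq> all_noise N"
    using i by (auto simp: agent_noise_def all_noise_def)
  have H1: "Linf T (Ac c)" "Linf T (Abar c)" "Linf T (Dc c)" "Linf T (Dbar c)" "Linf T (bc c)" "Linf T (bbar c)"
      "Linf T (Bc c)" "Linf T (Bbar c)" "Linf T (Fc c)" "Linf T (Fbar c)"
    using assms(4) by (auto simp: H1_def)
  have H2: "Linf T (Qc c)" "Linf T (Rc c)" "Linf T (Sc c)" "Linf T (qc c)" "Linf T (rc c)"
      "AE t in L. transpose (Qc c t) = Qc c t" "AE t in L. transpose (Rc c t) = Rc c t" "transpose (LT c) = LT c"
    using assms(5) by (auto simp: H2_def)
  have P: "abs_cont_deriv T P P'" "\<And>t. t \<in> {0..T} \<Longrightarrow> transpose (P t) = P t"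
    using assms(6) by (auto simp: relaxed_compensator_def)
  have X: "ito_process M \<F> T B (agent_noise k) x
       (\<lambda>t w. x_drift c t (X k t w) (U k t w) (avg N (\<lambda>j. X j t w)) (avg N (\<lambda>j. U j t w)))
       (state_coef c
         (\<lambda>t w. x_diff0 c t (X k t w) (U k t w) (avg N (\<lambda>j. X j t w)) (avg N (\<lambda>j. U j t w))))
       (X k)" if "k \<in> {1..N}" for k
    using assms(17) that unfolding state_eqs_def U_def by blast
  have Xm: "meas_adapted M \<F> T (X k)" "sup_sq_finite M T (X k)" if "k \<in> {1..N}" for k
    using X[OF that] unfolding ito_process_def by blast+
  have X2: "L2_fun LM (\<lambda>z. X k (fst z) (snd z))" if "k \<in> {1..N}" for k
    by (rule L2_fun_LM_sup_sq_finite[OF meas_adapted_case_prod Xm(2)[OF that]]) (rule Xm(1)[OF that])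
  have XT2: "L2_fun M (X k T)" if "k \<in> {1..N}" for k
    by (rule L2_fun_sup_sq_finite[OF meas_adapted_measurable[OF Xm(1)] Xm(2)]) (use that T_nonneg in auto)
  \<comment> \<open>Admissibility gives the moments of the deviating control \<open>u\<close>; those
    of the other controls come from the feedback relation.\<close>
  have U2: "L2_fun LM (\<lambda>z. U k (fst z) (snd z))" if k: "k \<in> {1..N}" for k
  proof (cases "k = i")
    case True
    have "case_prod u \<in> borel_measurable LM" "sup_sq_finite M T u"
      using assms(18) by (auto simp: admissible_c_def meas_adapted_def)
    then show ?thesis using L2_fun_LM_sup_sq_finite[of u] True by (simp add: U_def)
  next
    case False
    then have ds: "decentralized_strategy M \<F> T B c x \<theta> \<pi> \<Sigma> \<rho> x0 k Xb Yb ub" using assms(15) k by simp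
    have "meas_adapted M \<F> T (ub k)" using ds by (simp add: decentralized_strategy_def Let_def)
    then have "case_prod (ub k) \<in> borel_measurable LM" by (rule meas_adapted_case_prod)
    with decentralized_strategy_in_L2[OF bs assms(4,5,7,8,10-12) ds]
    show ?thesis using False by (simp add: L2_fun_def U_def case_prod_unfold)
  qed
  define xN uN where "xN t w = avg N (\<lambda>k. X k t w)" and "uN t w = avg N (\<lambda>k. U k t w)" for t w
  have xN2: "L2_fun LM (\<lambda>z. xN (fst z) (snd z))" and uN2: "L2_fun LM (\<lambda>z. uN (fst z) (snd z))"
    unfolding xN_def uN_def by (intro L2_fun_avg X2 U2; assumption)+
  have xNT2: "L2_fun M (xN T)" unfolding xN_def[abs_def] by (intro L2_fun_avg XT2)
  note L2 = X2[OF i] U2[OF i] xN2 uN2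
  define a where "a t w = x_drift c t (X i t w) (U i t w) (xN t w) (uN t w)" for t w
  define d where "d t w = x_diff0 c t (X i t w) (U i t w) (xN t w) (uN t w)" for t w
  \<comment> \<open>The drift of agent \<open>i\<close> contains the averages of all states and
    controls, hence the preceding bounds for every agent.\<close>
  have "L2_fun LM (\<lambda>z. a (fst z) (snd z))"
    unfolding a_def x_drift_def by (intro L2_fun_add L2_fun_Linf_mult L2_fun_Linf H1 L2)
  then have a2: "in_L2 LM (\<lambda>(t, w). norm (a t w))" by (simp add: L2_fun_def case_prod_unfold)
  have Xi: "ito_process M \<F> T B (agent_noise i) x a (state_coef c d) (X i)"
    using X[OF i] unfolding a_def[abs_def] d_def[abs_def] xN_def uN_def .
  define g where "g t w = (P' t *v X i t w) \<bullet> X i t w + (P t *v X i t w) \<bullet> a t w + (P t *v a t w) \<bullet> X i t w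
      + (\<Sum>j\<in>agent_noise i. (P t *v state_coef c d j t w) \<bullet> state_coef c d j t w)" for t w
  note ito = expectation_quadratic_ito[OF noise Xi a2 P(1), folded g_def]
  define f where "f t w = (Qc c t *v (X i t w - alpha1 c *\<^sub>R xN t w) + 2 *\<^sub>R qc c t) \<bullet> (X i t w - alpha1 c *\<^sub>R xN t w)
        + (Rc c t *v (U i t w - beta1 c *\<^sub>R uN t w) + 2 *\<^sub>R rc c t) \<bullet> (U i t w - beta1 c *\<^sub>R uN t w)
        + 2 * ((Sc c t *v (U i t w - beta2 c *\<^sub>R uN t w)) \<bullet> (X i t w - alpha2 c *\<^sub>R xN t w))" for t w
  define fT where "fT w = (LT c *v (X i T w - alpha3 c *\<^sub>R xN T w) + 2 *\<^sub>R lT c) \<bullet> (X i T w - alpha3 c *\<^sub>R xN T w)" for w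
  define fP where "fP t w = (QP c P P' t *v X i t w + 2 *\<^sub>R qP_tilde c P t + 2 *\<^sub>R (SP c P t *v U i t w)) \<bullet> X i t w
        + (RP c P t *v U i t w + 2 *\<^sub>R rP_tilde c P t) \<bullet> U i t w
        + (QP_tilde c P t *v xN t w) \<bullet> xN t w
        + 2 * ((QP_bar c P t *v X i t w + rP_bar c P t *v U i t w + qP_bar c P t) \<bullet> xN t w)
        + (RP_tilde c P t *v uN t w) \<bullet> uN t w
        + 2 * ((QP_hat c P t *v X i t w + rP_hat c P t *v U i t w + qP_hat c P t) \<bullet> uN t w)
        + MP_tilde c P t
        + 2 * ((SP_tilde c P t *v uN t w) \<bullet> xN t w)" for t w
  define fPT where "fPT w = (LP c P T *v X i T w + 2 *\<^sub>R lT c) \<bullet> X i T w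
        - 2 * alpha3 c * ((LT c *v X i T w + lT c) \<bullet> xN T w)
        + (alpha3 c)\<^sup>2 * ((LT c *v xN T w) \<bullet> xN T w)" for w
  have f_int: "integrable LM (case_prod f)"
    unfolding case_prod_unfold f_def
    by (intro Bochner_Integration.integrable_add integrable_mult_right L2_fun_inner L2_fun_add L2_fun_diff
        L2_fun_scaleR L2_fun_Linf_mult L2_fun_Linf H2 L2)
  have fT_int: "integrable M fT"
  proof -
    have "L2_fun M (\<lambda>_. lT c)"
      by (rule L2_fun_bounded[OF finite_measure_axioms, where C="norm (lT c)"]) auto
    then show ?thesis unfolding fT_def[abs_def]
      by (intro L2_fun_inner L2_fun_add L2_fun_diff L2_fun_scaleR L2_fun_mult_const XT2[OF i] xNT2)
  qed
  \<comment> \<open>Exceptional times are only those at which \<open>Qc c\<close> or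
    \<open>Rc c\<close> fails to be symmetric. They do not depend on the outcome, so the identity
    holds for all \<open>w\<close> at once.\<close>
  have fP_eq: "AE t in L. \<forall>w. f t w + g t w = fP t w"
    using H2(6,7) AE_space
  proof eventually_elim
    case (elim t)
    then have "transpose (P t) = P t" using P(2) by simp
    from running_cost_identity[where P=P and t=t, OF elim(1,2) this] show ?case
      by (simp add: fP_def f_def g_def a_def d_def sum_agent_noise trace_transpose_mult_mult)
  qed
  \<comment> \<open>\<open>LP\<close> differs from \<open>LT\<close> by the terminal value of
    \<open>P\<close>, and the symmetry of \<open>LT\<close> merges the two mixed terms into the
    factor 2 of \<open>cost_P\<close>.\<close>
  have fPT_eq: "fPT w = fT w - (P T *v X i T w) \<bullet> X i T w" for w
  proof -
    have "(LT c *v y) \<bullet> z = (LT c *v z) \<bullet> y" for y z by (rule inner_symmetric_matrix[OF H2(8)])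
    from this[of "xN T w" "X i T w"] show ?thesis
      by (simp add: fPT_def fT_def LP_def matrix_vector_mult_diff_rdistrib matrix_vector_mult_diff_distrib
        matrix_vector_mult_scaleR inner_add_left inner_diff_left inner_diff_right power2_eq_square algebra_simps)
  qed
  have fg_int: "integrable LM (\<lambda>(t, w). f t w + g t w)"
    using Bochner_Integration.integrable_add[OF f_int ito(2)] by (simp add: case_prod_unfold)
  \<comment> \<open>The integrand of \<open>cost_P\<close> is compared with \<open>f + g\<close> for
    each fixed outcome, so that joint integrability is taken from the latter.\<close>
  have inner: "(LINT t|L. fP t w) = (LINT t|L. f t w + g t w)" if "w \<in> space M" for w
  proof (rule integral_lebesgue_on_cong_AE)
    show "(\<lambda>t. f t w + g t w) \<in> borel_measurable L"
      using measurable_Pair1[OF borel_measurable_integrable[OF fg_int] that] by simp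
    show "AE t in L. f t w + g t w = fP t w" using fP_eq by eventually_elim simp
  qed simp
  \<comment> \<open>By \<open>ito(3)\<close> the integral of \<open>g\<close> and the expected
    terminal quadratic form differ exactly by the initial value, which alone survives.\<close>
  have "expectation (\<lambda>w. (LINT t|L. fP t w) + fPT w)
    = expectation (\<lambda>w. (LINT t|L. f t w + g t w) + (fT w - (P T *v X i T w) \<bullet> X i T w))"
    by (intro Bochner_Integration.integral_cong refl) (simp add: inner fPT_eq)
  also have "\<dots> = (\<integral>(t, w). f t w + g t w \<partial>LM) + (expectation fT - expectation (\<lambda>w. (P T *v X i T w) \<bullet> X i T w))"
    using LM.integrable_snd[OF fg_int] LM.integral_snd[OF fg_int] fT_int ito(1) by simp
  also have "(\<integral>(t, w). f t w + g t w \<partial>LM) = (\<integral>z. case_prod f z \<partial>LM) + (\<integral>z. case_prod g z \<partial>LM)"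
    using Bochner_Integration.integral_add[OF f_int ito(2)] by (simp add: case_prod_unfold)
  finally have costP: "expectation (\<lambda>w. (LINT t|L. fP t w) + fPT w)
    = (\<integral>z. case_prod f z \<partial>LM) + expectation fT - (P 0 *v x) \<bullet> x"
    unfolding ito(3) by simp
  have cost: "expectation (\<lambda>w. (LINT t|L. f t w) + fT w) = (\<integral>z. case_prod f z \<partial>LM) + expectation fT"
    using LM.integrable_snd[OF f_int] LM.integral_snd[OF f_int] fT_int by simp
  have "cost M T c N i X U = 1/2 * expectation (\<lambda>w. (LINT t|L. f t w) + fT w)"
    unfolding cost_def Let_def f_def fT_def xN_def uN_def ..
  moreover have "cost_P M T c P P' N i X U = 1/2 * expectation (\<lambda>w. (LINT t|L. fP t w) + fPT w)"
    unfolding cost_P_def Let_def fP_def fPT_def xN_def uN_def ..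
  ultimately show ?thesis unfolding U_def[symmetric] cost costP by (simp add: field_simps)
qed

end
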